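(* For all $p,q,a,b,c\in\mathbb{N}$, the identity $\mathcal{S}_{H}(p,q,a,b,c;s)=\tfrac14(J_0-J_1+J_2-J_3)$ holds (for $s\in\mathbb{C}$ except for singularities of the functions on both sides), where $H(\mathbf{s})=\zeta_3(\mathbf{s},\mathbf{0};PU(4))$ and $J_0,J_1,J_2,J_3$ are as in the context.
   Context: For $\mathbf{s}=(s_1,\dots,s_6)\in\mathbb{C}^6$, $\zeta_3(\mathbf{s},\mathbf{0};PU(4))=\sum_{l,m,n\ge1,\ l+2m+3n\equiv2\ (\mathrm{mod}\ 4)}\frac{1}{l^{s_1}m^{s_2}n^{s_3}(l+m)^{s_4}(m+n)^{s_5}(l+m+n)^{s_6}}$ (convergent for real parts large, meromorphically continued to $\mathbb{C}^6$). For a function $F$ of six complex variables define $\mathcal{S}_F(p,q,a,b,c;s)=F(p,q,s,a,b,c)+(-1)^pF(p,a,s,q,c,b)+(-1)^{p+a}F(q,a,c,p,s,b)+(-1)^{p+a+c}F(q,s,c,b,a,p)+(-1)^{q}F(a,q,b,p,s,c)+(-1)^{q+b}F(a,s,b,c,q,p)+(-1)^{q+a}F(a,p,b,q,c,s)+(-1)^{q+a+b}F(a,c,b,s,p,q)+(-1)^{q+a+b+c}F(s,c,p,a,b,q)+(-1)^{p+q+a}F(q,p,c,a,b,s)+(-1)^{p+q+a+c}F(q,b,c,s,p,a)+(-1)^{p+q+a+b+c}F(s,b,p,q,c,a)$. For $p,q\in\mathbb{N}$, $|x|,|y|\le1$, $s>1$: $\mathfrak{T}(p,s,q;x,y)=\sum_{l\in\mathbb{Z}\setminus\{0\},\,m\ge1,\,l+m\neq0}\frac{x^ly^m}{l^pm^s(l+m)^q}$,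 regarded as meromorphic in $s$; write $\mathfrak{T}(\cdot,\cdot,\cdot;(x,y))=\mathfrak{T}(\cdot,\cdot,\cdot;x,y)$. $\zeta$ is the Riemann zeta-function ($\zeta(0)=-1/2$), $\phi(s)=(2^{1-s}-1)\zeta(s)$, $L(s,\chi_4)=\sum_{m\ge0}(-1)^m(2m+1)^{-s}$; for $k,l\in\mathbb{N}_0$: $\varLambda(2k;\pm i)=2^{1-2k}(2^{1-2k}-1)\zeta(2k)$, $\varLambda(2l+1;i)=2iL(2l+1,\chi_4)$, $\varLambda(2l+1;-i)=-2iL(2l+1,\chi_4)$. $[x]$ is the integer part. For $\psi\in\{\zeta,\phi\}$: $R(\psi;u_1,u_2,u_3,u_4)=2(-1)^{p}\sum_{j=0}^{[p/2]}\psi(2j)\sum_{\omega=0}^{p-2j}\binom{\omega+a-1}{\omega}\binom{p+c-2j-\omega-1}{c-1}\mathfrak{T}(q+a+\omega,s,p+b+c-2j-\omega;u_1)+2(-1)^{p+a}\sum_{j=0}^{[c/2]}\psi(2j)\sum_{\omega=0}^{c-2j}\binom{\omega+a-1}{\omega}\binom{p+c-2j-\omega-1}{p-1}\mathfrak{T}(q,s+a+\omega,p+b+c-2j-\omega;u_2)+2(-1)^p\sum_{j=0}^{[a/2]}\psi(2j)\sum_{\omega=0}^{p-1}\binom{\omega+a-2j}{\omega}\binom{p+c-2-\omega}{c-1}\mathfrak{T}(q+a-2j+\omega+1,s,p+b+c-1-\omega;u_3)+2(-1)^{p+a}\sum_{j=0}^{[a/2]}\psi(2j)\sum_{\omega=0}^{c-1}\binom{\omega+a-2j}{\omega}\binom{p+c-2-\omega}{p-1}\mathfrak{T}(q,s+a-2j+\omega+1,p+b+c-1-\omega;u_4)$.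 For $\epsilon\in\{i,-i\}$: $K(\epsilon;u_1,u_2,u_3,u_4)=(-1)^p\sum_{j=0}^{p}\varLambda(j;\epsilon)(-1)^j\sum_{\omega=0}^{p-j}\binom{\omega+a-1}{\omega}\binom{p+c-j-\omega-1}{c-1}\mathfrak{T}(q+a+\omega,s,p+b+c-j-\omega;u_1)+(-1)^{p+a}\sum_{j=0}^{c}\varLambda(j;\epsilon)\sum_{\omega=0}^{c-j}\binom{\omega+a-1}{\omega}\binom{p+c-j-\omega-1}{p-1}\mathfrak{T}(q,s+a+\omega,p+b+c-j-\omega;u_2)+(-1)^p\sum_{j=0}^{a}\varLambda(j;\epsilon)\sum_{\omega=0}^{p-1}\binom{\omega+a-j}{\omega}\binom{p+c-2-\omega}{c-1}\mathfrak{T}(q+a-j+\omega+1,s,p+b+c-1-\omega;u_3)+(-1)^{p+a}\sum_{j=0}^{a}\varLambda(j;\epsilon)(-1)^j\sum_{\omega=0}^{c-1}\binom{\omega+a-j}{\omega}\binom{p+c-2-\omega}{p-1}\mathfrak{T}(q,s+a-j+\omega+1,p+b+c-1-\omega;u_4)$. Then $J_0=R(\zeta;(1,1),(1,1),(1,1),(1,1))$, $J_2=R(\phi;(1,-1),(-1,1),(-1,-1),(-1,-1))$, $J_1=K(-i;(-1,i),(-i,-1),(-i,i),(-i,i))$, $J_3=K(i;(-1,-i),(i,-1),(i,-i),(i,-i))$. *)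

theory Defs
  imports "HOL-Complex_Analysis.Complex_Analysis"
begin

text \<open>
  Meromorphic functions of several complex variables, on all of \<open>\<complex>\<^sup>n\<close>: locally quotients of
  holomorphic functions. The value at a point where the denominator vanishes is unconstrained,
  so statements about values have to be restricted to points of \<open>mv_holomorphic_at\<close>.
\<close>

definition mv_holomorphic_on :: "(complex^'n \<Rightarrow> complex) \<Rightarrow> (complex^'n) set \<Rightarrow> bool" where
  "mv_holomorphic_on f U \<longleftrightarrow>
     (\<forall>z\<in>U. \<exists>D :: complex^'n. (f has_derivative (\<lambda>h. \<Sum>i\<in>UNIV. D $ i * h $ i)) (at z))"

definition mv_holomorphic_at :: "(complex^'n \<Rightarrow> complex) \<Rightarrow> complex^'n \<Rightarrow> bool" where
  "mv_holomorphic_at f z \<longleftrightarrow> (\<exists>U. open U \<and> z \<in> U \<and> mv_holomorphic_on f U)"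

definition mv_meromorphic :: "(complex^'n \<Rightarrow> complex) \<Rightarrow> bool" where
  "mv_meromorphic f \<longleftrightarrow>
     (\<forall>z. \<exists>U g h. open U \<and> connected U \<and> z \<in> U \<and>
        mv_holomorphic_on g U \<and> mv_holomorphic_on h U \<and>
        (\<exists>w\<in>U. h w \<noteq> 0) \<and> (\<forall>w\<in>U. h w \<noteq> 0 \<longrightarrow> f w = g w / h w))"

definition PU4_index :: "(nat \<times> nat \<times> nat) set" where
  "PU4_index = {(l, m, n). 1 \<le> l \<and> 1 \<le> m \<and> 1 \<le> n \<and> (l + 2 * m + 3 * n) mod 4 = 2}"

definition zeta3_term :: "complex^6 \<Rightarrow> nat \<times> nat \<times> nat \<Rightarrow> complex" where
  "zeta3_term z = (\<lambda>(l, m, n).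
     1 / (of_nat l powr (z $ 1) * of_nat m powr (z $ 2) * of_nat n powr (z $ 3) *
          of_nat (l + m) powr (z $ 4) * of_nat (m + n) powr (z $ 5) *
          of_nat (l + m + n) powr (z $ 6)))"

text \<open>
  \<open>H\<close> is the meromorphic continuation to \<open>\<complex>\<^sup>6\<close> of the zeta-function of \<open>PU(4)\<close>: it agrees with
  the series wherever the latter converges absolutely. This determines \<open>H\<close> at every point
  at which it is holomorphic.
\<close>

definition is_zeta3_PU4 :: "(complex^6 \<Rightarrow> complex) \<Rightarrow> bool" where
  "is_zeta3_PU4 H \<longleftrightarrow> mv_meromorphic H \<and>
     (\<forall>z. zeta3_term z summable_on PU4_index \<longrightarrow> H z = infsum (zeta3_term z) PU4_index)"

lemma vector_6:
  "(vector [z1, z2, z3, z4, z5, z6] :: ('a::zero)^6) $ 1 = z1"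
  "(vector [z1, z2, z3, z4, z5, z6] :: ('a::zero)^6) $ 2 = z2"
  "(vector [z1, z2, z3, z4, z5, z6] :: ('a::zero)^6) $ 3 = z3"
  "(vector [z1, z2, z3, z4, z5, z6] :: ('a::zero)^6) $ 4 = z4"
  "(vector [z1, z2, z3, z4, z5, z6] :: ('a::zero)^6) $ 5 = z5"
  "(vector [z1, z2, z3, z4, z5, z6] :: ('a::zero)^6) $ 6 = z6"
  unfolding vector_def by simp_all

text \<open>
  Exponents \<open>e\<close> of the signs and arguments \<open>v\<close> of the twelve summands \<open>(-1)\<^sup>e F(v)\<close>.
\<close>

definition S_terms ::
    "nat \<Rightarrow> nat \<Rightarrow> nat \<Rightarrow> nat \<Rightarrow> nat \<Rightarrow> complex \<Rightarrow> (nat \<times> (complex^6)) list" where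
  "S_terms p q a b c s =
     (let P = of_nat p; Q = of_nat q; A = of_nat a; B = of_nat b; C = of_nat c in
       [(0,                 vector [P, Q, s, A, B, C]),
        (p,                 vector [P, A, s, Q, C, B]),
        (p + a,             vector [Q, A, C, P, s, B]),
        (p + a + c,         vector [Q, s, C, B, A, P]),
        (q,                 vector [A, Q, B, P, s, C]),
        (q + b,             vector [A, s, B, C, Q, P]),
        (q + a,             vector [A, P, B, Q, C, s]),
        (q + a + b,         vector [A, C, B, s, P, Q]),
        (q + a + b + c,     vector [s, C, P, A, B, Q]),
        (p + q + a,         vector [Q, P, C, A, B, s]),
        (p + q + a + c,     vector [Q, B, C, s, P, A]),
        (p + q + a + b + c, vector [s, B, P, Q, C, A])])"

definition S_sum ::
    "(complex^6 \<Rightarrow> complex) \<Rightarrow> nat \<Rightarrow> nat \<Rightarrow> nat \<Rightarrow> nat \<Rightarrow> nat \<Rightarrow> complex \<Rightarrow> complex" where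
  "S_sum F p q a b c s = (\<Sum>(e, v)\<leftarrow>S_terms p q a b c s. (-1) ^ e * F v)"

text \<open>
  The meromorphic continuation to \<open>\<complex>\<close> of a function given on the half-plane \<open>Re s > 1\<close>. It is
  unique, because the library's \<open>nicely_meromorphic_on\<close> fixes the value \<open>0\<close> at poles and
  excludes removable singularities.
\<close>

definition merom_ext :: "(complex \<Rightarrow> complex) \<Rightarrow> complex \<Rightarrow> complex" where
  "merom_ext f = (SOME F. F nicely_meromorphic_on UNIV \<and> (\<forall>s. Re s > 1 \<longrightarrow> F s = f s))"

definition riemann_zeta :: "complex \<Rightarrow> complex" where
  "riemann_zeta = merom_ext (\<lambda>s. \<Sum>n. 1 / of_nat (Suc n) powr s)"

definition phi :: "complex \<Rightarrow> complex" where
  "phi s = (2 powr (1 - s) - 1) * riemann_zeta s"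

text \<open>Only needed for positive odd \<open>s\<close>; at \<open>s = 1\<close> the series converges conditionally.\<close>

definition L_chi4 :: "complex \<Rightarrow> complex" where
  "L_chi4 s = (\<Sum>m. (-1) ^ m / of_nat (2 * m + 1) powr s)"

text \<open>Only meaningful for \<open>\<epsilon> \<in> {\<i>, -\<i>}\<close>.\<close>

definition Lambda :: "nat \<Rightarrow> complex \<Rightarrow> complex" where
  "Lambda j \<epsilon> =
     (if even j then 2 powi (1 - int j) * (2 powi (1 - int j) - 1) * riemann_zeta (of_nat j)
      else if \<epsilon> = \<i> then 2 * \<i> * L_chi4 (of_nat j)
      else - 2 * \<i> * L_chi4 (of_nat j))"

text \<open>
  The double series converges absolutely for \<open>p, q \<ge> 1\<close>, \<open>\<bar>x\<bar> = \<bar>y\<bar> = 1\<close> and \<open>Re s > 1\<close>; below,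
  \<open>x\<close> and \<open>y\<close> are always fourth roots of unity.
\<close>

definition frakT :: "nat \<Rightarrow> complex \<Rightarrow> nat \<Rightarrow> complex \<times> complex \<Rightarrow> complex" where
  "frakT p s q = (\<lambda>(x, y). merom_ext (\<lambda>s.
     \<Sum>\<^sub>\<infinity>(l, m)\<in>{(l :: int, m :: nat). l \<noteq> 0 \<and> 1 \<le> m \<and> l + int m \<noteq> 0}.
       x powi l * y ^ m / (of_int l ^ p * of_nat m powr s * of_int (l + int m) ^ q)) s)"

definition R_sum ::
    "(complex \<Rightarrow> complex) \<Rightarrow> nat \<Rightarrow> nat \<Rightarrow> nat \<Rightarrow> nat \<Rightarrow> nat \<Rightarrow> complex \<Rightarrow>
     complex \<times> complex \<Rightarrow> complex \<times> complex \<Rightarrow> complex \<times> complex \<Rightarrow> complex \<times> complex \<Rightarrow> complex"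
  where
  "R_sum \<psi> p q a b c s u1 u2 u3 u4 =
     2 * (-1) ^ p * (\<Sum>j\<le>p div 2. \<psi> (of_nat (2 * j)) *
       (\<Sum>\<omega>\<le>p - 2 * j. of_nat ((\<omega> + a - 1) choose \<omega>) *
          of_nat ((p + c - 2 * j - \<omega> - 1) choose (c - 1)) *
          frakT (q + a + \<omega>) s (p + b + c - 2 * j - \<omega>) u1))
   + 2 * (-1) ^ (p + a) * (\<Sum>j\<le>c div 2. \<psi> (of_nat (2 * j)) *
       (\<Sum>\<omega>\<le>c - 2 * j. of_nat ((\<omega> + a - 1) choose \<omega>) *
          of_nat ((p + c - 2 * j - \<omega> - 1) choose (p - 1)) *
          frakT q (s + of_nat (a + \<omega>)) (p + b + c - 2 * j - \<omega>) u2))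
   + 2 * (-1) ^ p * (\<Sum>j\<le>a div 2. \<psi> (of_nat (2 * j)) *
       (\<Sum>\<omega>\<le>p - 1. of_nat ((\<omega> + a - 2 * j) choose \<omega>) *
          of_nat ((p + c - 2 - \<omega>) choose (c - 1)) *
          frakT (q + a - 2 * j + \<omega> + 1) s (p + b + c - 1 - \<omega>) u3))
   + 2 * (-1) ^ (p + a) * (\<Sum>j\<le>a div 2. \<psi> (of_nat (2 * j)) *
       (\<Sum>\<omega>\<le>c - 1. of_nat ((\<omega> + a - 2 * j) choose \<omega>) *
          of_nat ((p + c - 2 - \<omega>) choose (p - 1)) *
          frakT q (s + of_nat (a - 2 * j + \<omega> + 1)) (p + b + c - 1 - \<omega>) u4))"

definition K_sum ::
    "complex \<Rightarrow> nat \<Rightarrow> nat \<Rightarrow> nat \<Rightarrow> nat \<Rightarrow> nat \<Rightarrow> complex \<Rightarrow>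
     complex \<times> complex \<Rightarrow> complex \<times> complex \<Rightarrow> complex \<times> complex \<Rightarrow> complex \<times> complex \<Rightarrow> complex"
  where
  "K_sum \<epsilon> p q a b c s u1 u2 u3 u4 =
     (-1) ^ p * (\<Sum>j\<le>p. Lambda j \<epsilon> * (-1) ^ j *
       (\<Sum>\<omega>\<le>p - j. of_nat ((\<omega> + a - 1) choose \<omega>) *
          of_nat ((p + c - j - \<omega> - 1) choose (c - 1)) *
          frakT (q + a + \<omega>) s (p + b + c - j - \<omega>) u1))
   + (-1) ^ (p + a) * (\<Sum>j\<le>c. Lambda j \<epsilon> *
       (\<Sum>\<omega>\<le>c - j. of_nat ((\<omega> + a - 1) choose \<omega>) *
          of_nat ((p + c - j - \<omega> - 1) choose (p - 1)) *
          frakT q (s + of_nat (a + \<omega>)) (p + b + c - j - \<omega>) u2))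
   + (-1) ^ p * (\<Sum>j\<le>a. Lambda j \<epsilon> *
       (\<Sum>\<omega>\<le>p - 1. of_nat ((\<omega> + a - j) choose \<omega>) *
          of_nat ((p + c - 2 - \<omega>) choose (c - 1)) *
          frakT (q + a - j + \<omega> + 1) s (p + b + c - 1 - \<omega>) u3))
   + (-1) ^ (p + a) * (\<Sum>j\<le>a. Lambda j \<epsilon> * (-1) ^ j *
       (\<Sum>\<omega>\<le>c - 1. of_nat ((\<omega> + a - j) choose \<omega>) *
          of_nat ((p + c - 2 - \<omega>) choose (p - 1)) *
          frakT q (s + of_nat (a - j + \<omega> + 1)) (p + b + c - 1 - \<omega>) u4))"

definition J0 :: "nat \<Rightarrow> nat \<Rightarrow> nat \<Rightarrow> nat \<Rightarrow> nat \<Rightarrow> complex \<Rightarrow> complex" where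
  "J0 p q a b c s = R_sum riemann_zeta p q a b c s (1, 1) (1, 1) (1, 1) (1, 1)"

definition J1 :: "nat \<Rightarrow> nat \<Rightarrow> nat \<Rightarrow> nat \<Rightarrow> nat \<Rightarrow> complex \<Rightarrow> complex" where
  "J1 p q a b c s = K_sum (-\<i>) p q a b c s (-1, \<i>) (-\<i>, -1) (-\<i>, \<i>) (-\<i>, \<i>)"

definition J2 :: "nat \<Rightarrow> nat \<Rightarrow> nat \<Rightarrow> nat \<Rightarrow> nat \<Rightarrow> complex \<Rightarrow> complex" where
  "J2 p q a b c s = R_sum phi p q a b c s (1, -1) (-1, 1) (-1, -1) (-1, -1)"

definition J3 :: "nat \<Rightarrow> nat \<Rightarrow> nat \<Rightarrow> nat \<Rightarrow> nat \<Rightarrow> complex \<Rightarrow> complex" where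
  "J3 p q a b c s = K_sum \<i> p q a b c s (-1, -\<i>) (\<i>, -1) (\<i>, -\<i>) (\<i>, -\<i>)"

end

theory Submission
  imports Defs
begin

unbundle no fps_syntax

text \<open>
  For \<open>Re s > 1\<close> the twelve summands of \<open>S_sum\<close> are the contributions of the twelve orderings of
  \<open>0, l, l + m, l + m + n\<close> with \<open>n \<ge> 1\<close> to one sum over integers \<open>l, m, n\<close> in the coset
  \<open>l + 2m + 3n \<equiv> 2 (mod 4)\<close>. Detecting the coset by the characters \<open>\<epsilon> powi (l + 2 m + 3 n)\<close>, where
  \<open>\<epsilon>\<close> runs through the fourth roots of unity, and summing over \<open>l\<close> first by partial fractions gives
  the four sums \<open>J\<close>. The same partial fractions express the double series by periodic zeta
  functions, which continue to the plane by repeated summation by parts.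

  For other \<open>s\<close> the function \<open>H\<close> has to be continued along twelve complex lines, on which the
  denominators of its local representations \<open>g / h\<close> might vanish identically. So the lines are
  shifted by \<open>t u\<close> with a generic direction \<open>u\<close>, and \<open>t\<close> tends to \<open>0\<close> from the right. The
  difference of the two sides, shifted in this way, has locally on the segment from \<open>2\<close> to \<open>s\<close> a
  well-defined order in \<open>t\<close>, so its tending to \<open>0\<close> for almost all \<open>z\<close> near a point of the segment
  is an open and closed condition.
\<close>

section \<open>Holomorphic functions of several variables\<close>

text \<open>Where a local denominator vanishes the value of \<open>H\<close> is arbitrary, so usable
  information about values comes only from the two ends of the segment. For \<open>Re z > 1\<close>
  a shift with \<open>t > 0\<close> in a direction of positive real parts stays where the series
  converges absolutely, and uniform convergence identifies the limit with \<open>H\<close> itself;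
  near \<open>s\<close> the holomorphy of \<open>H\<close> does the same. In between only the order
  in \<open>t\<close> is followed. The leading coefficients in \<open>t\<close> are holomorphic in
  \<open>z\<close> and may vanish at isolated points, which is why only almost all \<open>z\<close>
  are considered. Once directions are chosen, only functions of the two variables
  \<open>(t, z)\<close> remain.

  The obstacle in the sums over \<open>l\<close> is that partial fractions contain terms of exponent
  \<open>1\<close>, which do not converge absolutely; they are taken as symmetric limits. The
  integers excluded as poles leave correction terms, and these are the terms \<open>j = 0\<close> of
  the sums \<open>R\<close> and \<open>K\<close>, because
  \<open>2 * riemann_zeta 0 = -1\<close>.\<close>

lemma mv_holomorphic_on_subset:
  "mv_holomorphic_on f U \<Longrightarrow> V \<subseteq> U \<Longrightarrow> mv_holomorphic_on f V"
  unfolding mv_holomorphic_on_def by blast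

lemma mv_holomorphic_on_imp_continuous_on:
  fixes f :: "complex^'n \<Rightarrow> complex"
  assumes "mv_holomorphic_on f U"
  shows "continuous_on U f"
proof (rule continuous_at_imp_continuous_on, rule ballI)
  fix z assume "z \<in> U"
  then obtain D where "(f has_derivative D) (at z)"
    using assms unfolding mv_holomorphic_on_def by blast
  thus "isCont f z" by (rule has_derivative_continuous)
qed

lemma has_derivative_vec_lambda:
  fixes f :: "'a::real_normed_vector \<Rightarrow> ('b::euclidean_space)^'n"
  assumes "\<And>i. ((\<lambda>x. f x $ i) has_derivative (\<lambda>h. D h $ i)) (at x within S)"
  shows "(f has_derivative D) (at x within S)"
  unfolding has_derivative_componentwise_within[of f]
proof
  fix b :: "'b^'n" assume "b \<in> Basis"
  then obtain i u where b: "b = axis i u" "u \<in> Basis"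
    by (auto simp: Basis_vec_def)
  have "((\<lambda>x. f x $ i \<bullet> u) has_derivative (\<lambda>h. D h $ i \<bullet> u)) (at x within S)"
    by (intro derivative_intros assms)
  thus "((\<lambda>x. f x \<bullet> b) has_derivative (\<lambda>x. D x \<bullet> b)) (at x within S)"
    by (simp add: b inner_axis)
qed

lemma mv_holomorphic_on_compose:
  fixes f :: "complex^'n \<Rightarrow> complex" and g :: "complex^'m \<Rightarrow> complex^'n"
  assumes f: "mv_holomorphic_on f U" and g: "\<And>i. mv_holomorphic_on (\<lambda>x. g x $ i) V"
    and sub: "g ` V \<subseteq> U"
  shows "mv_holomorphic_on (\<lambda>x. f (g x)) V"
  unfolding mv_holomorphic_on_def
proof
  fix z assume z: "z \<in> V"
  have "\<forall>i. \<exists>E :: complex^'m. ((\<lambda>x. g x $ i) has_derivative (\<lambda>h. \<Sum>j\<in>UNIV. E $ j * h $ j)) (at z)"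
    using g z unfolding mv_holomorphic_on_def by blast
  then obtain E :: "'n \<Rightarrow> complex^'m"
    where E: "\<And>i. ((\<lambda>x. g x $ i) has_derivative (\<lambda>h. \<Sum>j\<in>UNIV. E i $ j * h $ j)) (at z)"
    by metis
  have dg: "(g has_derivative (\<lambda>h. \<chi> i. \<Sum>j\<in>UNIV. E i $ j * h $ j)) (at z)"
    by (rule has_derivative_vec_lambda) (simp add: E)
  have "g z \<in> U" using z sub by blast
  then obtain D where D: "(f has_derivative (\<lambda>h. \<Sum>i\<in>UNIV. D $ i * h $ i)) (at (g z))"
    using f unfolding mv_holomorphic_on_def by blast
  have "((\<lambda>x. f (g x)) has_derivative
      (\<lambda>h. \<Sum>i\<in>UNIV. D $ i * (\<chi> i. \<Sum>j\<in>UNIV. E i $ j * h $ j) $ i)) (at z)"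
    by (rule has_derivative_compose[OF dg D])
  \<comment> \<open>The row vector \<open>D\<close> times the Jacobian matrix \<open>E\<close> gives
    the coefficients, so the composed derivative is again complex linear.\<close>
  also have "(\<lambda>h. \<Sum>i\<in>UNIV. D $ i * (\<chi> i. \<Sum>j\<in>UNIV. E i $ j * h $ j) $ i) =
      (\<lambda>h. \<Sum>j\<in>UNIV. (\<chi> j. \<Sum>i\<in>UNIV. D $ i * E i $ j) $ j * h $ j)"
    by (rule ext, simp add: sum_distrib_left sum_distrib_right mult.assoc, rule sum.swap)
  finally show "\<exists>D :: complex^'m. ((\<lambda>x. f (g x)) has_derivative (\<lambda>h. \<Sum>j\<in>UNIV. D $ j * h $ j)) (at z)"
    by blast
qed

lemma mv_holomorphic_on_compose_curve:
  fixes f :: "complex^'n \<Rightarrow> complex" and g :: "complex \<Rightarrow> complex^'n"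
  assumes f: "mv_holomorphic_on f U" and g: "\<And>i. (\<lambda>x. g x $ i) holomorphic_on V"
    and sub: "g ` V \<subseteq> U" and "open V"
  shows "(\<lambda>x. f (g x)) holomorphic_on V"
  unfolding holomorphic_on_open[OF \<open>open V\<close>]
proof
  fix z assume z: "z \<in> V"
  have "\<forall>i. \<exists>e. ((\<lambda>x. g x $ i) has_field_derivative e) (at z)"
    using g z \<open>open V\<close> holomorphic_on_open by blast
  then obtain e where E: "\<And>i. ((\<lambda>x. g x $ i) has_field_derivative e i) (at z)"
    by metis
  have dg: "(g has_derivative (\<lambda>h. \<chi> i. e i * h)) (at z)"
    by (rule has_derivative_vec_lambda) (use E in \<open>simp add: has_field_derivative_def\<close>)
  have "g z \<in> U" using z sub by blast
  then obtain D where D: "(f has_derivative (\<lambda>h. \<Sum>i\<in>UNIV. D $ i * h $ i)) (at (g z))"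
    using f unfolding mv_holomorphic_on_def by blast
  have "((\<lambda>x. f (g x)) has_derivative (\<lambda>h. \<Sum>i\<in>UNIV. D $ i * (\<chi> i. e i * h) $ i)) (at z)"
    by (rule has_derivative_compose[OF dg D])
  also have "(\<lambda>h. \<Sum>i\<in>UNIV. D $ i * (\<chi> i. e i * h) $ i) = (*) (\<Sum>i\<in>UNIV. D $ i * e i)"
    by (rule ext, simp add: sum_distrib_right mult.assoc)
  finally show "\<exists>f'. ((\<lambda>x. f (g x)) has_field_derivative f') (at z)"
    unfolding has_field_derivative_def by blast
qed

lemma mv_holomorphic_on_const: "mv_holomorphic_on (\<lambda>_. c) U"
  unfolding mv_holomorphic_on_def
  by (intro ballI exI[of _ 0]) simp

lemma mv_holomorphic_on_add:
  assumes "mv_holomorphic_on f U" "mv_holomorphic_on g U"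
  shows "mv_holomorphic_on (\<lambda>x. f x + g x) U"
  unfolding mv_holomorphic_on_def
proof
  fix z assume "z \<in> U"
  then obtain D E where "(f has_derivative (\<lambda>h. \<Sum>i\<in>UNIV. D $ i * h $ i)) (at z)"
      "(g has_derivative (\<lambda>h. \<Sum>i\<in>UNIV. E $ i * h $ i)) (at z)"
    using assms unfolding mv_holomorphic_on_def by blast
  from has_derivative_add[OF this]
  have "((\<lambda>x. f x + g x) has_derivative (\<lambda>h. \<Sum>i\<in>UNIV. (D + E) $ i * h $ i)) (at z)"
    by (simp add: algebra_simps sum.distrib)
  thus "\<exists>D. ((\<lambda>x. f x + g x) has_derivative (\<lambda>h. \<Sum>i\<in>UNIV. D $ i * h $ i)) (at z)" by blast
qed

lemma mv_holomorphic_on_mult: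
  fixes f g :: "complex^'n \<Rightarrow> complex"
  assumes "mv_holomorphic_on f U" "mv_holomorphic_on g U"
  shows "mv_holomorphic_on (\<lambda>x. f x * g x) U"
  unfolding mv_holomorphic_on_def
proof
  fix z assume "z \<in> U"
  then obtain D E where "(f has_derivative (\<lambda>h. \<Sum>i\<in>UNIV. D $ i * h $ i)) (at z)"
      "(g has_derivative (\<lambda>h. \<Sum>i\<in>UNIV. E $ i * h $ i)) (at z)"
    using assms unfolding mv_holomorphic_on_def by blast
  from has_derivative_mult[OF this]
  have "((\<lambda>x. f x * g x) has_derivative
      (\<lambda>h. \<Sum>i\<in>UNIV. (\<chi> i. f z * E $ i + g z * D $ i) $ i * h $ i)) (at z)"
    by (simp add: algebra_simps sum.distrib sum_distrib_left)
  thus "\<exists>D. ((\<lambda>x. f x * g x) has_derivative (\<lambda>h. \<Sum>i\<in>UNIV. D $ i * h $ i)) (at z)" by blast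
qed

lemma mv_holomorphic_on_nth_compose:
  fixes U :: "(complex^'n) set"
  assumes "g holomorphic_on S" "open S" "\<And>x. x \<in> U \<Longrightarrow> x $ k \<in> S"
  shows "mv_holomorphic_on (\<lambda>x. g (x $ k)) U"
  unfolding mv_holomorphic_on_def
proof
  fix z assume z: "z \<in> U"
  then obtain d where "(g has_field_derivative d) (at (z $ k))"
    using assms holomorphic_on_open by blast
  hence d: "(g has_derivative (\<lambda>h. d * h)) (at (z $ k))"
    by (simp add: has_field_derivative_def)
  have eq: "(\<lambda>h::complex^'n. \<Sum>j\<in>UNIV. axis k d $ j * h $ j) = (\<lambda>h. d * h $ k)"
    by (rule ext) (simp add: axis_def if_distrib[where f="\<lambda>x. x * _"] cong: if_cong)
  have "((\<lambda>x. x $ k) has_derivative (\<lambda>h. h $ k)) (at z)"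
    by (rule bounded_linear_imp_has_derivative) (rule bounded_linear_vec_nth)
  from has_derivative_compose[OF this d]
  have "((\<lambda>x. g (x $ k)) has_derivative (\<lambda>h. \<Sum>j\<in>UNIV. axis k d $ j * h $ j)) (at z)"
    unfolding eq .
  thus "\<exists>D::complex^'n. ((\<lambda>x. g (x $ k)) has_derivative (\<lambda>h. \<Sum>j\<in>UNIV. D $ j * h $ j)) (at z)"
    by blast
qed

lemma mv_holomorphic_on_nth: "mv_holomorphic_on (\<lambda>x. x $ i) (U :: (complex^'n) set)"
  using mv_holomorphic_on_nth_compose[of "\<lambda>z. z" UNIV U i] by simp

text \<open>Along complex lines this reduces to the identity theorem in one variable.\<close>

lemma mv_identity_theorem:
  fixes f :: "complex^'n \<Rightarrow> complex"
  assumes hol: "mv_holomorphic_on f U" and "open U" "connected U"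
    and V: "open V" "V \<subseteq> U" "V \<noteq> {}" and zero: "\<And>x. x \<in> V \<Longrightarrow> f x = 0"
    and "x \<in> U"
  shows "f x = 0"
proof -
  \<comment> \<open>The interior is taken because single zeros do not spread. It is shown to be open
    and closed in \<open>U\<close>: a ball inside \<open>U\<close> that meets \<open>Z\<close> is
    absorbed by \<open>Z\<close>.\<close>
  define Z where "Z = interior {x \<in> U. f x = 0}"
  have ball_sub: "ball a r \<subseteq> Z" if r: "r > 0" "ball a r \<subseteq> U" and b: "b \<in> ball a r" "b \<in> Z" for a b r
  proof -
    have "f w = 0" if w: "w \<in> ball a r" for w
    proof -
      define S where "S = {l. b + l *s (w - b) \<in> ball a r}"
      have cont: "continuous_on UNIV (\<lambda>l. b + l *s (w - b))"
        by (subst continuous_on_componentwise)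
          (auto intro!: continuous_intros simp: Basis_vec_def inner_axis)
      have "open S"
        using open_vimage[OF open_ball[of a r] cont] by (simp add: S_def vimage_def)
      have lin: "b + ((1 - u) *\<^sub>R l + u *\<^sub>R l') *s (w - b) =
          (1 - u) *\<^sub>R (b + l *s (w - b)) + u *\<^sub>R (b + l' *s (w - b))" for l l' u
        by (simp add: vec_eq_iff algebra_simps scaleR_conv_of_real[where 'a=complex])
      have "convex S"
        unfolding convex_alt S_def mem_Collect_eq lin
        using convex_ball[of a r] unfolding convex_alt by blast
      hence "connected S" by (rule convex_connected)
      have hol': "(\<lambda>l. f (b + l *s (w - b))) holomorphic_on S"
        by (rule mv_holomorphic_on_compose_curve[OF hol])
          (use \<open>open S\<close> r(2) in \<open>auto simp: S_def intro!: holomorphic_intros\<close>)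
      have S0: "0 \<in> S" "1 \<in> S" using b w by (auto simp: S_def)
      define T where "T = S \<inter> {l. b + l *s (w - b) \<in> Z}"
      have "open T"
        unfolding T_def using \<open>open S\<close> open_vimage[OF _ cont, of Z]
        by (auto simp: vimage_def Z_def)
      moreover have "0 \<in> T" using S0 b by (simp add: T_def)
      moreover have "f (b + l *s (w - b)) = 0" if "l \<in> T" for l
        using that interior_subset[of "{x \<in> U. f x = 0}"] by (auto simp: T_def Z_def)
      moreover have "T \<subseteq> S" by (auto simp: T_def)
      ultimately have "f (b + 1 *s (w - b)) = 0"
        by (intro analytic_continuation_open[of T S "\<lambda>l. f (b + l *s (w - b))" "\<lambda>_. 0" 1])
          (use \<open>open S\<close> \<open>connected S\<close> hol' S0 in \<open>auto simp del: vector_ssub_ldistrib\<close>)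
      thus ?thesis by simp
    qed
    thus ?thesis unfolding Z_def using r(2) by (intro interior_maximal) auto
  qed
  have "openin (top_of_set U) Z"
    unfolding Z_def using interior_subset by (intro open_openin_trans) (auto simp: \<open>open U\<close>)
  moreover have "closedin (top_of_set U) Z"
  proof -
    have "a \<in> Z" if a: "a \<in> U" "a \<in> closure Z" for a
    proof -
      obtain r where r: "r > 0" "ball a r \<subseteq> U"
        using \<open>open U\<close> a(1) openE by blast
      obtain b where "b \<in> Z" "b \<in> ball a r"
        using a(2) r(1) closure_approachable[of a Z] by (metis dist_commute mem_ball)
      from ball_sub[OF r this(2,1)] r(1) show ?thesis by auto
    qed
    moreover have "Z \<subseteq> U" unfolding Z_def using interior_subset by auto
    ultimately have "Z = U \<inter> closure Z" using closure_subset[of Z] by blast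
    thus ?thesis by (metis closed_closure closedin_closed_Int)
  qed
  moreover have "Z \<noteq> {}"
    using V zero interior_maximal[of V "{x \<in> U. f x = 0}"] unfolding Z_def by blast
  ultimately have "Z = U"
    using \<open>connected U\<close> connected_clopen by blast
  with \<open>x \<in> U\<close> show ?thesis unfolding Z_def using interior_subset by blast
qed

section \<open>Leading coefficients along a line\<close>

text \<open>By Cauchy's formula the coefficient is an integral over the circle of radius
  \<open>r\<close> of functions holomorphic in \<open>z\<close>. Interchanging it with the integral
  along a triangle shows that the latter vanishes, and Morera's theorem applies.\<close>

lemma holomorphic_on_taylor_coeff:
  fixes g :: "complex \<Rightarrow> complex \<Rightarrow> complex"
  assumes r: "r > 0" and V: "open V"
    and cont: "continuous_on (cball 0 r \<times> V) (\<lambda>(t, z). g t z)"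
    and hol_t: "\<And>z. z \<in> V \<Longrightarrow> (\<lambda>t. g t z) holomorphic_on ball 0 r"
    and hol_z: "\<And>t. t \<in> cball 0 r \<Longrightarrow> g t holomorphic_on V"
  shows "(\<lambda>z. (deriv ^^ n) (\<lambda>t. g t z) 0) holomorphic_on V"
proof -
  define C where "C = circlepath 0 r"
  define G where "G = (\<lambda>t z. g t z / t ^ Suc n)"
  define F where "F = (\<lambda>z. contour_integral C (\<lambda>t. G t z))"
  have C: "path_image C = sphere 0 r" "path_image C \<subseteq> cball 0 r" "valid_path C" "0 \<notin> path_image C"
    using r by (auto simp: C_def)
  have contC: "continuous_on {0..1} C"
    using valid_path_imp_path[OF C(3)] by (simp add: path_def)
  have contG: "continuous_on (path_image C \<times> V) (\<lambda>(t, z). G t z)"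
    unfolding G_def case_prod_unfold
    by (intro continuous_intros continuous_on_subset[OF cont[unfolded case_prod_unfold]])
      (use C in auto)
  have vd: "continuous_on {0..1} (\<lambda>t. vector_derivative C (at t))"
    unfolding C_def by (simp add: vector_derivative_circlepath) (intro continuous_intros)
  have eq: "(deriv ^^ n) (\<lambda>t. g t z) 0 = fact n / (2 * pi * \<i>) * F z" if z: "z \<in> V" for z
  proof -
    have "continuous_on (cball 0 r) (\<lambda>t. (\<lambda>(t, z). g t z) (t, z))"
      by (rule continuous_on_compose2[OF cont]) (use z in \<open>auto intro!: continuous_intros\<close>)
    hence "((\<lambda>t. g t z / (t - 0) ^ Suc n) has_contour_integral
        ((2 * pi * \<i>) / (fact n) * (deriv ^^ n) (\<lambda>t. g t z) 0)) C"
      unfolding C_def using r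
      by (intro Cauchy_has_contour_integral_higher_derivative_circlepath) (auto intro: hol_t z)
    hence "F z = (2 * pi * \<i>) / (fact n) * (deriv ^^ n) (\<lambda>t. g t z) 0"
      unfolding F_def G_def by (simp add: contour_integral_unique)
    thus ?thesis by (simp add: field_simps)
  qed
  have contF: "continuous_on V F"
  proof -
    have "continuous_on V (\<lambda>z. integral (cbox 0 1) (\<lambda>x. G (C x) z * vector_derivative C (at x)))"
    proof (rule integral_continuous_on_param)
      have p: "continuous_on (V \<times> cbox 0 1) (\<lambda>x. (\<lambda>(t, z). G t z) (C (snd x), fst x))"
        by (rule continuous_on_compose2[OF contG])
          (auto intro!: continuous_on_Pair continuous_on_fst continuous_on_id
            continuous_on_compose2[OF contC continuous_on_snd] simp: path_image_def)
      have "continuous_on (V \<times> cbox 0 1) (\<lambda>x. vector_derivative C (at (snd x)))"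
        by (rule continuous_on_compose2[OF vd]) (auto intro!: continuous_intros)
      with p show "continuous_on (V \<times> cbox 0 1) (\<lambda>(z, x). G (C x) z * vector_derivative C (at x))"
        unfolding case_prod_unfold by (auto intro!: continuous_intros)
    qed
    thus ?thesis unfolding F_def contour_integral_integral by simp
  qed
  have "F analytic_on V"
  proof (rule Morera_triangle[OF contF V], rule impI)
    fix a b c assume tri: "convex hull {a, b, c} \<subseteq> V"
    have seg0: "closed_segment x y \<subseteq> V" if "x \<in> {a, b, c}" "y \<in> {a, b, c}" for x y
    proof -
      have "closed_segment x y \<subseteq> convex hull {a, b, c}"
        by (intro closed_segment_subset hull_inc that convex_convex_hull)
      thus ?thesis using tri by blast
    qed
    have seg: "closed_segment a b \<subseteq> V" "closed_segment b c \<subseteq> V" "closed_segment c a \<subseteq> V"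
      by (rule seg0; simp)+
    have swap: "contour_integral (linepath x y) F =
        contour_integral C (\<lambda>t. contour_integral (linepath x y) (G t))"
      and int: "(\<lambda>t. contour_integral (linepath x y) (G t)) contour_integrable_on C"
      if xy: "closed_segment x y \<subseteq> V" for x y
    proof -
      have c1: "continuous_on (closed_segment x y \<times> path_image C) (\<lambda>(z, t). G t z)"
        using continuous_on_swap_args[OF continuous_on_subset[OF contG, of "path_image C \<times> closed_segment x y"]] xy
        by auto
      show "contour_integral (linepath x y) F =
        contour_integral C (\<lambda>t. contour_integral (linepath x y) (G t))"
        unfolding F_def using contour_integral_swap[of "linepath x y" C "\<lambda>z t. G t z"] c1 C vd
        by (simp add: continuous_on_const)
      have c2: "continuous_on (path_image C) (\<lambda>t. contour_integral (linepath x y) (G t))"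
      proof -
        have "continuous_on (path_image C)
           (\<lambda>t. integral (cbox 0 1) (\<lambda>u. G t (linepath x y u) * (y - x)))"
        proof (rule integral_continuous_on_param)
          have "continuous_on (path_image C \<times> cbox 0 1)
              (\<lambda>p. (\<lambda>(t, z). G t z) (fst p, linepath x y (snd p)))"
            by (rule continuous_on_compose2[OF contG])
              (use xy path_image_linepath[of x y] in
                \<open>auto intro!: continuous_intros continuous_on_compose2[OF continuous_on_linepath]
                  simp: path_image_def\<close>)
          thus "continuous_on (path_image C \<times> cbox 0 1) (\<lambda>(t, u). G t (linepath x y u) * (y - x))"
            unfolding case_prod_unfold by (auto intro!: continuous_intros)
        qed
        thus ?thesis unfolding contour_integral_integral by simp
      qed
      have "continuous_on {0..1} (\<lambda>x'. contour_integral (linepath x y) (G (C x')))"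
        by (rule continuous_on_compose2[OF c2])
          (use contC in \<open>auto simp: path_image_def\<close>)
      thus "(\<lambda>t. contour_integral (linepath x y) (G t)) contour_integrable_on C"
        unfolding contour_integrable_on
        by (intro integrable_continuous_real continuous_on_mult vd)
    qed
    have zero: "contour_integral (linepath a b) (G t) + contour_integral (linepath b c) (G t) +
        contour_integral (linepath c a) (G t) = 0" if t: "t \<in> path_image C" for t
    proof -
      have "G t holomorphic_on V"
        unfolding G_def using t C by (intro holomorphic_intros hol_z) auto
      hence "(G t has_contour_integral 0) (linepath a b +++ linepath b c +++ linepath c a)"
        by (intro Cauchy_theorem_triangle holomorphic_on_subset[OF _ tri])
      moreover have int_G: "G t contour_integrable_on linepath x y" if "closed_segment x y \<subseteq> V" for x y
        using \<open>G t holomorphic_on V\<close> that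
        by (intro contour_integrable_continuous_linepath)
          (meson continuous_on_subset holomorphic_on_imp_continuous_on)
      ultimately show ?thesis
        using contour_integral_unique[of "G t" 0 "linepath a b +++ linepath b c +++ linepath c a"]
          int_G[OF seg(1)] int_G[OF seg(2)] int_G[OF seg(3)]
        by (simp add: add.assoc)
    qed
    have "contour_integral (linepath a b) F + contour_integral (linepath b c) F +
        contour_integral (linepath c a) F = contour_integral C (\<lambda>t.
        contour_integral (linepath a b) (G t) + contour_integral (linepath b c) (G t) +
        contour_integral (linepath c a) (G t))"
      using int seg by (simp add: swap contour_integral_add contour_integrable_add)
    also have "\<dots> = contour_integral C (\<lambda>_. 0)"
      by (rule contour_integral_eq) (use zero in auto)
    finally show "contour_integral (linepath a b) F + contour_integral (linepath b c) F +
        contour_integral (linepath c a) F = 0" by simp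
  qed
  hence "(\<lambda>z. fact n / (2 * pi * \<i>) * F z) holomorphic_on V"
    by (intro holomorphic_intros analytic_imp_holomorphic)
  thus ?thesis
    by (rule holomorphic_transform) (simp add: eq)
qed

text \<open>After division by \<open>t ^ k\<close> the Taylor series begins with the coefficient of
  index \<open>k\<close>.\<close>

lemma holomorphic_leading_term_tendsto:
  fixes f :: "complex \<Rightarrow> complex"
  assumes r: "r > 0" and hol: "f holomorphic_on ball 0 r"
    and low: "\<And>j. j < k \<Longrightarrow> (deriv ^^ j) f 0 = 0"
  shows "((\<lambda>t. f t / t ^ k) \<longlongrightarrow> (deriv ^^ k) f 0 / fact k) (at 0)"
proof -
  define d where "d = (\<lambda>n. (deriv ^^ n) f 0 / fact n)"
  have "(\<lambda>n. d (n + k) * t ^ n) sums (f t / t ^ k)" if t: "t \<noteq> 0" "norm t < r" for t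
  proof -
    have "(\<lambda>n. d n * (t - 0) ^ n) sums f t"
      unfolding d_def by (rule holomorphic_power_series[OF hol]) (use t in auto)
    hence "(\<lambda>n. d (n + k) * t ^ (n + k)) sums (f t - (\<Sum>i<k. d i * t ^ i))"
      using sums_iff_shift[of "\<lambda>n. d n * t ^ n" k "f t - (\<Sum>i<k. d i * t ^ i)"] by simp
    moreover have "(\<Sum>i<k. d i * t ^ i) = 0"
      by (rule sum.neutral) (simp add: d_def low)
    ultimately have "(\<lambda>n. d (n + k) * t ^ (n + k) / t ^ k) sums (f t / t ^ k)"
      by (intro sums_divide) simp
    thus ?thesis using t by (simp add: power_add)
  qed
  from powser_limit_0_strong[OF r this] show ?thesis by (simp add: d_def)
qed

text \<open>\<open>k\<close> is the least index whose Taylor coefficient in \<open>t\<close> does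
  not vanish identically in \<open>z\<close>. That coefficient is holomorphic in \<open>z\<close>,
  so its zeros are isolated, and the order in \<open>t\<close> is the same for all \<open>z\<close>
  near \<open>z0\<close>, with \<open>z0\<close> itself as a possible exception.\<close>

lemma leading_coeff_along_line:
  fixes g :: "complex \<Rightarrow> complex \<Rightarrow> complex"
  assumes r: "r > 0" and V: "open V" "connected V" "z0 \<in> V"
    and cont: "continuous_on (cball 0 r \<times> V) (\<lambda>(t, z). g t z)"
    and hol_t: "\<And>z. z \<in> V \<Longrightarrow> (\<lambda>t. g t z) holomorphic_on ball 0 r"
    and hol_z: "\<And>t. t \<in> cball 0 r \<Longrightarrow> g t holomorphic_on V"
  shows "(\<forall>t\<in>ball 0 r. \<forall>z\<in>V. g t z = 0) \<or>
    (\<exists>k c. (\<forall>\<^sub>F z in at z0. c z \<noteq> 0 \<and> ((\<lambda>t. g t z / t ^ k) \<longlongrightarrow> c z) (at 0)))"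
proof (cases "\<forall>n. \<forall>z\<in>V. (deriv ^^ n) (\<lambda>t. g t z) 0 = 0")
  case True
  have "g t z = 0" if "t \<in> ball 0 r" "z \<in> V" for t z
    by (rule holomorphic_fun_eq_0_on_ball[OF hol_t[OF that(2)] that(1)]) (use True that in auto)
  thus ?thesis by blast
next
  case False
  define k where "k = (LEAST n. \<exists>z\<in>V. (deriv ^^ n) (\<lambda>t. g t z) 0 \<noteq> 0)"
  define c where "c = (\<lambda>z. (deriv ^^ k) (\<lambda>t. g t z) 0 / fact k)"
  have ex: "\<exists>z\<in>V. (deriv ^^ k) (\<lambda>t. g t z) 0 \<noteq> 0"
    unfolding k_def by (rule LeastI_ex) (use False in blast)
  have low: "(deriv ^^ j) (\<lambda>t. g t z) 0 = 0" if "j < k" "z \<in> V" for j z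
    using not_less_Least[of j "\<lambda>n. \<exists>z\<in>V. (deriv ^^ n) (\<lambda>t. g t z) 0 \<noteq> 0"] that
    unfolding k_def by blast
  have "(\<lambda>z. (deriv ^^ k) (\<lambda>t. g t z) 0) holomorphic_on V"
    by (rule holomorphic_on_taylor_coeff[OF r V(1) cont]) (use hol_t hol_z in auto)
  hence "c holomorphic_on V"
    unfolding c_def by (intro holomorphic_on_divide holomorphic_on_const) auto
  moreover obtain w where "w \<in> V" "c w \<noteq> 0" using ex unfolding c_def by auto
  ultimately have "\<forall>\<^sub>F z in at z0. c z \<noteq> 0 \<and> z \<in> V"
    using non_zero_neighbour_alt[of c V z0 w] V by blast
  hence "\<forall>\<^sub>F z in at z0. c z \<noteq> 0 \<and> ((\<lambda>t. g t z / t ^ k) \<longlongrightarrow> c z) (at 0)"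
  proof eventually_elim
    case (elim z)
    show ?case
      using elim holomorphic_leading_term_tendsto[OF r hol_t[of z] low, of k] by (simp add: c_def)
  qed
  thus ?thesis by blast
qed

section \<open>Meromorphic functions near a line\<close>

text \<open>The local condition of \<open>mv_meromorphic\<close> at a single point; the functions of
  two variables used later are known to satisfy it only along a segment.\<close>

definition mv_quotient_at :: "(complex^'n \<Rightarrow> complex) \<Rightarrow> complex^'n \<Rightarrow> bool" where
  "mv_quotient_at f z \<longleftrightarrow> (\<exists>U g h. open U \<and> connected U \<and> z \<in> U \<and>
        mv_holomorphic_on g U \<and> mv_holomorphic_on h U \<and>
        (\<exists>w\<in>U. h w \<noteq> 0) \<and> (\<forall>w\<in>U. h w \<noteq> 0 \<longrightarrow> f w = g w / h w))"

lemma mv_quotient_atI: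
  assumes "open U" "connected U" "z \<in> U" "mv_holomorphic_on g U" "mv_holomorphic_on h U"
    "\<exists>w\<in>U. h w \<noteq> 0" "\<And>w. w \<in> U \<Longrightarrow> h w \<noteq> 0 \<Longrightarrow> f w = g w / h w"
  shows "mv_quotient_at f z"
  unfolding mv_quotient_at_def using assms by metis

lemma mv_meromorphic_iff_quotient: "mv_meromorphic f \<longleftrightarrow> (\<forall>z. mv_quotient_at f z)"
  unfolding mv_meromorphic_def mv_quotient_at_def ..

text \<open>The identity theorem turns one nonzero value of the denominator into nonzero values on
  every nonempty open subset. In this form denominators can be multiplied and sets of directions can
  be shrunk.\<close>

lemma mv_quotient_at_ballE:
  fixes f :: "complex^'n \<Rightarrow> complex"
  assumes "mv_quotient_at f z"
  obtains e g h where "e > 0" "mv_holomorphic_on g (ball z e)" "mv_holomorphic_on h (ball z e)"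
    "\<And>V. open V \<Longrightarrow> V \<subseteq> ball z e \<Longrightarrow> V \<noteq> {} \<Longrightarrow> \<exists>w\<in>V. h w \<noteq> 0"
    "\<And>w. w \<in> ball z e \<Longrightarrow> h w \<noteq> 0 \<Longrightarrow> f w = g w / h w"
proof -
  obtain U g h where U: "open U" "connected U" "z \<in> U" "mv_holomorphic_on g U"
      "mv_holomorphic_on h U" "\<exists>w\<in>U. h w \<noteq> 0" "\<And>w. w \<in> U \<Longrightarrow> h w \<noteq> 0 \<Longrightarrow> f w = g w / h w"
    using assms unfolding mv_quotient_at_def by blast
  obtain e where e: "e > 0" "ball z e \<subseteq> U" using U(1,3) openE by blast
  have "\<exists>w\<in>V. h w \<noteq> 0" if V: "open V" "V \<subseteq> ball z e" "V \<noteq> {}" for V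
    using mv_identity_theorem[OF U(5,1,2) V(1) _ V(3)] V(2) e(2) U(6) by (meson order_trans)
  moreover have "mv_holomorphic_on g (ball z e)" "mv_holomorphic_on h (ball z e)"
    using U(4,5) e(2) mv_holomorphic_on_subset by blast+
  ultimately show ?thesis using that[of e g h] e U(7) by blast
qed

lemma open_nonzero_set:
  fixes h :: "'a::topological_space \<Rightarrow> 'b::real_normed_vector"
  assumes "continuous_on U h" "open U"
  shows "open {w \<in> U. h w \<noteq> 0}"
proof -
  have "{w \<in> U. h w \<noteq> 0} = U \<inter> h -` (- {0})" by auto
  thus ?thesis using continuous_open_preimage[OF assms, of "- {0}"] by (simp add: open_Compl)
qed

lemma mv_quotient_at_add:
  fixes f1 f2 :: "complex^'n \<Rightarrow> complex"
  assumes "mv_quotient_at f1 z" "mv_quotient_at f2 z"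
  shows "mv_quotient_at (\<lambda>w. f1 w + f2 w) z"
proof -
  obtain e1 g1 h1 where 1: "e1 > 0" "mv_holomorphic_on g1 (ball z e1)" "mv_holomorphic_on h1 (ball z e1)"
    "\<And>V. open V \<Longrightarrow> V \<subseteq> ball z e1 \<Longrightarrow> V \<noteq> {} \<Longrightarrow> \<exists>w\<in>V. h1 w \<noteq> 0"
    "\<And>w. w \<in> ball z e1 \<Longrightarrow> h1 w \<noteq> 0 \<Longrightarrow> f1 w = g1 w / h1 w"
    using mv_quotient_at_ballE[OF assms(1)] by metis
  obtain e2 g2 h2 where 2: "e2 > 0" "mv_holomorphic_on g2 (ball z e2)" "mv_holomorphic_on h2 (ball z e2)"
    "\<And>V. open V \<Longrightarrow> V \<subseteq> ball z e2 \<Longrightarrow> V \<noteq> {} \<Longrightarrow> \<exists>w\<in>V. h2 w \<noteq> 0"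
    "\<And>w. w \<in> ball z e2 \<Longrightarrow> h2 w \<noteq> 0 \<Longrightarrow> f2 w = g2 w / h2 w"
    using mv_quotient_at_ballE[OF assms(2)] by metis
  define U where "U = ball z (min e1 e2)"
  have U: "open U" "connected U" "z \<in> U" "U \<subseteq> ball z e1" "U \<subseteq> ball z e2"
    using 1(1) 2(1) by (auto simp: U_def)
  note hol = mv_holomorphic_on_subset[OF 1(2) U(4)] mv_holomorphic_on_subset[OF 1(3) U(4)]
    mv_holomorphic_on_subset[OF 2(2) U(5)] mv_holomorphic_on_subset[OF 2(3) U(5)]
  have "open {w \<in> U. h1 w \<noteq> 0}"
    by (intro open_nonzero_set mv_holomorphic_on_imp_continuous_on hol U)
  moreover have "{w \<in> U. h1 w \<noteq> 0} \<noteq> {}" using 1(4)[of U] U by blast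
  \<comment> \<open>Density of the nonzero points of \<open>h2\<close>, applied to the open set
    where \<open>h1\<close> is nonzero, gives a common point.\<close>
  ultimately have "\<exists>w\<in>{w \<in> U. h1 w \<noteq> 0}. h2 w \<noteq> 0"
    using 2(4)[of "{w \<in> U. h1 w \<noteq> 0}"] U(5) by blast
  hence nz: "\<exists>w\<in>U. h1 w * h2 w \<noteq> 0" by auto
  have eq: "f1 w + f2 w = (g1 w * h2 w + g2 w * h1 w) / (h1 w * h2 w)"
    if "w \<in> U" "h1 w * h2 w \<noteq> 0" for w
  proof -
    have "f1 w = g1 w / h1 w" "f2 w = g2 w / h2 w"
      using that 1(5)[of w] 2(5)[of w] U by auto
    thus ?thesis using that add_frac_eq[of "h1 w" "h2 w" "g1 w" "g2 w"] by simp
  qed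
  have "mv_holomorphic_on (\<lambda>w. g1 w * h2 w + g2 w * h1 w) U"
      "mv_holomorphic_on (\<lambda>w. h1 w * h2 w) U"
    by (intro mv_holomorphic_on_add mv_holomorphic_on_mult hol)+
  thus ?thesis by (rule mv_quotient_atI[OF U(1-3) _ _ nz eq])
qed

lemma mv_quotient_at_cmult:
  fixes f :: "complex^'n \<Rightarrow> complex"
  assumes "mv_quotient_at f z"
  shows "mv_quotient_at (\<lambda>w. c * f w) z"
proof -
  obtain U g h where U: "open U" "connected U" "z \<in> U" "mv_holomorphic_on g U"
      "mv_holomorphic_on h U" "\<exists>w\<in>U. h w \<noteq> 0" "\<And>w. w \<in> U \<Longrightarrow> h w \<noteq> 0 \<Longrightarrow> f w = g w / h w"
    using assms unfolding mv_quotient_at_def by blast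
  thus ?thesis unfolding mv_quotient_at_def
    by (intro exI[of _ U] exI[of _ "\<lambda>w. c * g w"] exI[of _ h])
      (auto intro!: mv_holomorphic_on_mult mv_holomorphic_on_const)
qed

lemma mv_quotient_at_const: "mv_quotient_at (\<lambda>_. c) z"
  unfolding mv_quotient_at_def
  by (intro exI[of _ UNIV] exI[of _ "\<lambda>_. c"] exI[of _ "\<lambda>_. 1"])
    (auto intro!: mv_holomorphic_on_const)

lemma mv_quotient_at_sum_list:
  assumes "\<And>x. x \<in> set xs \<Longrightarrow> mv_quotient_at (F x) z"
  shows "mv_quotient_at (\<lambda>w. \<Sum>x\<leftarrow>xs. F x w) z"
  using assms by (induction xs) (auto intro: mv_quotient_at_const mv_quotient_at_add)

text \<open>Near the point \<open>E\<close> is a power series times an integer power of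
  \<open>w - a\<close>; the sign of the exponent decides whether the power goes to the numerator or
  to the denominator.\<close>

lemma mv_quotient_at_meromorphic_nth:
  fixes z :: "complex^'n"
  assumes "E meromorphic_on {z $ k}"
  shows "mv_quotient_at (\<lambda>x. E (x $ k)) z"
proof -
  define a where "a = z $ k"
  obtain L where L: "(\<lambda>w. E (a + w)) has_laurent_expansion L"
    using assms unfolding a_def meromorphic_on_def by blast
  define P where "P = fls_base_factor_to_fps L"
  define n where "n = fls_subdegree L"
  have *: "\<forall>\<^sub>F w in at 0. eval_fls L w = E (a + w)" "fls_conv_radius L > 0"
    using L by (auto simp: has_laurent_expansion_def)
  obtain d1 where d1: "d1 > 0" "\<And>w. w \<noteq> 0 \<Longrightarrow> norm w < d1 \<Longrightarrow> eval_fls L w = E (a + w)"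
    using *(1) by (auto simp: eventually_at)
  obtain d2 where d2: "0 < ereal d2" "ereal d2 < fls_conv_radius L"
    using *(2) ereal_dense2 by blast
  define d where "d = min d1 d2"
  have "ereal d \<le> ereal d2" by (simp add: d_def)
  also have "\<dots> < fps_conv_radius P" using d2 by (simp add: P_def fls_conv_radius_altdef)
  finally have d3: "ereal d \<le> fps_conv_radius P" by simp
  have d: "d > 0" "\<And>w. w \<noteq> 0 \<Longrightarrow> norm w < d \<Longrightarrow> eval_fls L w = E (a + w)"
    "ereal d \<le> fps_conv_radius P"
    using d1 d2 d3 by (auto simp: d_def)
  define U where "U = {x :: complex^'n. x $ k \<in> ball a d}"
  have cont: "continuous_on UNIV (\<lambda>x::complex^'n. x $ k)" by (intro continuous_intros)
  have "open U"
    using open_vimage[OF open_ball[of a d] cont] by (simp add: U_def vimage_def)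
  have "convex U"
    unfolding U_def using convex_ball[of a d] by (auto simp: convex_def)
  have zU: "z \<in> U" using d(1) by (simp add: U_def a_def)
  have P: "(\<lambda>w. eval_fps P (w - a)) holomorphic_on ball a d"
  proof -
    have "eball 0 (fps_conv_radius P) \<supseteq> (\<lambda>w. w - a) ` ball a d"
      using d(3) by (auto simp: dist_norm norm_minus_commute elim!: less_le_trans[rotated])
    thus ?thesis
      by (intro holomorphic_on_compose_gen[OF _ holomorphic_on_eval_fps, unfolded o_def]
        holomorphic_intros) auto
  qed
  define g where "g = (\<lambda>w. eval_fps P (w - a) * (w - a) ^ nat n)"
  define h where "h = (\<lambda>w. (w - a) ^ nat (- n))"
  have E: "E w = g w / h w" if w: "w \<in> ball a d" "w \<noteq> a" for w
  proof -
    have "E w = eval_fls L (w - a)" using d(2)[of "w - a"] w by (auto simp: dist_norm norm_minus_commute)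
    also have "\<dots> = eval_fps P (w - a) * (w - a) powi n"
      using w by (simp add: eval_fls_def P_def n_def)
    also have "\<dots> = g w / h w"
      using w by (cases "n \<ge> 0") (auto simp: g_def h_def power_int_def field_simps)
    finally show ?thesis .
  qed
  \<comment> \<open>The additional factor makes the denominator vanish at \<open>a\<close>, where
    the value of \<open>E\<close> may be unrelated to its Laurent series.\<close>
  define h' where "h' = (\<lambda>w. h w * (w - a))"
  define g' where "g' = (\<lambda>w. g w * (w - a))"
  have "mv_holomorphic_on (\<lambda>x::complex^'n. g' (x $ k)) U"
    unfolding g'_def g_def using d
    by (intro mv_holomorphic_on_nth_compose[where S = "ball a d"] holomorphic_intros P) (auto simp: U_def)
  moreover have "mv_holomorphic_on (\<lambda>x::complex^'n. h' (x $ k)) U"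
    unfolding h'_def h_def
    by (intro mv_holomorphic_on_nth_compose[where S = "ball a d"] holomorphic_intros) (auto simp: U_def)
  moreover have "\<exists>x\<in>U. h' (x $ k) \<noteq> 0"
    by (rule bexI[of _ "z + axis k (of_real (d / 2))"])
      (use d(1) in \<open>auto simp: U_def h'_def h_def a_def dist_norm\<close>)
  moreover have "E (x $ k) = g' (x $ k) / h' (x $ k)" if "x \<in> U" "h' (x $ k) \<noteq> 0" for x :: "complex^'n"
    using E[of "x $ k"] that by (auto simp: U_def g'_def h'_def)
  ultimately show ?thesis
    by (rule mv_quotient_atI[OF \<open>open U\<close> convex_connected[OF \<open>convex U\<close>] zU])
qed

lemma continuous_on_vec_scalar_mult [continuous_intros]:
  fixes f :: "'a::topological_space \<Rightarrow> complex" and g :: "'a \<Rightarrow> complex^'n"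
  assumes "continuous_on S f" "continuous_on S g"
  shows "continuous_on S (\<lambda>x. f x *s g x)"
  unfolding vector_scalar_mult_def
  by (intro continuous_on_vec_lambda continuous_intros assms)

text \<open>
  The direction is found by shrinking \<open>W\<close> once for each member of a finite cover of the line.
\<close>

lemma generic_direction:
  fixes H :: "complex^'n \<Rightarrow> complex" and a b :: "complex^'n" and W :: "(complex^'n) set"
  assumes H: "mv_meromorphic H" and K: "compact K" and W: "open W" "W \<noteq> {}"
  obtains u where "u \<in> W"
    "\<And>z. z \<in> K \<Longrightarrow> mv_quotient_at (\<lambda>x::complex^2. H (a + x $ 2 *s b + x $ 1 *s u)) (vector [0, z])"
proof -
  define \<gamma> where "\<gamma> = (\<lambda>z. a + z *s b)"
  have contg: "continuous_on UNIV \<gamma>" unfolding \<gamma>_def by (intro continuous_intros)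
  have "\<forall>z. \<exists>e g h. e > 0 \<and> mv_holomorphic_on g (ball (\<gamma> z) e) \<and> mv_holomorphic_on h (ball (\<gamma> z) e) \<and>
    (\<forall>V. open V \<longrightarrow> V \<subseteq> ball (\<gamma> z) e \<longrightarrow> V \<noteq> {} \<longrightarrow> (\<exists>w\<in>V. h w \<noteq> 0)) \<and>
    (\<forall>w. w \<in> ball (\<gamma> z) e \<longrightarrow> h w \<noteq> 0 \<longrightarrow> H w = g w / h w)" (is "\<forall>z. ?P z")
  proof
    fix z
    have "mv_quotient_at H (\<gamma> z)" using H mv_meromorphic_iff_quotient by blast
    from mv_quotient_at_ballE[OF this] show "?P z" by metis
  qed
  then obtain e g h where e: "\<And>z. e z > (0::real)"
    and g: "\<And>z. mv_holomorphic_on (g z) (ball (\<gamma> z) (e z))"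
    and h: "\<And>z. mv_holomorphic_on (h z) (ball (\<gamma> z) (e z))"
    and nz: "\<And>z V. open V \<Longrightarrow> V \<subseteq> ball (\<gamma> z) (e z) \<Longrightarrow> V \<noteq> {} \<Longrightarrow> \<exists>w\<in>V. h z w \<noteq> 0"
    and eq: "\<And>z w. w \<in> ball (\<gamma> z) (e z) \<Longrightarrow> h z w \<noteq> 0 \<Longrightarrow> H w = g z w / h z w"
    by metis
  define B where "B = (\<lambda>z. ball (\<gamma> z) (e z))"
  have "\<forall>z\<in>K. open (\<gamma> -` B z)"
    unfolding B_def using open_vimage[OF open_ball contg] by blast
  moreover have "K \<subseteq> (\<Union>z\<in>K. \<gamma> -` B z)" using e by (auto simp: B_def)
  ultimately obtain K' where K': "K' \<subseteq> K" "finite K'" "K \<subseteq> (\<Union>z\<in>K'. \<gamma> -` B z)"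
    using compactE_image[OF K, of K "\<lambda>z. \<gamma> -` B z"] by metis
  \<comment> \<open>Invariant: for every centre treated so far, each line from it in a direction of
    the current open set leaves the zero set of the local denominator.\<close>
  have "\<exists>W'. open W' \<and> W' \<noteq> {} \<and> W' \<subseteq> W \<and>
      (\<forall>z\<in>K'. \<forall>u\<in>W'. \<exists>t. \<gamma> z + t *s u \<in> B z \<and> h z (\<gamma> z + t *s u) \<noteq> 0)"
    using K'(2)
  proof induction
    case empty
    show ?case using W by blast
  next
    case (insert z F)
    then obtain W' where W': "open W'" "W' \<noteq> {}" "W' \<subseteq> W"
      "\<And>z u. z \<in> F \<Longrightarrow> u \<in> W' \<Longrightarrow> \<exists>t. \<gamma> z + t *s u \<in> B z \<and> h z (\<gamma> z + t *s u) \<noteq> 0"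
      by blast
    then obtain u1 where u1: "u1 \<in> W'" by blast
    have "continuous_on UNIV (\<lambda>t. \<gamma> z + t *s u1)" by (intro continuous_intros)
    hence "((\<lambda>t. \<gamma> z + t *s u1) \<longlongrightarrow> \<gamma> z) (at 0)"
      by (auto simp: continuous_on_def dest: spec[of _ 0])
    hence "\<forall>\<^sub>F t in at 0. \<gamma> z + t *s u1 \<in> B z"
      using e[of z] by (intro topological_tendstoD) (auto simp: B_def)
    hence "\<exists>t. \<gamma> z + t *s u1 \<in> B z \<and> t \<noteq> 0"
      by (intro eventually_happens'[of "at 0"] eventually_conj eventually_neq_at_within) auto
    then obtain t0 where t0: "\<gamma> z + t0 *s u1 \<in> B z" "t0 \<noteq> 0" by blast
    \<comment> \<open>The points of the ball that are reached from the centre at parameter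
      \<open>t0\<close> in a direction of \<open>W'\<close>. They form a nonempty open set, so
      \<open>h z\<close> is nonzero at one of them, and dividing by \<open>t0\<close> recovers its
      direction.\<close>
    define V where "V = B z \<inter> (\<lambda>x. (1 / t0) *s (x - \<gamma> z)) -` W'"
    have "open V"
      unfolding V_def B_def by (intro open_Int open_ball open_vimage W') (intro continuous_intros)
    moreover have "\<gamma> z + t0 *s u1 \<in> V"
      using t0 u1 by (simp add: V_def vector_smult_assoc)
    ultimately obtain x where x: "x \<in> V" "h z x \<noteq> 0"
      using nz[OF \<open>open V\<close>, of z] unfolding V_def B_def by blast
    define u0 where "u0 = (1 / t0) *s (x - \<gamma> z)"
    have xu: "x = \<gamma> z + t0 *s u0" using t0 by (simp add: u0_def vector_smult_assoc)
    define W'' where "W'' = W' \<inter> (\<lambda>u. \<gamma> z + t0 *s u) -` {x \<in> B z. h z x \<noteq> 0}"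
    have "open {x \<in> B z. h z x \<noteq> 0}"
      unfolding B_def by (intro open_nonzero_set mv_holomorphic_on_imp_continuous_on h) auto
    hence "open W''"
      unfolding W''_def by (intro open_Int open_vimage W') (auto intro!: continuous_intros)
    moreover have "u0 \<in> W''"
    proof -
      have "u0 \<in> W'" "x \<in> B z" using x(1) by (auto simp: V_def u0_def)
      thus ?thesis using x(2) by (simp add: W''_def flip: xu)
    qed
    moreover have "\<exists>t. \<gamma> y + t *s u \<in> B y \<and> h y (\<gamma> y + t *s u) \<noteq> 0"
      if "y \<in> insert z F" "u \<in> W''" for y u
      using that W'(4)[of y u] by (auto simp: W''_def)
    moreover have "W'' \<subseteq> W" using W'(3) unfolding W''_def by blast
    ultimately show ?case by (intro exI[of _ W'']) blast
  qed
  then obtain W' where W': "W' \<noteq> {}" "W' \<subseteq> W"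
    "\<forall>z\<in>K'. \<forall>u\<in>W'. \<exists>t. \<gamma> z + t *s u \<in> B z \<and> h z (\<gamma> z + t *s u) \<noteq> 0"
    by (elim exE conjE) (rule that)
  then obtain u where u: "u \<in> W'" by blast
  define A where "A = (\<lambda>x::complex^2. a + x $ 2 *s b + x $ 1 *s u)"
  have A_nth: "A x $ i = a $ i + x $ 2 * b $ i + x $ 1 * u $ i" for x i
    by (simp add: A_def)
  have A_hol: "mv_holomorphic_on (\<lambda>x. A x $ i) U" for U i
    unfolding A_nth
    by (intro mv_holomorphic_on_add mv_holomorphic_on_mult mv_holomorphic_on_const mv_holomorphic_on_nth)
  have A_cont: "continuous_on UNIV A" unfolding A_def by (intro continuous_intros)
  have lin: "A ((1 - c) *\<^sub>R x + c *\<^sub>R y) = (1 - c) *\<^sub>R A x + c *\<^sub>R A y" for x y c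
    by (simp add: vec_eq_iff A_nth algebra_simps scaleR_conv_of_real[where 'a=complex])
  have "mv_quotient_at (\<lambda>x. H (A x)) (vector [0, w])" if w: "w \<in> K" for w
  proof -
    obtain z where z: "z \<in> K'" "\<gamma> w \<in> B z" using K' w by blast
    define U where "U = A -` B z"
    have "open U" unfolding U_def B_def by (intro open_vimage A_cont) auto
    moreover have "convex U"
      unfolding convex_alt U_def vimage_def mem_Collect_eq lin
      using convex_ball[of "\<gamma> z" "e z"] unfolding convex_alt B_def by blast
    moreover have "vector [0, w] \<in> U" using z(2) by (simp add: U_def A_def \<gamma>_def)
    moreover have "mv_holomorphic_on (\<lambda>x. g z (A x)) U" "mv_holomorphic_on (\<lambda>x. h z (A x)) U"
      by (rule mv_holomorphic_on_compose[OF g[of z] A_hol] mv_holomorphic_on_compose[OF h[of z] A_hol],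
        force simp: U_def B_def)+
    moreover obtain t where "\<gamma> z + t *s u \<in> B z" "h z (\<gamma> z + t *s u) \<noteq> 0"
      using bspec[OF bspec[OF W'(3) z(1)] u] by blast
    \<comment> \<open>The nonzero value is found over the centre \<open>z\<close> of the covering
      ball, not over \<open>w\<close>; the convex set \<open>U\<close> contains the points over
      both.\<close>
    hence "\<exists>x\<in>U. h z (A x) \<noteq> 0"
      by (intro bexI[of _ "vector [t, z]"]) (auto simp: U_def A_def \<gamma>_def)
    moreover have "H (A x) = g z (A x) / h z (A x)" if "x \<in> U" "h z (A x) \<noteq> 0" for x
      using eq[of "A x" z] that by (auto simp: U_def B_def)
    ultimately show ?thesis
      using mv_quotient_atI[of U _ "\<lambda>x. g z (A x)" "\<lambda>x. h z (A x)" "\<lambda>x. H (A x)"]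
      by (simp add: convex_connected)
  qed
  with u W'(2) that[of u] show ?thesis unfolding A_def by blast
qed

section \<open>Limits in the shift parameter along a segment\<close>

lemma two_var_section:
  assumes r: "r > 0" and g: "mv_holomorphic_on g (ball (vector [0, z0] :: complex^2) (3 * r))"
  defines "f \<equiv> \<lambda>t z. g (vector [t, z])"
  shows "continuous_on (cball 0 r \<times> ball z0 r) (\<lambda>(t, z). f t z)"
    and "\<And>z. z \<in> ball z0 r \<Longrightarrow> (\<lambda>t. f t z) holomorphic_on ball 0 r"
    and "\<And>t. t \<in> cball 0 r \<Longrightarrow> f t holomorphic_on ball z0 r"
    and "\<And>t z. t \<in> cball 0 r \<Longrightarrow> z \<in> ball z0 r \<Longrightarrow> (vector [t, z] :: complex^2) \<in> ball (vector [0, z0]) (3 * r)"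
proof -
  \<comment> \<open>The norm is at most the sum of the two coordinate norms, hence below
    \<open>2 * r\<close>, and the radius \<open>3 * r\<close> leaves room.\<close>
  show in_ball: "(vector [t, z] :: complex^2) \<in> ball (vector [0, z0]) (3 * r)"
    if "t \<in> cball 0 r" "z \<in> ball z0 r" for t z
  proof -
    have "norm (vector [0, z0] - vector [t, z] :: complex^2) \<le>
        (\<Sum>i\<in>UNIV. norm ((vector [0, z0] - vector [t, z] :: complex^2) $ i))"
      unfolding norm_vec_def by (rule L2_set_le_sum) auto
    also have "\<dots> = norm t + norm (z0 - z)" by (simp add: sum_2)
    also have "\<dots> < 3 * r" using that r by (simp add: dist_norm)
    finally show ?thesis by (simp add: dist_norm)
  qed
  have vec: "vector [t, z] = (\<chi> i::2. if i = 1 then t else z)" for t z :: complex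
    by (auto simp: vec_eq_iff forall_2)
  have vc: "continuous_on S (\<lambda>p. vector [fst p, snd p] :: complex^2)" for S :: "(complex \<times> complex) set"
    unfolding vec
  proof (rule continuous_on_vec_lambda)
    fix i :: 2
    show "continuous_on S (\<lambda>p. if i = 1 then fst p else snd p)"
      by (cases "i = 1") (auto intro!: continuous_intros)
  qed
  have "continuous_on (cball 0 r \<times> ball z0 r) (\<lambda>p. g (vector [fst p, snd p]))"
    by (rule continuous_on_compose2[OF mv_holomorphic_on_imp_continuous_on[OF g] vc])
      (use in_ball in auto)
  thus "continuous_on (cball 0 r \<times> ball z0 r) (\<lambda>(t, z). f t z)"
    by (simp add: f_def case_prod_unfold)
  have hol_nth: "(\<lambda>t. (vector [t, z] :: complex^2) $ i) holomorphic_on S"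
      "(\<lambda>z. (vector [t, z] :: complex^2) $ i) holomorphic_on S" for t z i S
    by (cases "i = 1"; simp add: vec)+
  show "(\<lambda>t. f t z) holomorphic_on ball 0 r" if "z \<in> ball z0 r" for z
    unfolding f_def by (rule mv_holomorphic_on_compose_curve[OF g hol_nth(1)])
      (use in_ball that in auto)
  show "f t holomorphic_on ball z0 r" if "t \<in> cball 0 r" for t
    unfolding f_def by (rule mv_holomorphic_on_compose_curve[OF g hol_nth(2)])
      (use in_ball that in auto)
qed

text \<open>Unless the numerator vanishes identically, for \<open>z\<close> near but off
  \<open>z0\<close> it behaves like \<open>d z * t ^ l\<close> and the denominator like
  \<open>c z * t ^ k\<close>, with \<open>d z\<close> and \<open>c z\<close> nonzero. So the limit
  is \<open>0\<close> exactly if \<open>k < l\<close>, a condition independent of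
  \<open>z\<close>.\<close>

lemma quotient_limit_dichotomy:
  fixes \<Phi> :: "complex^2 \<Rightarrow> complex"
  assumes "mv_quotient_at \<Phi> (vector [0, z0])"
  defines "good \<equiv> \<lambda>z. ((\<lambda>t. \<Phi> (vector [complex_of_real t, z])) \<longlongrightarrow> 0) (at_right 0)"
  shows "(\<forall>\<^sub>F z in at z0. good z) \<or> (\<forall>\<^sub>F z in at z0. \<not> good z)"
proof -
  obtain e g h where e: "e > 0" and g: "mv_holomorphic_on g (ball (vector [0, z0]) e)"
    and h: "mv_holomorphic_on h (ball (vector [0, z0]) e)"
    and nz: "\<And>V. open V \<Longrightarrow> V \<subseteq> ball (vector [0, z0]) e \<Longrightarrow> V \<noteq> {} \<Longrightarrow> \<exists>w\<in>V. h w \<noteq> 0"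
    and eq: "\<And>w. w \<in> ball (vector [0, z0]) e \<Longrightarrow> h w \<noteq> 0 \<Longrightarrow> \<Phi> w = g w / h w"
    using mv_quotient_at_ballE[OF assms(1)] by metis
  define r where "r = e / 3"
  have r: "r > 0" and e_eq: "e = 3 * r" using e by (auto simp: r_def)
  note sg = two_var_section[OF r g[unfolded e_eq]] and sh = two_var_section[OF r h[unfolded e_eq]]
  have V: "open (ball z0 r)" "connected (ball z0 r)" "z0 \<in> ball z0 r" using r by auto
  have real_lim: "filterlim complex_of_real (at 0) (at_right 0)"
    unfolding filterlim_at
    by (auto intro!: tendsto_eq_intros eventually_at_rightI[of 0 1])
  \<comment> \<open>The bidisc is a nonempty open set, on which \<open>h\<close> cannot vanish
    identically; this excludes the first alternative of \<open>leading_coeff_along_line\<close> for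
    \<open>h\<close>.\<close>
  have "\<not> (\<forall>t\<in>ball 0 r. \<forall>z\<in>ball z0 r. h (vector [t, z]) = 0)"
  proof
    assume 0: "\<forall>t\<in>ball 0 r. \<forall>z\<in>ball z0 r. h (vector [t, z]) = 0"
    define U where "U = (\<lambda>x::complex^2. x $ 1) -` ball 0 r \<inter> (\<lambda>x. x $ 2) -` ball z0 r"
    have vec: "x = vector [x $ 1, x $ 2]" for x :: "complex^2"
      by (simp add: vec_eq_iff forall_2)
    have c: "continuous_on UNIV (\<lambda>x::complex^2. x $ i)" for i by (intro continuous_intros)
    have "open U"
      unfolding U_def by (intro open_Int open_vimage open_ball c)
    moreover have "U \<subseteq> ball (vector [0, z0]) e"
    proof
      fix x assume "x \<in> U"
      thus "x \<in> ball (vector [0, z0]) e"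
        using sh(4)[of "x $ 1" "x $ 2"] vec[of x] by (simp add: U_def e_eq)
    qed
    moreover have "vector [0, z0] \<in> U" using r by (simp add: U_def)
    ultimately obtain x where "x \<in> U" "h x \<noteq> 0" using nz[of U] by blast
    moreover from \<open>x \<in> U\<close> have "h (vector [x $ 1, x $ 2]) = 0" using 0 by (auto simp: U_def)
    ultimately show False by (metis vec)
  qed
  then obtain k c where h_lim:
    "\<forall>\<^sub>F z in at z0. c z \<noteq> 0 \<and> ((\<lambda>t. h (vector [t, z]) / t ^ k) \<longlongrightarrow> c z) (at 0)"
    using leading_coeff_along_line[OF r V sh(1-3)] by blast
  have in_V: "\<forall>\<^sub>F z in at z0. z \<in> ball z0 r" by (rule eventually_at_in_open') (use r in auto)
  have in_r: "\<forall>\<^sub>F t in at_right 0. complex_of_real t \<in> ball 0 r"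
    by (rule eventually_at_rightI[of 0 r]) (use r in auto)
  have h_nz: "\<forall>\<^sub>F t in at_right 0. h (vector [complex_of_real t, z]) \<noteq> 0"
    if "c z \<noteq> 0" "((\<lambda>t. h (vector [t, z]) / t ^ k) \<longlongrightarrow> c z) (at 0)" for z
  proof -
    have "((\<lambda>t. h (vector [complex_of_real t, z]) / of_real t ^ k) \<longlongrightarrow> c z) (at_right 0)"
      by (rule filterlim_compose[OF that(2) real_lim])
    from tendsto_imp_eventually_ne[OF this that(1)] show ?thesis
      by eventually_elim auto
  qed
  show ?thesis
  proof (cases "\<forall>t\<in>ball 0 r. \<forall>z\<in>ball z0 r. g (vector [t, z]) = 0")
    case True
    have "\<forall>\<^sub>F z in at z0. good z"
      using h_lim in_V
    proof eventually_elim
      case (elim z)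
      have "\<forall>\<^sub>F t in at_right 0. \<Phi> (vector [complex_of_real t, z]) = 0"
        using h_nz[of z, OF conjunct1[OF elim(1)] conjunct2[OF elim(1)]] in_r
      proof eventually_elim
        case (elim t)
        thus ?case
          using True eq[of "vector [of_real t, z]"] sg(4)[of "of_real t" z] \<open>z \<in> ball z0 r\<close>
          by (simp add: e_eq)
      qed
      thus ?case unfolding good_def by (rule tendsto_eventually)
    qed
    thus ?thesis ..
  next
    case False
    then obtain l d where g_lim:
      "\<forall>\<^sub>F z in at z0. d z \<noteq> 0 \<and> ((\<lambda>t. g (vector [t, z]) / t ^ l) \<longlongrightarrow> d z) (at 0)"
      using leading_coeff_along_line[OF r V sg(1-3)] by blast
    define \<rho> where "\<rho> = (\<lambda>t z. (g (vector [complex_of_real t, z]) / of_real t ^ l) /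
      (h (vector [complex_of_real t, z]) / of_real t ^ k))"
    have lims: "\<forall>\<^sub>F z in at z0. z \<in> ball z0 r \<and> d z / c z \<noteq> 0 \<and>
        ((\<lambda>t. \<rho> t z) \<longlongrightarrow> d z / c z) (at_right 0) \<and>
        (\<forall>\<^sub>F t in at_right 0. \<Phi> (vector [complex_of_real t, z]) * of_real t ^ k = \<rho> t z * of_real t ^ l)"
      using h_lim g_lim in_V
    proof eventually_elim
      case (elim z)
      have "((\<lambda>t. \<rho> t z) \<longlongrightarrow> d z / c z) (at_right 0)"
        unfolding \<rho>_def using elim
        by (intro tendsto_divide filterlim_compose[OF _ real_lim, of _ "nhds (d z)"]
          filterlim_compose[OF _ real_lim, of _ "nhds (c z)"]) auto
      moreover have "\<forall>\<^sub>F t in at_right 0. t > (0::real)" by (rule eventually_at_right_less)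
      hence "\<forall>\<^sub>F t in at_right 0. \<Phi> (vector [complex_of_real t, z]) * of_real t ^ k = \<rho> t z * of_real t ^ l"
        using h_nz[of z, OF conjunct1[OF elim(1)] conjunct2[OF elim(1)]] in_r
      proof eventually_elim
        case (elim t)
        thus ?case
          using eq[of "vector [of_real t, z]"] sg(4)[of "of_real t" z] \<open>z \<in> ball z0 r\<close>
          by (simp add: e_eq \<rho>_def)
      qed
      ultimately show ?case using elim by auto
    qed
    have t0: "((\<lambda>t. complex_of_real t ^ n) \<longlongrightarrow> 0) (at_right 0)" if "n > 0" for n
      by (rule tendsto_eq_intros refl)+ (use that in auto)
    show ?thesis
    proof (cases "k < l")
      case True
      have "\<forall>\<^sub>F z in at z0. good z"
        using lims
      proof eventually_elim
        case (elim z)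
        have "((\<lambda>t. \<rho> t z * of_real t ^ (l - k)) \<longlongrightarrow> d z / c z * 0) (at_right 0)"
          using elim True by (intro tendsto_mult t0) auto
        moreover have "\<forall>\<^sub>F t in at_right 0. \<rho> t z * of_real t ^ (l - k) = \<Phi> (vector [complex_of_real t, z])"
          using conjunct2[OF conjunct2[OF conjunct2[OF elim]]] eventually_at_right_less[of "0::real"]
        proof eventually_elim
          case (elim t)
          have "of_real t ^ l = (of_real t ^ (l - k) * of_real t ^ k :: complex)"
            using True by (simp flip: power_add)
          with elim show ?case by simp
        qed
        ultimately show ?case unfolding good_def by (simp add: tendsto_cong)
      qed
      thus ?thesis ..
    next
      case False
      have "\<forall>\<^sub>F z in at z0. \<not> good z"
        using lims
      proof eventually_elim
        case (elim z)
        show ?case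
        proof
          assume "good z"
          \<comment> \<open>For \<open>l \<le> k\<close> the bounded factor
            \<open>t ^ (k - l)\<close> turns \<open>\<Phi>\<close> into \<open>\<rho>\<close>, so
            \<open>\<rho>\<close> would tend to \<open>0\<close> against its nonzero limit.\<close>
          hence "((\<lambda>t. \<Phi> (vector [complex_of_real t, z]) * of_real t ^ (k - l)) \<longlongrightarrow> 0 * 0 ^ (k - l)) (at_right 0)"
            unfolding good_def by (intro tendsto_mult tendsto_power tendsto_of_real_iff[THEN iffD2, of _ 0, simplified] tendsto_ident_at)
          moreover have "\<forall>\<^sub>F t in at_right 0. \<Phi> (vector [complex_of_real t, z]) * of_real t ^ (k - l) = \<rho> t z"
            using conjunct2[OF conjunct2[OF conjunct2[OF elim]]] eventually_at_right_less[of "0::real"]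
          proof eventually_elim
            case (elim t)
            have "of_real t ^ k = (of_real t ^ (k - l) * of_real t ^ l :: complex)"
              using False by (simp flip: power_add)
            with elim show ?case by simp
          qed
          ultimately have "((\<lambda>t. \<rho> t z) \<longlongrightarrow> 0) (at_right 0)" by (simp add: tendsto_cong)
          moreover have "((\<lambda>t. \<rho> t z) \<longlongrightarrow> d z / c z) (at_right 0)" using elim by blast
          ultimately have "d z / c z = 0" using tendsto_unique trivial_limit_at_right_real by blast
          thus False using elim by blast
        qed
      qed
      thus ?thesis ..
    qed
  qed
qed

text \<open>A point \<open>y\<close> of the neighbourhood other than \<open>z\<close> is served by
  the neighbourhood without \<open>z\<close>, which is still open.\<close>

lemma open_eventually_at:
  fixes P :: "'a::t1_space \<Rightarrow> bool"
  shows "open {z. \<forall>\<^sub>F w in at z. P w}"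
proof (subst open_subopen, rule ballI)
  fix z assume "z \<in> {z. \<forall>\<^sub>F w in at z. P w}"
  then obtain S where S: "open S" "z \<in> S" "\<And>w. w \<in> S \<Longrightarrow> w \<noteq> z \<Longrightarrow> P w"
    by (auto simp: eventually_at_topological)
  have "\<forall>\<^sub>F w in at y. P w" if y: "y \<in> S" for y
  proof (cases "y = z")
    case True
    thus ?thesis using S by (auto simp: eventually_at_topological)
  next
    case False
    thus ?thesis unfolding eventually_at_topological
      using S y by (intro exI[of _ "S - {z}"]) auto
  qed
  thus "\<exists>T. open T \<and> z \<in> T \<and> T \<subseteq> {z. \<forall>\<^sub>F w in at z. P w}" using S by blast
qed

lemma quotient_limit_propagates:
  fixes \<Phi> :: "complex^2 \<Rightarrow> complex"
  assumes "\<And>z. z \<in> closed_segment a b \<Longrightarrow> mv_quotient_at \<Phi> (vector [0, z])"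
  defines "good \<equiv> \<lambda>z. ((\<lambda>t. \<Phi> (vector [complex_of_real t, z])) \<longlongrightarrow> 0) (at_right 0)"
  assumes a: "\<forall>\<^sub>F z in at a. good z"
  shows "\<forall>\<^sub>F z in at b. good z"
proof (rule ccontr)
  assume b: "\<not> (\<forall>\<^sub>F z in at b. good z)"
  define A where "A = {z. \<forall>\<^sub>F w in at z. good w}"
  define B where "B = {z. \<forall>\<^sub>F w in at z. \<not> good w}"
  have "closed_segment a b \<subseteq> A \<union> B"
    using quotient_limit_dichotomy[OF assms(1)] unfolding A_def B_def good_def by blast
  moreover have "open A" "open B" unfolding A_def B_def by (rule open_eventually_at)+
  \<comment> \<open>Punctured neighbourhoods in the complex plane are nonempty, so the two
    alternatives exclude each other.\<close>
  moreover have "A \<inter> B = {}"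
  proof -
    have False if "\<forall>\<^sub>F w in at z. good w" "\<forall>\<^sub>F w in at z. \<not> good w" for z :: complex
      using eventually_happens'[OF _ eventually_conj[OF that]] by auto
    thus ?thesis unfolding A_def B_def by blast
  qed
  moreover have "a \<in> A" "b \<notin> A" using a b by (auto simp: A_def)
  ultimately show False
    using connectedD[OF connected_segment(1)[of a b], of A B] by (metis IntI empty_iff ends_in_segment UnE subset_iff Int_assoc Int_empty_left inf_commute)
qed

section \<open>Periodic zeta functions\<close>

text \<open>The \<open>N\<close>-th forward difference in \<open>z\<close> of the power
  \<open>z powr (-s)\<close>; every difference gains one power of decay.\<close>

fun dpow :: "nat \<Rightarrow> complex \<Rightarrow> complex \<Rightarrow> complex" where
  "dpow 0 s z = z powr (-s)"
| "dpow (Suc N) s z = dpow N s (z + 1) - dpow N s z"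

lemma pos_not_nonpos_Reals: "Re z > 0 \<Longrightarrow> z \<notin> \<real>\<^sub>\<le>\<^sub>0"
  by (auto simp: complex_nonpos_Reals_iff)

lemma has_field_derivative_dpow:
  "Re z > 0 \<Longrightarrow> (dpow N s has_field_derivative - s * dpow N (s + 1) z) (at z)"
proof (induction N arbitrary: z)
  case 0
  have "((\<lambda>z. z powr (- s)) has_field_derivative - s * z powr (- s - 1)) (at z)"
    using 0 by (intro has_field_derivative_powr pos_not_nonpos_Reals)
  moreover have "- (s + 1) = - s - 1" by simp
  ultimately show ?case by (simp only: dpow.simps)
next
  case (Suc N)
  have "((\<lambda>z. dpow N s (z + 1)) has_field_derivative - s * dpow N (s + 1) (z + 1)) (at z)"
    using Suc.IH[of "z + 1"] Suc.prems unfolding DERIV_shift by simp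
  thus ?case unfolding dpow.simps
    by (rule DERIV_diff[THEN DERIV_cong]) (use Suc in \<open>auto simp: algebra_simps\<close>)
qed

lemma pochhammer_nonneg_real: "x \<ge> 0 \<Longrightarrow> pochhammer (x::real) n \<ge> 0"
  by (simp add: pochhammer_prod prod_nonneg)

text \<open>A difference is bounded through the derivative \<open>- s * dpow N (s + 1)\<close>. The
  induction therefore changes \<open>s\<close> as well, and the factors \<open>s\<close>,
  \<open>s + 1\<close>, ... build up the Pochhammer symbol.\<close>

lemma norm_dpow_le:
  assumes "x \<ge> 1" "Re s + N \<ge> 0"
  shows "norm (dpow N s (of_real x)) \<le> pochhammer (norm s) N * x powr (- (Re s + N))"
  using assms
proof (induction N arbitrary: s x)
  case 0
  thus ?case by (simp add: norm_powr_real_powr)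
next
  case (Suc N)
  define B where "B = norm s * (pochhammer (norm (s + 1)) N * x powr (- (Re s + 1 + N)))"
  have "norm (dpow N s (of_real (x + 1)) - dpow N s (of_real x)) \<le> B * norm (of_real (x + 1) - of_real x :: complex)"
  proof (rule field_differentiable_bound[where S = "closed_segment (of_real x) (of_real (x + 1))"])
    fix z assume "z \<in> closed_segment (complex_of_real x) (of_real (x + 1))"
    then obtain y where y: "z = of_real y" "x \<le> y" "y \<le> x + 1"
      by (auto simp: closed_segment_of_real closed_segment_eq_real_ivl simp del: of_real_add)
    show "(dpow N s has_field_derivative - s * dpow N (s + 1) z)
        (at z within closed_segment (of_real x) (of_real (x + 1)))"
      by (rule has_field_derivative_at_within[OF has_field_derivative_dpow]) (use y Suc.prems in auto)
    have "norm (dpow N (s + 1) z) \<le> pochhammer (norm (s + 1)) N * y powr (- (Re (s + 1) + N))"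
      unfolding y(1) by (rule Suc.IH) (use y Suc.prems in auto)
    also have "\<dots> \<le> pochhammer (norm (s + 1)) N * x powr (- (Re (s + 1) + N))"
      using y Suc.prems by (intro mult_left_mono powr_mono2' pochhammer_nonneg_real)  auto
    finally show "norm (- s * dpow N (s + 1) z) \<le> B"
      unfolding B_def norm_mult norm_minus_cancel by (intro mult_left_mono) auto
  qed auto
  also have "norm (of_real (x + 1) - of_real x :: complex) = 1"
    by (simp flip: of_real_diff)
  also have "B * 1 \<le> norm s * (pochhammer (norm s + 1) N * x powr (- (Re s + 1 + N)))"
  proof -
    have "pochhammer (norm (s + 1)) N \<le> pochhammer (norm s + 1) N"
      unfolding pochhammer_prod using norm_triangle_ineq[of s 1] by (intro prod_mono) auto
    thus ?thesis unfolding B_def by (simp add: mult_left_mono mult_right_mono)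
  qed
  finally show ?case by (simp add: pochhammer_rec algebra_simps)
qed

lemma holomorphic_on_dpow:
  assumes "Re z > 0"
  shows "(\<lambda>s. dpow N s z) holomorphic_on A"
  using assms
proof (induction N arbitrary: z)
  case 0
  thus ?case by (auto intro!: holomorphic_intros)
next
  case (Suc N)
  thus ?case by (auto intro!: holomorphic_intros)
qed

lemma dpow_0_right: "Re z > 0 \<Longrightarrow> dpow N 0 z = (if N = 0 then 1 else 0)"
  by (induction N arbitrary: z) auto

definition dser :: "complex \<Rightarrow> nat \<Rightarrow> complex \<Rightarrow> complex" where
  "dser \<eta> N s = (\<Sum>n. \<eta> ^ Suc n * dpow N s (of_nat (Suc n)))"

lemma norm_dser_term_le:
  assumes "norm \<eta> = 1" "Re s + N \<ge> 0"
  shows "norm (\<eta> ^ Suc n * dpow N s (of_nat (Suc n))) \<le>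
    pochhammer (norm s) N * real (Suc n) powr (- (Re s + N))"
  using norm_dpow_le[of "real (Suc n)" s N] assms by (simp add: norm_mult norm_power)

lemma summable_Suc_powr: "a > 1 \<Longrightarrow> summable (\<lambda>n. real (Suc n) powr (- a))"
  using summable_real_powr_iff[of "-a"] summable_Suc_iff[of "\<lambda>n. real n powr (- a)"] by simp

lemma summable_dser:
  assumes "norm \<eta> = 1" "Re s + N > 1"
  shows "summable (\<lambda>n. \<eta> ^ Suc n * dpow N s (of_nat (Suc n)))"
  by (rule summable_comparison_test'[OF summable_mult[OF summable_Suc_powr]
        norm_dser_term_le]) (use assms in auto)

lemma holomorphic_on_dser:
  assumes \<eta>: "norm \<eta> = 1"
  shows "dser \<eta> N holomorphic_on {s. Re s + N > 1}"
proof -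
  define S where "S = {s. Re s + N > 1}"
  have "open S"
  proof -
    have "S = {s. Re s > 1 - real N}" by (auto simp: S_def)
    thus ?thesis by (simp add: open_halfspace_Re_gt)
  qed
  have "\<exists>g :: complex \<Rightarrow> complex. \<forall>x\<in>S. ((\<lambda>n. \<eta> ^ Suc n * dpow N x (of_nat (Suc n))) sums g x) \<and> g field_differentiable at x"
  proof (rule series_differentiable_comparison_complex[OF \<open>open S\<close>])
    fix n x assume "x \<in> S"
    have "(\<lambda>x. \<eta> ^ Suc n * dpow N x (of_nat (Suc n))) holomorphic_on UNIV"
      by (intro holomorphic_intros holomorphic_on_dpow) auto
    thus "(\<lambda>x. \<eta> ^ Suc n * dpow N x (of_nat (Suc n))) field_differentiable at x"
      by (simp add: holomorphic_on_def)
  next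
    fix x assume x: "x \<in> S"
    \<comment> \<open>Half the distance to the boundary of the half-plane: the majorant on the disc
      of radius \<open>d\<close> then has exponent \<open>Re x - d + N\<close>, which still exceeds
      \<open>1\<close>.\<close>
    define d where "d = (Re x + N - 1) / 2"
    have d: "d > 0" using x by (auto simp: d_def S_def)
    define h where "h = (\<lambda>n. complex_of_real (pochhammer (norm x + d) N * real (Suc n) powr (- (Re x - d + N))))"
    have "summable h"
      unfolding h_def by (intro summable_of_real summable_mult summable_Suc_powr)
        (use x in \<open>auto simp: d_def S_def field_simps\<close>)
    moreover have "range h \<subseteq> \<real>\<^sub>\<ge>\<^sub>0"
      using d unfolding h_def by (auto intro!: mult_nonneg_nonneg pochhammer_nonneg_real simp del: of_real_mult)
    moreover have "\<forall>\<^sub>F n in sequentially. \<forall>y\<in>ball x d \<inter> S.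
        norm (\<eta> ^ Suc n * dpow N y (of_nat (Suc n))) \<le> norm (h n)"
    proof (intro always_eventually allI ballI)
      fix n y assume y: "y \<in> ball x d \<inter> S"
      have "norm y \<le> norm x + d" "Re y \<ge> Re x - d"
      proof -
        have "norm (y - x) < d" using y by (auto simp: dist_norm norm_minus_commute)
        thus "norm y \<le> norm x + d" "Re y \<ge> Re x - d"
          using norm_triangle_sub[of y x] abs_Re_le_cmod[of "y - x"] by auto
      qed
      hence "pochhammer (norm y) N * real (Suc n) powr (- (Re y + N)) \<le>
          pochhammer (norm x + d) N * real (Suc n) powr (- (Re x - d + N))"
        unfolding pochhammer_prod using d
        by (intro mult_mono prod_mono powr_mono prod_nonneg) auto
      also have "\<dots> = norm (h n)"
        unfolding h_def norm_of_real using d by (subst abs_of_nonneg) (auto intro!: mult_nonneg_nonneg pochhammer_nonneg_real)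
      finally show "norm (\<eta> ^ Suc n * dpow N y (of_nat (Suc n))) \<le> norm (h n)"
        using norm_dser_term_le[OF \<eta>, of y N n] y by (auto simp: S_def)
    qed
    ultimately have "0 < d \<and> summable h \<and> range h \<subseteq> \<real>\<^sub>\<ge>\<^sub>0 \<and>
        (\<forall>\<^sub>F n in sequentially. \<forall>y\<in>ball x d \<inter> S.
           norm (\<eta> ^ Suc n * dpow N y (of_nat (Suc n))) \<le> norm (h n))"
      using d by (intro conjI)
    thus "\<exists>d (h :: nat \<Rightarrow> complex). 0 < d \<and> summable h \<and> range h \<subseteq> \<real>\<^sub>\<ge>\<^sub>0 \<and>
        (\<forall>\<^sub>F n in sequentially. \<forall>y\<in>ball x d \<inter> S.
           norm (\<eta> ^ Suc n * dpow N y (of_nat (Suc n))) \<le> norm (h n))"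
      by (rule exI[of _ d, OF exI[of _ h]])
  qed (rule exI)
  then obtain g where g: "\<And>x. x \<in> S \<Longrightarrow> (\<lambda>n. \<eta> ^ Suc n * dpow N x (of_nat (Suc n))) sums g x"
      "\<And>x. x \<in> S \<Longrightarrow> g field_differentiable at x" by blast
  have "g holomorphic_on S"
    using g(2) by (auto simp: holomorphic_on_def intro: field_differentiable_at_within)
  hence "dser \<eta> N holomorphic_on S"
    by (rule holomorphic_transform) (use g(1) in \<open>auto simp: dser_def sums_iff\<close>)
  thus ?thesis by (simp add: S_def)
qed

text \<open>Abel summation: the series of differences reassembles to a multiple of the original
  series up to the first term, and the factor \<open>1 - \<eta>\<close> that arises can be divided
  out.\<close>

lemma dser_rec:
  assumes \<eta>: "norm \<eta> = 1" "\<eta> \<noteq> 1" and s: "Re s + N > 1"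
  shows "dser \<eta> N s = \<eta> / (1 - \<eta>) * (dpow N s 1 + dser \<eta> (Suc N) s)"
proof -
  define b where "b = (\<lambda>n. dpow N s (of_nat (Suc n)))"
  have sm: "summable (\<lambda>n. \<eta> ^ Suc n * b n)" unfolding b_def using summable_dser[OF \<eta>(1) s] .
  have sm2: "summable (\<lambda>n. \<eta> ^ Suc (Suc n) * b (Suc n))"
    using sm by (subst summable_Suc_iff)
  have ne: "\<eta> \<noteq> 0" using \<eta> by auto
  have "dser \<eta> (Suc N) s = (\<Sum>n. inverse \<eta> * (\<eta> ^ Suc (Suc n) * b (Suc n)) - \<eta> ^ Suc n * b n)"
  proof -
    have "inverse \<eta> * (\<eta> ^ Suc (Suc n) * b (Suc n)) = \<eta> ^ Suc n * b (Suc n)" for n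
      using ne by simp
    moreover have "dpow (Suc N) s (of_nat (Suc n)) = b (Suc n) - b n" for n
      by (simp add: b_def add.commute)
    ultimately have "\<eta> ^ Suc n * dpow (Suc N) s (of_nat (Suc n)) =
        inverse \<eta> * (\<eta> ^ Suc (Suc n) * b (Suc n)) - \<eta> ^ Suc n * b n" for n
      by (simp only: right_diff_distrib)
    thus ?thesis unfolding dser_def by (simp only:)
  qed
  also have "\<dots> = inverse \<eta> * (\<Sum>n. \<eta> ^ Suc (Suc n) * b (Suc n)) - (\<Sum>n. \<eta> ^ Suc n * b n)"
    using sm sm2 by (subst suminf_diff[symmetric]) (auto intro: summable_mult simp: suminf_mult)
  also have "(\<Sum>n. \<eta> ^ Suc (Suc n) * b (Suc n)) = (\<Sum>n. \<eta> ^ Suc n * b n) - \<eta> * b 0"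
    using suminf_split_head[OF sm] by simp
  also have "(\<Sum>n. \<eta> ^ Suc n * b n) = dser \<eta> N s" by (simp add: dser_def b_def)
  finally have rec: "dser \<eta> (Suc N) s = inverse \<eta> * (dser \<eta> N s - \<eta> * b 0) - dser \<eta> N s" .
  have "\<eta> * dser \<eta> (Suc N) s = dser \<eta> N s - \<eta> * dpow N s 1 - \<eta> * dser \<eta> N s"
    unfolding rec right_diff_distrib[of \<eta>] mult.assoc[symmetric] using ne by (simp add: b_def)
  hence "(1 - \<eta>) * dser \<eta> N s = \<eta> * (dpow N s 1 + dser \<eta> (Suc N) s)"
    by (simp add: algebra_simps)
  moreover have "1 - \<eta> \<noteq> 0" using \<eta>(2) by simp
  ultimately show ?thesis by (simp add: field_simps)
qed

text \<open>
  The series \<open>\<Sum> \<eta>\<^sup>m m\<^sup>-\<^sup>s\<close> after \<open>N\<close> summations by parts; each of them moves the abscissa of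
  absolute convergence by one to the left.
\<close>

definition dser_ext :: "complex \<Rightarrow> nat \<Rightarrow> complex \<Rightarrow> complex" where
  "dser_ext \<eta> N s = (\<Sum>n<N. (\<eta> / (1 - \<eta>)) ^ Suc n * dpow n s 1) + (\<eta> / (1 - \<eta>)) ^ N * dser \<eta> N s"

lemma dser_ext_Suc:
  assumes "norm \<eta> = 1" "\<eta> \<noteq> 1" "Re s + N > 1"
  shows "dser_ext \<eta> (Suc N) s = dser_ext \<eta> N s"
  unfolding dser_ext_def using dser_rec[OF assms] by (simp add: algebra_simps)

lemma dser_ext_eq:
  assumes "norm \<eta> = 1" "\<eta> \<noteq> 1" "Re s + N > 1" "M \<ge> N"
  shows "dser_ext \<eta> M s = dser_ext \<eta> N s"
  using assms(4)
proof (induction M rule: dec_induct)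
  case (step m)
  have "Re s + real m > 1" using assms(3) step by linarith
  thus ?case using dser_ext_Suc[OF assms(1,2)] step by simp
qed simp

text \<open>The expressions for different \<open>N\<close> agree on common half-planes, so letting
  \<open>N\<close> depend on \<open>s\<close> gives a single entire function.\<close>

lemma periodic_zeta_entire:
  assumes \<eta>: "norm \<eta> = 1" "\<eta> \<noteq> 1"
  obtains F where "F holomorphic_on UNIV" "F 0 = \<eta> / (1 - \<eta>)"
    "\<And>s. Re s > 1 \<Longrightarrow> F s = (\<Sum>n. \<eta> ^ Suc n / of_nat (Suc n) powr s)"
proof -
  define F where "F = (\<lambda>s. dser_ext \<eta> (nat \<lceil>2 - Re s\<rceil>) s)"
  have F_eq: "F s = dser_ext \<eta> N s" if "Re s + N > 1" for s N
  proof -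
    define M where "M = nat \<lceil>2 - Re s\<rceil>"
    have "Re s + M > 1" unfolding M_def by linarith
    thus ?thesis unfolding F_def M_def[symmetric]
      using dser_ext_eq[OF \<eta>, of s N "max M N"] dser_ext_eq[OF \<eta>, of s M "max M N"] that by simp
  qed
  have "F field_differentiable at s" for s
  proof -
    define N where "N = nat \<lceil>2 - Re s\<rceil>"
    have N: "Re s + N > 1" unfolding N_def by linarith
    have op: "open {s. Re s + N > 1}"
    proof -
      have "{s. Re s + N > 1} = {s. Re s > 1 - real N}" by auto
      thus ?thesis by (simp add: open_halfspace_Re_gt)
    qed
    have "dser_ext \<eta> N holomorphic_on {s. Re s + N > 1}"
      unfolding dser_ext_def
      by (intro holomorphic_intros holomorphic_on_dser holomorphic_on_dpow \<eta>) auto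
    hence "F holomorphic_on {s. Re s + N > 1}"
      by (rule holomorphic_transform) (simp add: F_eq)
    thus ?thesis using N op holomorphic_on_imp_differentiable_at by blast
  qed
  hence "F holomorphic_on UNIV" by (simp add: holomorphic_on_def)
  \<comment> \<open>At \<open>s = 0\<close> the power is constant and all its differences vanish,
    which leaves only the summand \<open>n = 0\<close>.\<close>
  moreover have "F 0 = \<eta> / (1 - \<eta>)"
  proof -
    have "F 0 = dser_ext \<eta> (Suc (Suc 0)) 0" by (rule F_eq) simp
    moreover have "dpow (Suc (Suc 0)) 0 (of_nat (Suc n)) = 0" for n
      by (subst dpow_0_right) auto
    hence "dser \<eta> (Suc (Suc 0)) 0 = 0" unfolding dser_def by simp
    ultimately show ?thesis by (simp add: dser_ext_def)
  qed
  moreover have "F s = (\<Sum>n. \<eta> ^ Suc n / of_nat (Suc n) powr s)" if "Re s > 1" for s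
  proof -
    have "F s = dser_ext \<eta> 0 s" by (rule F_eq) (use that in simp)
    thus ?thesis by (simp add: dser_ext_def dser_def powr_minus field_simps)
  qed
  ultimately show ?thesis using that by blast
qed

section \<open>Uniqueness of the continuation, and the Riemann zeta function\<close>

lemma merom_ext_props:
  assumes M: "M meromorphic_on UNIV" and f: "\<And>s. Re s > 1 \<Longrightarrow> M s = f s"
    and an: "M analytic_on {s. Re s > 1}"
  shows "merom_ext f nicely_meromorphic_on UNIV"
    and "\<And>s. Re s > 1 \<Longrightarrow> merom_ext f s = f s"
    and "\<And>s. M analytic_on {s} \<Longrightarrow> merom_ext f s = M s"
proof -
  \<comment> \<open>With its singularities normalised \<open>M\<close> meets the description in
    \<open>merom_ext\<close>, so the choice there is from a nonempty set.\<close>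
  have "remove_sings M nicely_meromorphic_on UNIV" by (rule remove_sings_nicely_meromorphic[OF M])
  moreover have "remove_sings M s = f s" if "Re s > 1" for s
  proof -
    have "M analytic_on {s}" using an that by (auto intro: analytic_on_subset)
    thus ?thesis using f[OF that] by simp
  qed
  ultimately have "\<exists>F. F nicely_meromorphic_on UNIV \<and> (\<forall>s. Re s > 1 \<longrightarrow> F s = f s)" by blast
  from someI_ex[OF this]
  have F: "merom_ext f nicely_meromorphic_on UNIV" "\<And>s. Re s > 1 \<Longrightarrow> merom_ext f s = f s"
    unfolding merom_ext_def by auto
  thus "merom_ext f nicely_meromorphic_on UNIV" "\<And>s. Re s > 1 \<Longrightarrow> merom_ext f s = f s" by auto
  fix s assume s: "M analytic_on {s}"
  \<comment> \<open>The difference vanishes near \<open>2\<close>. After \<open>remove_sings\<close>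
    the identity theorem makes it \<open>0\<close> everywhere; for \<open>D\<close> itself this
    gives equality in punctured neighbourhoods.\<close>
  define D where "D = (\<lambda>s. merom_ext f s - M s)"
  have D: "D meromorphic_on UNIV"
    unfolding D_def using F(1) M by (intro meromorphic_intros) (auto simp: nicely_meromorphic_on_def)
  have "remove_sings D w = 0" for w
  proof (rule frequently_eq_meromorphic_imp_constant[of "remove_sings D" 0 2 UNIV])
    have ev: "\<forall>\<^sub>F z in at 2. z \<in> {s. Re s > 1}"
      by (rule eventually_at_in_open') (auto simp: open_halfspace_Re_gt)
    have "\<forall>\<^sub>F z in at 2. remove_sings D z = D z"
      using D by (intro eventually_remove_sings_eq_at meromorphic_on_isolated_singularity[of _ 2])
        (auto intro: meromorphic_on_subset)
    with ev have "\<forall>\<^sub>F z in at 2. remove_sings D z = 0"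
      by eventually_elim (auto simp: D_def F f)
    thus "\<exists>\<^sub>F z in at (2::complex). remove_sings D z = 0"
      by (intro eventually_frequently) auto
  qed (use remove_sings_nicely_meromorphic[OF D] in auto)
  moreover have "\<forall>\<^sub>F z in at s. remove_sings D z = D z"
    using D by (intro eventually_remove_sings_eq_at meromorphic_on_isolated_singularity[of _ s])
      (auto intro: meromorphic_on_subset)
  ultimately have "\<forall>\<^sub>F z in at s. merom_ext f z = M z" by (simp add: D_def)
  moreover have "M \<midarrow>s\<rightarrow> M s" using s analytic_at_imp_isCont isCont_def by blast
  ultimately have lim: "merom_ext f \<midarrow>s\<rightarrow> M s" by (simp add: tendsto_cong)
  \<comment> \<open>A finite limit excludes a pole, and away from poles a nicely meromorphic
    function takes its limit as value.\<close>
  hence "\<not> is_pole (merom_ext f) s"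
    using not_tendsto_and_filterlim_at_infinity[of "at s"] unfolding is_pole_def by auto
  hence "merom_ext f \<midarrow>s\<rightarrow> merom_ext f s"
    using F(1) by (auto simp: nicely_meromorphic_on_def)
  thus "merom_ext f s = M s" using LIM_unique lim by blast
qed

text \<open>Adding the series without signs cancels the terms with odd \<open>m = n + 1\<close> and
  doubles those with even \<open>m\<close>, which make up \<open>2 powr (1 - s)\<close> times the
  zeta series.\<close>

lemma alternating_zeta_series:
  assumes "Re s > 1"
  shows "(\<Sum>n. (-1) ^ Suc n / of_nat (Suc n) powr s) =
    (2 powr (1 - s) - 1) * (\<Sum>n. 1 / of_nat (Suc n) powr s)"
proof -
  define b where "b = (\<lambda>n. 1 / of_nat (Suc n) powr s :: complex)"
  have nb: "norm (b n) = real (Suc n) powr (- Re s)" for n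
    by (simp add: b_def norm_divide norm_inverse norm_powr_real_powr powr_minus divide_inverse del: of_nat_Suc)
  have sb: "summable b"
    by (rule summable_norm_cancel) (simp add: nb summable_Suc_powr assms del: of_nat_Suc)
  have sa: "summable (\<lambda>n. (-1) ^ Suc n * b n)"
    by (rule summable_norm_cancel)
      (simp add: norm_mult norm_power nb summable_Suc_powr assms del: of_nat_Suc)
  have "(\<Sum>n. (-1) ^ Suc n * b n) + (\<Sum>n. b n) = (\<Sum>n. (-1) ^ Suc n * b n + b n)"
    by (rule suminf_add[OF sa sb])
  also have "\<dots> = (\<Sum>k. (-1) ^ Suc (2 * k + 1) * b (2 * k + 1) + b (2 * k + 1))"
  proof (rule suminf_mono_reindex[symmetric])
    fix n :: nat assume "n \<notin> range (\<lambda>k. 2 * k + 1)"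
    hence "even n" by (metis oddE rangeI)
    thus "(-1) ^ Suc n * b n + b n = 0" by simp
  qed (simp add: strict_mono_def)
  also have "\<dots> = (\<Sum>k. 2 powr (1 - s) * b k)"
  proof (rule suminf_cong)
    fix k
    have "of_nat (Suc (2 * k + 1)) powr s = (2 * of_nat (Suc k) :: complex) powr s" by simp
    also have "\<dots> = 2 powr s * of_nat (Suc k) powr s"
      by (rule powr_times_real) auto
    finally show "(-1) ^ Suc (2 * k + 1) * b (2 * k + 1) + b (2 * k + 1) = 2 powr (1 - s) * b k"
      by (simp add: b_def powr_diff del: of_nat_Suc)
  qed
  also have "\<dots> = 2 powr (1 - s) * (\<Sum>k. b k)" by (rule suminf_mult[OF sb])
  finally show ?thesis by (simp add: b_def algebra_simps)
qed

lemma two_powr_ne_1: "Re s > 1 \<Longrightarrow> 2 powr (1 - s) \<noteq> (1::complex)"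
proof
  assume s: "Re s > 1" and "2 powr (1 - s) = (1::complex)"
  hence "norm (2 powr (1 - s) :: complex) = 1" by simp
  moreover have "norm (2 powr (1 - s) :: complex) = 2 powr (1 - Re s)"
    using norm_powr_real_powr[of 2 "1 - s"] by simp
  moreover have "(2::real) powr (1 - Re s) < 2 powr 0" using s by (intro powr_less_mono) auto
  ultimately show False by simp
qed

text \<open>The continuation is the entire alternating series divided by
  \<open>2 powr (1 - s) - 1\<close>. The zeros of this denominator lie on \<open>Re s = 1\<close>,
  outside the half-plane where analyticity is claimed.\<close>

lemma
  shows nicely_meromorphic_riemann_zeta: "riemann_zeta nicely_meromorphic_on UNIV"
    and riemann_zeta_series: "\<And>s. Re s > 1 \<Longrightarrow> riemann_zeta s = (\<Sum>n. 1 / of_nat (Suc n) powr s)"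
    and riemann_zeta_0: "riemann_zeta 0 = - 1 / 2"
    and analytic_on_riemann_zeta: "riemann_zeta analytic_on {s. Re s > 1}"
proof -
  obtain F where F: "F holomorphic_on UNIV" "F 0 = - 1 / (1 - (- 1))"
    "\<And>s. Re s > 1 \<Longrightarrow> F s = (\<Sum>n. (-1) ^ Suc n / of_nat (Suc n) powr s)"
    by (rule periodic_zeta_entire[of "-1"]) auto
  define M where "M = (\<lambda>s. F s / (2 powr (1 - s) - 1))"
  have hol: "(\<lambda>s. 2 powr (1 - s) - 1 :: complex) holomorphic_on UNIV" by (intro holomorphic_intros) auto
  have an: "M analytic_on {s}" if "2 powr (1 - s) \<noteq> 1" for s
  proof -
    have "F analytic_on {s}" "(\<lambda>s. 2 powr (1 - s) - 1 :: complex) analytic_on {s}"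
      using F(1) hol by (auto simp: analytic_on_open[symmetric] intro: analytic_on_subset)
    thus ?thesis unfolding M_def using that by (intro analytic_on_divide) auto
  qed
  have mero: "M meromorphic_on UNIV"
    unfolding M_def using F(1) hol
    by (intro meromorphic_on_divide) (auto intro!: analytic_on_imp_meromorphic_on simp: analytic_on_open)
  have an1: "M analytic_on {s. Re s > 1}"
    using an two_powr_ne_1 by (subst analytic_on_analytic_at) blast
  have eq: "M s = (\<Sum>n. 1 / of_nat (Suc n) powr s)" if "Re s > 1" for s
    using F(3)[OF that] alternating_zeta_series[OF that] two_powr_ne_1[OF that] by (simp add: M_def)
  note props = merom_ext_props[OF mero _ an1, of "\<lambda>s. \<Sum>n. 1 / of_nat (Suc n) powr s", folded riemann_zeta_def]
  show "riemann_zeta nicely_meromorphic_on UNIV" by (rule props(1)) (rule eq)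
  show "riemann_zeta s = (\<Sum>n. 1 / of_nat (Suc n) powr s)" if "Re s > 1" for s
    by (rule props(2)[OF _ that]) (rule eq)
  \<comment> \<open>At \<open>0\<close> the denominator is \<open>1\<close>, so the value is that of
    the alternating series, \<open>\<eta> / (1 - \<eta>)\<close> for
    \<open>\<eta> = -1\<close>.\<close>
  have "riemann_zeta 0 = M 0" by (rule props(3)[OF _ an]) (use eq in auto)
  thus "riemann_zeta 0 = - 1 / 2" using F(2) by (simp add: M_def)
  have "M holomorphic_on {s. Re s > 1}" using an1 analytic_imp_holomorphic by blast
  hence "riemann_zeta holomorphic_on {s. Re s > 1}"
    by (rule holomorphic_transform) (simp add: eq props(2)[OF eq])
  thus "riemann_zeta analytic_on {s. Re s > 1}"
    by (simp add: analytic_on_open open_halfspace_Re_gt)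
qed

section \<open>Partial fractions and sums over the integers\<close>

text \<open>The principal part at \<open>x = 0\<close> of \<open>1 / (x ^ i * (x + M) ^ a)\<close>,
  with \<open>g j\<close> in place of \<open>1 / x ^ j\<close>. The placeholder makes it linear in
  \<open>g\<close>, so that sums over \<open>l\<close> and their limits can be inserted.\<close>

definition pf_part :: "'a::field \<Rightarrow> nat \<Rightarrow> nat \<Rightarrow> (nat \<Rightarrow> 'a) \<Rightarrow> 'a" where
  "pf_part M i a g = (\<Sum>\<omega><i. (-1) ^ \<omega> * of_nat ((\<omega> + a - 1) choose \<omega>) / M ^ (a + \<omega>) * g (i - \<omega>))"

text \<open>Pascal's rule for the coefficients. It mirrors \<open>M / (x ^ (i + 1) * y ^ (a + 1)) =
  1 / (x ^ (i + 1) * y ^ a) - 1 / (x ^ i * y ^ (a + 1))\<close> for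
  \<open>y = x + M\<close>.\<close>

lemma pf_part_rec:
  assumes "M \<noteq> 0"
  shows "M * pf_part M (Suc i) (Suc a) g = pf_part M (Suc i) a g - pf_part M i (Suc a) g"
proof -
  define t where "t = (\<lambda>\<omega> b. of_nat ((\<omega> + b - 1) choose \<omega>) :: 'a)"
  have "M * pf_part M (Suc i) (Suc a) g =
      (\<Sum>\<omega><Suc i. (-1) ^ \<omega> * t \<omega> (Suc a) / M ^ (a + \<omega>) * g (Suc i - \<omega>))"
    unfolding pf_part_def sum_distrib_left t_def using assms by (intro sum.cong) (auto simp: field_simps)
  also have "\<dots> = g (Suc i) / M ^ a +
      (\<Sum>\<omega><i. (-1) ^ Suc \<omega> * t (Suc \<omega>) (Suc a) / M ^ (a + Suc \<omega>) * g (i - \<omega>))"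
    by (subst sum.lessThan_Suc_shift) (simp add: t_def)
  also have "(\<Sum>\<omega><i. (-1) ^ Suc \<omega> * t (Suc \<omega>) (Suc a) / M ^ (a + Suc \<omega>) * g (i - \<omega>)) =
      (\<Sum>\<omega><i. (-1) ^ Suc \<omega> * t (Suc \<omega>) a / M ^ (a + Suc \<omega>) * g (i - \<omega>)) -
      (\<Sum>\<omega><i. (-1) ^ \<omega> * t \<omega> (Suc a) / M ^ (Suc a + \<omega>) * g (i - \<omega>))"
    unfolding sum_subtractf[symmetric]
  proof (rule sum.cong)
    fix \<omega>
    have "t (Suc \<omega>) (Suc a) = t (Suc \<omega>) a + t \<omega> (Suc a)" by (simp add: t_def)
    thus "(-1) ^ Suc \<omega> * t (Suc \<omega>) (Suc a) / M ^ (a + Suc \<omega>) * g (i - \<omega>) =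
        (-1) ^ Suc \<omega> * t (Suc \<omega>) a / M ^ (a + Suc \<omega>) * g (i - \<omega>) -
        (-1) ^ \<omega> * t \<omega> (Suc a) / M ^ (Suc a + \<omega>) * g (i - \<omega>)"
      by (simp add: add_divide_distrib diff_divide_distrib algebra_simps)
  qed simp
  also have "g (Suc i) / M ^ a + ((\<Sum>\<omega><i. (-1) ^ Suc \<omega> * t (Suc \<omega>) a / M ^ (a + Suc \<omega>) * g (i - \<omega>)) -
      (\<Sum>\<omega><i. (-1) ^ \<omega> * t \<omega> (Suc a) / M ^ (Suc a + \<omega>) * g (i - \<omega>))) =
      (\<Sum>\<omega><Suc i. (-1) ^ \<omega> * t \<omega> a / M ^ (a + \<omega>) * g (Suc i - \<omega>)) - pf_part M i (Suc a) g"
    by (subst sum.lessThan_Suc_shift) (simp add: t_def pf_part_def binomial_eq_0)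
  finally show ?thesis by (simp add: pf_part_def t_def)
qed

lemma pf_part_0_left [simp]: "pf_part M 0 a g = 0"
  by (simp add: pf_part_def)

lemma pf_part_0_right: "i > 0 \<Longrightarrow> pf_part M i 0 g = g i"
proof -
  assume "i > 0"
  then obtain k where k: "i = Suc k" by (cases i) auto
  show ?thesis
    unfolding k pf_part_def by (subst sum.lessThan_Suc_shift) (simp add: binomial_eq_0)
qed

lemma pf_part_add: "pf_part M i a (\<lambda>j. g j + h j) = pf_part M i a g + pf_part M i a h"
  by (simp add: pf_part_def distrib_left sum.distrib)

lemma pf_part_diff: "pf_part M i a (\<lambda>j. g j - h j) = pf_part M i a g - pf_part M i a h"
  by (simp add: pf_part_def right_diff_distrib sum_subtractf)

lemma pf_part_cmult: "pf_part M i a (\<lambda>j. k * g j) = k * pf_part M i a g"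
  by (simp add: pf_part_def sum_distrib_left mult_ac)

text \<open>Induction on \<open>i + a\<close>: writing \<open>M = y - x\<close> lowers one of the
  exponents, and by \<open>pf_part_rec\<close> both principal parts obey the same recursion.\<close>

lemma partial_fraction_decomp:
  fixes x y M :: "'a::field"
  assumes "x \<noteq> 0" "y \<noteq> 0" "M \<noteq> 0" "y = x + M" "i + a > 0"
  shows "1 / (x ^ i * y ^ a) = pf_part M i a (\<lambda>j. 1 / x ^ j) + pf_part (-M) a i (\<lambda>j. 1 / y ^ j)"
  using assms(5)
proof (induction "i + a" arbitrary: i a rule: less_induct)
  case less
  show ?case
  proof (cases "i = 0 \<or> a = 0")
    case True
    thus ?thesis using less.prems by (auto simp: pf_part_0_right)
  next
    case False
    then obtain k b where kb: "i = Suc k" "a = Suc b" by (metis not0_implies_Suc)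
    have IH1: "1 / (x ^ Suc k * y ^ b) = pf_part M (Suc k) b (\<lambda>j. 1 / x ^ j) + pf_part (-M) b (Suc k) (\<lambda>j. 1 / y ^ j)"
      by (rule less.hyps) (auto simp: kb)
    have IH2: "1 / (x ^ k * y ^ Suc b) = pf_part M k (Suc b) (\<lambda>j. 1 / x ^ j) + pf_part (-M) (Suc b) k (\<lambda>j. 1 / y ^ j)"
      by (rule less.hyps) (auto simp: kb)
    have "M * (1 / (x ^ Suc k * y ^ Suc b)) = 1 / (x ^ Suc k * y ^ b) - 1 / (x ^ k * y ^ Suc b)"
    proof -
      have "M = y - x" using assms(4) by simp
      thus ?thesis using assms(1,2) by (simp add: divide_simps)
    qed
    also have "\<dots> = M * pf_part M (Suc k) (Suc b) (\<lambda>j. 1 / x ^ j) -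
        (- M) * pf_part (-M) (Suc b) (Suc k) (\<lambda>j. 1 / y ^ j)"
    proof -
      have "- M \<noteq> 0" using assms(3) by simp
      note r = pf_part_rec[OF assms(3)] pf_part_rec[OF this]
      show ?thesis unfolding IH1 IH2 r by simp
    qed
    finally have "M * (1 / (x ^ Suc k * y ^ Suc b)) = M * (pf_part M (Suc k) (Suc b) (\<lambda>j. 1 / x ^ j) +
        pf_part (-M) (Suc b) (Suc k) (\<lambda>j. 1 / y ^ j))" by (simp add: algebra_simps)
    thus ?thesis using assms(3) unfolding kb by (simp only: mult_cancel_left) simp
  qed
qed

text \<open>
  The convention \<open>\<Lambda> 0 = -1\<close> makes the excluded terms of the sums below fit the general pattern.
  The term \<open>l = 0\<close> is \<open>0\<close> because of \<open>1 / 0 = 0\<close>.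
\<close>

definition root_lambda :: "complex \<Rightarrow> (nat \<Rightarrow> complex) \<Rightarrow> bool" where
  "root_lambda \<epsilon> \<Lambda> \<longleftrightarrow> norm \<epsilon> = 1 \<and> \<Lambda> 0 = -1 \<and>
     (\<forall>j>0. (\<lambda>N. \<Sum>l\<in>{- int N..int N}. \<epsilon> powi l / of_int l ^ j) \<longlonglongrightarrow> \<Lambda> j)"

text \<open>A shift by one only exchanges two boundary terms, which tend to \<open>0\<close>.
  Reindexing an absolutely convergent sum would not do, since for exponent \<open>1\<close> there is
  no absolute convergence.\<close>

lemma symmetric_sum_shift:
  fixes f :: "int \<Rightarrow> complex"
  assumes lim: "(\<lambda>N. \<Sum>l\<in>{- int N..int N}. f l) \<longlonglongrightarrow> L"
    and f: "(\<lambda>N. f (int N)) \<longlonglongrightarrow> 0" "(\<lambda>N. f (- int N)) \<longlonglongrightarrow> 0"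
  shows "(\<lambda>N. \<Sum>l\<in>{- int N..int N}. f (l + M)) \<longlonglongrightarrow> L"
proof -
  have shift: "(\<lambda>N. g (int N + k)) \<longlonglongrightarrow> 0" if "(\<lambda>N. g (int N)) \<longlonglongrightarrow> 0" for g :: "int \<Rightarrow> complex" and k
  proof -
    have "filterlim (\<lambda>N. nat (int N + k)) at_top sequentially"
      unfolding filterlim_at_top
    proof
      fix Z :: nat
      show "\<forall>\<^sub>F N in sequentially. Z \<le> nat (int N + k)"
        by (rule eventually_sequentiallyI[of "nat (int Z - k)"]) linarith
    qed
    from filterlim_compose[OF that this]
    have "(\<lambda>N. g (int (nat (int N + k)))) \<longlonglongrightarrow> 0" .
    moreover have "\<forall>\<^sub>F N in sequentially. g (int (nat (int N + k))) = g (int N + k)"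
      unfolding eventually_sequentially by (rule exI[of _ "nat (- k)"]) auto
    ultimately show ?thesis by (rule Lim_transform_eventually)
  qed
  have up: "(\<lambda>N. f (int N + k)) \<longlonglongrightarrow> 0" and down: "(\<lambda>N. f (- int N + k)) \<longlonglongrightarrow> 0" for k
    using shift[OF f(1), of k] shift[of "\<lambda>l. f (- l)" "- k", OF f(2)] by simp_all
  have tele: "(\<Sum>l\<in>{- int N..int N}. f (l + (M + 1))) =
      (\<Sum>l\<in>{- int N..int N}. f (l + M)) + (f (int N + (M + 1)) - f (- int N + M))" for N M
  proof -
    have "(\<Sum>l\<in>{- int N..int N}. f (l + (M + 1))) = (\<Sum>l\<in>{- int N + 1..int N + 1}. f (l + M))"
      by (rule sum.reindex_bij_witness[of _ "\<lambda>l. l - 1" "\<lambda>l. l + 1"]) (auto simp: algebra_simps)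
    also have "\<dots> + f (- int N + M) = (\<Sum>l\<in>{- int N..int N + 1}. f (l + M))"
    proof -
      have "{- int N..int N + 1} = insert (- int N) {- int N + 1..int N + 1}" by auto
      thus ?thesis by (simp add: add.commute)
    qed
    also have "\<dots> = (\<Sum>l\<in>{- int N..int N}. f (l + M)) + f (int N + (M + 1))"
    proof -
      have "{- int N..int N + 1} = insert (int N + 1) {- int N..int N}" by auto
      thus ?thesis by (simp add: algebra_simps)
    qed
    finally show ?thesis by (simp add: algebra_simps)
  qed
  show ?thesis
  proof (induction M rule: int_induct[of _ 0])
    case base
    thus ?case using lim by simp
  next
    case (step1 i)
    from tendsto_add[OF step1(2) tendsto_diff[OF up[of "i + 1"] down[of i]]]
    show ?case unfolding tele by simp
  next
    case (step2 i)
    have eq: "(\<Sum>l\<in>{- int N..int N}. f (l + (i - 1))) =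
        (\<Sum>l\<in>{- int N..int N}. f (l + i)) - (f (int N + i) - f (- int N + (i - 1)))" for N
      using tele[of "i - 1" N] by simp
    from tendsto_diff[OF step2(2) tendsto_diff[OF up[of i] down[of "i - 1"]]]
    show ?case unfolding eq by simp
  qed
qed

lemma norm_powi_1: "norm (\<epsilon>::complex) = 1 \<Longrightarrow> norm (\<epsilon> powi l) = 1"
  by (simp add: norm_power_int)

lemma root_lambda_shift:
  assumes "root_lambda \<epsilon> \<Lambda>" "j > 0"
  shows "(\<lambda>N. \<Sum>l\<in>{- int N..int N}. \<epsilon> powi l / of_int (l + M) ^ j) \<longlonglongrightarrow> \<epsilon> powi (-M) * \<Lambda> j"
proof -
  define f where "f = (\<lambda>l::int. \<epsilon> powi l / of_int l ^ j)"
  have ne: "\<epsilon> \<noteq> 0" and n1: "norm \<epsilon> = 1" using assms by (auto simp: root_lambda_def)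
  have inv: "(\<lambda>N. inverse (real N)) \<longlonglongrightarrow> 0" by (rule lim_inverse_n)
  have small: "norm (f l) \<le> inverse (of_int \<bar>l\<bar>)" for l
  proof (cases "l = 0")
    case False
    hence "(1::real) \<le> of_int \<bar>l\<bar>" by linarith
    hence "(of_int \<bar>l\<bar> :: real) ^ 1 \<le> of_int \<bar>l\<bar> ^ j" using assms(2) by (intro power_increasing) auto
    thus ?thesis using False n1
      by (simp add: f_def norm_divide norm_power norm_powi_1 divide_simps)
  qed (use assms in \<open>simp add: f_def\<close>)
  have "(\<lambda>N. f (int N)) \<longlonglongrightarrow> 0" "(\<lambda>N. f (- int N)) \<longlonglongrightarrow> 0"
    by (rule Lim_null_comparison[OF _ inv], rule always_eventually, use small[of "int _"] small[of "- int _"] in simp)+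
  moreover have "(\<lambda>N. \<Sum>l\<in>{- int N..int N}. f l) \<longlonglongrightarrow> \<Lambda> j"
    using assms by (simp add: root_lambda_def f_def)
  ultimately have "(\<lambda>N. \<Sum>l\<in>{- int N..int N}. f (l + M)) \<longlonglongrightarrow> \<Lambda> j"
    by (intro symmetric_sum_shift)
  from tendsto_mult_left[OF this, of "\<epsilon> powi (-M)"]
  have "(\<lambda>N. \<Sum>l\<in>{- int N..int N}. \<epsilon> powi (-M) * f (l + M)) \<longlonglongrightarrow> \<epsilon> powi (-M) * \<Lambda> j"
    by (simp add: sum_distrib_left)
  moreover have "\<epsilon> powi (-M) * f (l + M) = \<epsilon> powi l / of_int (l + M) ^ j" for l
    using ne by (simp add: f_def power_int_add power_int_minus field_simps)
  ultimately show ?thesis by simp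
qed

lemma summable_on_inverse_int_square: "(\<lambda>l::int. 1 / (of_int l :: real)\<^sup>2) summable_on UNIV"
proof -
  have n: "(\<lambda>n::nat. 1 / (real n)\<^sup>2) summable_on UNIV"
    using inverse_power_summable[of 2, where 'a=real]
    by (intro norm_summable_imp_summable_on) (simp add: inverse_eq_divide)
  have "(\<lambda>l::int. 1 / (of_int l :: real)\<^sup>2) summable_on {0..}"
    by (rule summable_on_reindex_bij_witness[of _ int nat, THEN iffD2, OF _ _ _ _ _ n]) auto
  moreover have "(\<lambda>l::int. 1 / (of_int l :: real)\<^sup>2) summable_on {..0}"
    by (rule summable_on_reindex_bij_witness[of _ "\<lambda>n. - int n" "\<lambda>l. nat (-l)", THEN iffD2, OF _ _ _ _ _ n]) auto
  moreover have "UNIV = {0..} \<union> {..0::int}" by auto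
  ultimately show ?thesis by (metis summable_on_union)
qed

text \<open>From \<open>u * v \<le> u^2 + v^2\<close>. The sum over all integers of this bound does
  not depend on the shift between \<open>x\<close> and \<open>y\<close>, so it can be summed over a
  further variable.\<close>

lemma inverse_power_mult_le:
  fixes x y :: int
  assumes "x \<noteq> 0" "y \<noteq> 0" "i > 0" "a > 0"
  shows "1 / (\<bar>of_int x\<bar> ^ i * \<bar>of_int y\<bar> ^ a) \<le> 1 / (of_int x)\<^sup>2 + 1 / (of_int y :: real)\<^sup>2"
proof -
  define X Y where "X = \<bar>real_of_int x\<bar>" and "Y = \<bar>real_of_int y\<bar>"
  have XY: "X \<ge> 1" "Y \<ge> 1" using assms(1,2) unfolding X_def Y_def by linarith+
  have "X ^ 1 \<le> X ^ i" "Y ^ 1 \<le> Y ^ a" using XY assms by (intro power_increasing; auto)+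
  hence "X * Y \<le> X ^ i * Y ^ a" using XY by (intro mult_mono) auto
  hence "1 / (X ^ i * Y ^ a) \<le> 1 / (X * Y)" using XY by (intro divide_left_mono) auto
  also have "\<dots> = 1 / X * (1 / Y)" by simp
  also have "\<dots> \<le> (1 / X)\<^sup>2 + (1 / Y)\<^sup>2"
  proof -
    define u v where "u = 1 / X" and "v = 1 / Y"
    have "u * v \<ge> 0" using XY by (simp add: u_def v_def)
    thus ?thesis using sum_squares_bound[of u v] unfolding u_def[symmetric] v_def[symmetric]
      by (simp add: mult.assoc)
  qed
  finally show ?thesis by (simp add: X_def Y_def power_divide)
qed

lemma summable_on_root_pf:
  assumes "norm (\<epsilon>::complex) = 1" "i > 0" "a > 0" "S \<inter> {0, -M} = {}"
  shows "(\<lambda>l. \<epsilon> powi l / (of_int l ^ i * of_int (l + M) ^ a)) summable_on S"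
proof -
  have s2: "(\<lambda>l. 1 / (of_int (l + M) :: real)\<^sup>2) summable_on UNIV"
    by (rule summable_on_reindex_bij_witness[of _ "\<lambda>l. l - M" "\<lambda>l. l + M", THEN iffD2,
        OF _ _ _ _ _ summable_on_inverse_int_square]) auto
  have "(\<lambda>l. norm (\<epsilon> powi l / (of_int l ^ i * of_int (l + M) ^ a))) summable_on S"
  proof (rule Infinite_Sum.abs_summable_on_comparison_test')
    show "(\<lambda>l. 1 / (of_int l :: real)\<^sup>2 + 1 / (of_int (l + M))\<^sup>2) summable_on S"
      by (intro summable_on_add) (rule summable_on_subset_banach[OF s2] summable_on_subset_banach[OF summable_on_inverse_int_square], simp)+
    fix l assume "l \<in> S"
    hence "l \<noteq> 0" "l \<noteq> -M" using assms(4) by auto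
    hence "l \<noteq> 0" "l + M \<noteq> 0" by linarith+
    thus "norm (\<epsilon> powi l / (of_int l ^ i * of_int (l + M) ^ a)) \<le> 1 / (of_int l)\<^sup>2 + 1 / (of_int (l + M))\<^sup>2"
      using inverse_power_mult_le[of l "l + M" i a] assms
      by (simp add: norm_divide norm_mult norm_power norm_powi_1 del: of_int_add)
  qed
  thus ?thesis by (rule abs_summable_summable)
qed

text \<open>Unlike \<open>pf_part\<close> this includes \<open>\<omega> = i\<close>. For
  \<open>g = \<Lambda>\<close> that term has the factor \<open>\<Lambda> 0 = -1\<close> and accounts
  for an integer excluded from the sum.\<close>

definition pf_full :: "complex \<Rightarrow> nat \<Rightarrow> nat \<Rightarrow> (nat \<Rightarrow> complex) \<Rightarrow> complex" where
  "pf_full M i a g = (\<Sum>\<omega>\<le>i. (-1) ^ \<omega> * of_nat ((\<omega> + a - 1) choose \<omega>) / M ^ (a + \<omega>) * g (i - \<omega>))"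

lemma pf_full_eq: "pf_full M i a g =
    pf_part M i a g + (-1) ^ i * of_nat ((i + a - 1) choose i) / M ^ (a + i) * g 0"
  by (simp add: pf_full_def pf_part_def lessThan_Suc_atMost[symmetric])

text \<open>The principal part at \<open>0\<close> evaluated at the other pole
  \<open>x = -M\<close>: all signs agree there, and the coefficients add up by the hockey-stick
  identity.\<close>

lemma pf_part_opposite:
  fixes M :: "'a::field_char_0"
  assumes "M \<noteq> 0" "i > 0" "a > 0"
  shows "pf_part M i a (\<lambda>j. 1 / (-M) ^ j) = (-1) ^ i * of_nat ((i + a - 1) choose a) / M ^ (a + i)"
proof -
  have "pf_part M i a (\<lambda>j. 1 / (-M) ^ j) =
      (\<Sum>\<omega><i. (-1) ^ i / M ^ (a + i) * of_nat ((\<omega> + a - 1) choose \<omega>))"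
    unfolding pf_part_def
  proof (rule sum.cong)
    fix \<omega> assume "\<omega> \<in> {..<i}"
    then obtain k where k: "i = \<omega> + k" by (metis lessThan_iff less_imp_add_positive)
    have "(-M) ^ k = (-1) ^ k * M ^ k" by (rule power_minus)
    moreover have "(1 :: 'a) / (-1) ^ k = (-1) ^ k" by (cases "even k") auto
    ultimately show "(-1) ^ \<omega> * of_nat ((\<omega> + a - 1) choose \<omega>) / M ^ (a + \<omega>) * (1 / (-M) ^ (i - \<omega>)) =
        (-1) ^ i / M ^ (a + i) * of_nat ((\<omega> + a - 1) choose \<omega>)"
      using assms(1) by (simp add: k power_add field_simps)
  qed simp
  also have "\<dots> = (-1) ^ i / M ^ (a + i) * of_nat (\<Sum>\<omega><i. ((\<omega> + a - 1) choose \<omega>))"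
    by (simp add: sum_distrib_left)
  also have "(\<Sum>\<omega><i. ((\<omega> + a - 1) choose \<omega>)) = (i + a - 1) choose a"
  proof -
    obtain i' a' where ia: "i = Suc i'" "a = Suc a'" using assms by (metis gr0_implies_Suc)
    have "(\<Sum>\<omega><i. ((\<omega> + a - 1) choose \<omega>)) = (\<Sum>\<omega>\<le>i'. ((a' + \<omega>) choose \<omega>))"
      by (simp add: ia lessThan_Suc_atMost add.commute)
    also have "\<dots> = Suc (a' + i') choose i'" by (rule sum_choose_lower)
    also have "\<dots> = (i + a - 1) choose a"
      using binomial_symmetric[of i' "Suc (a' + i')"] by (simp add: ia add.commute)
    finally show ?thesis .
  qed
  finally show ?thesis by simp
qed

text \<open>Lets an unconditional sum be computed along symmetric intervals, as the pieces of its
  partial fractions require.\<close>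

lemma filterlim_int_intervals:
  "filterlim (\<lambda>N. {- int N..int N} - B) (finite_subsets_at_top (- B)) sequentially"
  unfolding filterlim_finite_subsets_at_top
proof (intro allI impI)
  fix X :: "int set" assume X: "finite X \<and> X \<subseteq> - B"
  define N0 where "N0 = nat (\<Sum>x\<in>X. \<bar>x\<bar>)"
  show "\<forall>\<^sub>F N in sequentially. finite ({- int N..int N} - B) \<and> X \<subseteq> {- int N..int N} - B \<and>
      {- int N..int N} - B \<subseteq> - B"
    unfolding eventually_sequentially
  proof (intro exI allI impI conjI)
    fix N assume N: "N \<ge> N0"
    have "\<bar>x\<bar> \<le> int N" if "x \<in> X" for x
    proof -
      have "\<bar>x\<bar> \<le> (\<Sum>x\<in>X. \<bar>x\<bar>)" using X that by (intro member_le_sum) auto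
      also have "\<dots> \<le> int N" using N by (simp add: N0_def)
      finally show ?thesis .
    qed
    thus "X \<subseteq> {- int N..int N} - B" using X by fastforce
  qed auto
qed

text \<open>After partial fractions each pole yields the symmetric limits
  \<open>\<Lambda> j\<close>, the pole at \<open>-M\<close> with the factor
  \<open>\<epsilon> powi (-M)\<close> from the shift. From each of the two kinds of sums one
  excluded integer has to be subtracted.\<close>

lemma has_sum_root_pf:
  fixes M :: int
  assumes \<Lambda>: "root_lambda \<epsilon> \<Lambda>" and M: "M \<noteq> 0" and ia: "i > 0" "a > 0"
  shows "((\<lambda>l. \<epsilon> powi l / (of_int l ^ i * of_int (l + M) ^ a)) has_sum
    (pf_full (of_int M) i a \<Lambda> + \<epsilon> powi (-M) * pf_full (- of_int M) a i \<Lambda>)) (- {0, -M})"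
proof -
  define m :: complex where "m = of_int M"
  have m0: "m \<noteq> 0" using M by (simp add: m_def)
  have n1: "norm \<epsilon> = 1" and L0: "\<Lambda> 0 = -1" and e0: "\<epsilon> \<noteq> 0" using \<Lambda> by (auto simp: root_lambda_def)
  define f where "f = (\<lambda>l. \<epsilon> powi l / (of_int l ^ i * of_int (l + M) ^ a))"
  define V where "V = pf_part m i a (\<lambda>j. \<Lambda> j - \<epsilon> powi (-M) / (-m) ^ j) +
     pf_part (-m) a i (\<lambda>j. \<epsilon> powi (-M) * \<Lambda> j - 1 / m ^ j)"
  have sm: "f summable_on (- {0, -M})"
    unfolding f_def using n1 ia by (rule summable_on_root_pf) auto
  \<comment> \<open>At \<open>l = 0\<close> the summand is already \<open>0\<close> by
    \<open>1 / 0 = 0\<close>, so only \<open>l = -M\<close> is taken away. In \<open>Y\<close> the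
    two integers exchange their roles.\<close>
  have X: "(\<lambda>N. \<Sum>l\<in>{- int N..int N} - {0, -M}. \<epsilon> powi l / of_int l ^ j) \<longlonglongrightarrow> \<Lambda> j - \<epsilon> powi (-M) / (-m) ^ j"
    if j: "j > 0" for j
  proof -
    have "(\<lambda>N. (\<Sum>l\<in>{- int N..int N}. \<epsilon> powi l / of_int l ^ j) - \<epsilon> powi (-M) / (-m) ^ j)
        \<longlonglongrightarrow> \<Lambda> j - \<epsilon> powi (-M) / (-m) ^ j"
      using \<Lambda> j by (intro tendsto_diff tendsto_const) (auto simp: root_lambda_def)
    moreover have "\<forall>\<^sub>F N in sequentially. (\<Sum>l\<in>{- int N..int N}. \<epsilon> powi l / of_int l ^ j) - \<epsilon> powi (-M) / (-m) ^ j =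
        (\<Sum>l\<in>{- int N..int N} - {0, -M}. \<epsilon> powi l / of_int l ^ j)"
      unfolding eventually_sequentially
    proof (intro exI allI impI)
      fix N assume N: "N \<ge> nat \<bar>M\<bar>"
      have "(\<Sum>l\<in>{- int N..int N} - {0, -M}. \<epsilon> powi l / of_int l ^ j) =
          (\<Sum>l\<in>{- int N..int N} - {-M}. \<epsilon> powi l / of_int l ^ j)"
        by (rule sum.mono_neutral_left) (use j in auto)
      also have "\<dots> = (\<Sum>l\<in>{- int N..int N}. \<epsilon> powi l / of_int l ^ j) - \<epsilon> powi (-M) / (-m) ^ j"
        by (subst sum_diff1) (use N in \<open>auto simp: m_def\<close>)
      finally show "(\<Sum>l\<in>{- int N..int N}. \<epsilon> powi l / of_int l ^ j) - \<epsilon> powi (-M) / (-m) ^ j =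
        (\<Sum>l\<in>{- int N..int N} - {0, -M}. \<epsilon> powi l / of_int l ^ j)" by simp
    qed
    ultimately show ?thesis by (rule Lim_transform_eventually)
  qed
  have Y: "(\<lambda>N. \<Sum>l\<in>{- int N..int N} - {0, -M}. \<epsilon> powi l / of_int (l + M) ^ j) \<longlonglongrightarrow> \<epsilon> powi (-M) * \<Lambda> j - 1 / m ^ j"
    if j: "j > 0" for j
  proof -
    have "(\<lambda>N. (\<Sum>l\<in>{- int N..int N}. \<epsilon> powi l / of_int (l + M) ^ j) - 1 / m ^ j)
        \<longlonglongrightarrow> \<epsilon> powi (-M) * \<Lambda> j - 1 / m ^ j"
      by (intro tendsto_diff tendsto_const root_lambda_shift[OF \<Lambda> j])
    moreover have "(\<Sum>l\<in>{- int N..int N}. \<epsilon> powi l / of_int (l + M) ^ j) - 1 / m ^ j =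
        (\<Sum>l\<in>{- int N..int N} - {0, -M}. \<epsilon> powi l / of_int (l + M) ^ j)" for N
    proof -
      have "(\<Sum>l\<in>{- int N..int N} - {0, -M}. \<epsilon> powi l / of_int (l + M) ^ j) =
          (\<Sum>l\<in>{- int N..int N} - {0}. \<epsilon> powi l / of_int (l + M) ^ j)"
        by (rule sum.mono_neutral_left) (use j in auto)
      also have "\<dots> = (\<Sum>l\<in>{- int N..int N}. \<epsilon> powi l / of_int (l + M) ^ j) - 1 / m ^ j"
        by (subst sum_diff1) (auto simp: m_def)
      finally show ?thesis by simp
    qed
    ultimately show ?thesis by simp
  qed
  have lin: "(\<Sum>l\<in>A. pf_part M' i' a' (g l)) = pf_part M' i' a' (\<lambda>j. \<Sum>l\<in>A. g l j)"
    for A :: "int set" and M' :: complex and i' a' and g :: "int \<Rightarrow> nat \<Rightarrow> complex"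
    unfolding pf_part_def by (subst sum.swap) (simp add: sum_distrib_left)
  have "f l = pf_part m i a (\<lambda>j. \<epsilon> powi l / of_int l ^ j) + pf_part (-m) a i (\<lambda>j. \<epsilon> powi l / of_int (l + M) ^ j)"
    if "l \<notin> {0, -M}" for l
  proof -
    have "of_int (l + M) \<noteq> (0::complex)" using that by (simp only: of_int_eq_0_iff) auto
    hence "1 / (of_int l ^ i * of_int (l + M) ^ a) =
      pf_part m i a (\<lambda>j. 1 / of_int l ^ j) + pf_part (-m) a i (\<lambda>j. 1 / of_int (l + M) ^ j)"
      by (intro partial_fraction_decomp) (use that m0 ia in \<open>auto simp: m_def\<close>)
    hence "f l = \<epsilon> powi l * (pf_part m i a (\<lambda>j. 1 / of_int l ^ j) + pf_part (-m) a i (\<lambda>j. 1 / of_int (l + M) ^ j))"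
      unfolding f_def by (metis times_divide_eq_right mult.right_neutral)
    thus ?thesis by (simp add: distrib_left flip: pf_part_cmult)
  qed
  hence sum_eq: "(\<Sum>l\<in>{- int N..int N} - {0, -M}. f l) =
      pf_part m i a (\<lambda>j. \<Sum>l\<in>{- int N..int N} - {0, -M}. \<epsilon> powi l / of_int l ^ j) +
      pf_part (-m) a i (\<lambda>j. \<Sum>l\<in>{- int N..int N} - {0, -M}. \<epsilon> powi l / of_int (l + M) ^ j)" for N
    by (simp add: sum.distrib flip: lin)
  have "(\<lambda>N. \<Sum>l\<in>{- int N..int N} - {0, -M}. f l) \<longlonglongrightarrow> V"
    unfolding sum_eq V_def unfolding pf_part_def
    by (intro tendsto_intros X Y) auto
  moreover have "(\<lambda>N. \<Sum>l\<in>{- int N..int N} - {0, -M}. f l) \<longlonglongrightarrow> infsum f (- {0, -M})"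
    by (rule filterlim_compose[OF infsum_tendsto[OF sm] filterlim_int_intervals])
  ultimately have "infsum f (- {0, -M}) = V" by (rule LIMSEQ_unique[symmetric])
  with sm have "(f has_sum V) (- {0, -M})" by (simp add: has_sum_iff)
  \<comment> \<open>The corrections match crosswise: removing \<open>l = 0\<close> from the sums at
    the pole \<open>-M\<close> supplies the last term of the first \<open>pf_full\<close>, and
    removing \<open>l = -M\<close> from the sums at the pole \<open>0\<close> that of the
    second.\<close>
  moreover have "V = pf_full m i a \<Lambda> + \<epsilon> powi (-M) * pf_full (-m) a i \<Lambda>"
  proof -
    have o1: "pf_part m i a (\<lambda>j. \<epsilon> powi (-M) / (-m) ^ j) =
        \<epsilon> powi (-M) * ((-1) ^ i * of_nat ((i + a - 1) choose a) / m ^ (a + i))"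
      using pf_part_opposite[OF m0 ia] pf_part_cmult[of m i a "\<epsilon> powi (-M)" "\<lambda>j. 1 / (-m) ^ j"] by simp
    have o2: "pf_part (-m) a i (\<lambda>j. 1 / m ^ j) = (-1) ^ a * of_nat ((a + i - 1) choose i) / (-m) ^ (i + a)"
      using pf_part_opposite[of "-m" a i] m0 ia by simp
    have sign: "(-1) ^ a / (-m) ^ (i + a) = (-1) ^ i / m ^ (a + i)"
    proof -
      have "(-m) ^ (i + a) = (-1) ^ i * (-1) ^ a * m ^ (i + a)"
        by (subst power_minus) (simp add: power_add)
      thus ?thesis by (cases "even i"; cases "even a") (auto simp: add.commute)
    qed
    define t where "t = (-1) ^ i / m ^ (a + i)"
    have r1: "(-1) ^ i * c / m ^ (a + i) = t * c" for c by (simp add: t_def)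
    have r2: "(-1) ^ a * c / (-m) ^ (i + a) = t * c" for c
      unfolding t_def sign[symmetric] by simp
    have r3: "pf_part (-m) a i (\<lambda>j. \<epsilon> powi (-M) * \<Lambda> j) = \<epsilon> powi (-M) * pf_part (-m) a i \<Lambda>"
      by (rule pf_part_cmult)
    show ?thesis
      unfolding V_def pf_part_diff o1 o2 pf_full_eq L0 r1 r2 r3
      by (simp add: algebra_simps)
  qed
  ultimately show ?thesis by (simp add: f_def m_def)
qed

section \<open>Special values\<close>

text \<open>The terms at \<open>l\<close> and \<open>-l\<close> are paired; the term at
  \<open>l = 0\<close> is \<open>0\<close> since \<open>j > 0\<close>.\<close>

lemma symmetric_sum_eq:
  assumes "j > 0"
  shows "(\<Sum>l\<in>{- int N..int N}. \<epsilon> powi l / of_int l ^ j) =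
    (\<Sum>n<N. (\<epsilon> ^ Suc n + (-1) ^ j * inverse \<epsilon> ^ Suc n) / of_nat (Suc n) ^ j :: complex)"
proof (induction N)
  case 0
  show ?case using assms by simp
next
  case (Suc N)
  have "{- int (Suc N)..int (Suc N)} = insert (- int (Suc N)) (insert (int (Suc N)) {- int N..int N})"
    by auto
  moreover have "\<epsilon> powi (- int (Suc N)) / of_int (- int (Suc N)) ^ j =
      (-1) ^ j * inverse \<epsilon> ^ Suc N / of_nat (Suc N) ^ j"
  proof -
    have "\<epsilon> powi (- int (Suc N)) = inverse \<epsilon> ^ Suc N"
      by (simp only: power_int_minus power_int_of_nat power_inverse)
    moreover have "(of_int (- int (Suc N)) :: complex) ^ j = (-1) ^ j * of_nat (Suc N) ^ j"
      by (simp only: of_int_minus of_int_of_nat_eq power_minus[of "of_nat (Suc N)" j])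
    moreover have "x / ((-1) ^ j * y) = (-1) ^ j * x / y" for x y :: complex
      by (cases "even j") auto
    ultimately show ?thesis by simp
  qed
  moreover have "\<epsilon> powi (int (Suc N)) / of_int (int (Suc N)) ^ j = \<epsilon> ^ Suc N / of_nat (Suc N) ^ j"
    by (simp only: power_int_of_nat of_int_of_nat_eq)
  ultimately show ?case using Suc
    by (simp add: add_divide_distrib del: of_nat_Suc power_Suc of_int_of_nat_eq power_int_minus)
qed

lemma root_lambdaI:
  assumes "norm \<epsilon> = 1" "\<Lambda> 0 = -1"
    "\<And>j. j > 0 \<Longrightarrow> (\<lambda>n. (\<epsilon> ^ Suc n + (-1) ^ j * inverse \<epsilon> ^ Suc n) / of_nat (Suc n) ^ j) sums \<Lambda> j"
  shows "root_lambda \<epsilon> \<Lambda>"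
  using assms unfolding root_lambda_def by (simp add: symmetric_sum_eq sums_def)

lemma summable_Suc_power:
  assumes "j > 1" "norm \<eta> = 1"
  shows "summable (\<lambda>n. \<eta> ^ Suc n / of_nat (Suc n) ^ j :: complex)"
proof -
  have "summable (\<lambda>n. real (Suc n) powr (- real j))" using assms by (intro summable_Suc_powr) auto
  moreover have "norm (\<eta> ^ Suc n / of_nat (Suc n) ^ j) = real (Suc n) powr (- real j)" for n
    using assms by (simp add: norm_divide norm_power powr_minus powr_realpow field_simps del: of_nat_Suc power_Suc)
  ultimately show ?thesis by (intro summable_norm_cancel[of "\<lambda>n. \<eta> ^ Suc n / of_nat (Suc n) ^ j"]) simp
qed

lemma of_nat_Suc_powr_of_nat: "of_nat (Suc n) powr of_nat j = (of_nat (Suc n) :: complex) ^ j"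
  by (rule powr_nat') (metis of_nat_neq_0)

lemma riemann_zeta_sums:
  assumes "j > 1"
  shows "(\<lambda>n. 1 / of_nat (Suc n) ^ j) sums riemann_zeta (of_nat j)"
proof -
  have "riemann_zeta (of_nat j) = (\<Sum>n. 1 / of_nat (Suc n) ^ j)"
    using assms by (subst riemann_zeta_series) (simp_all only: of_nat_Suc_powr_of_nat, simp)
  thus ?thesis using summable_Suc_power[of j 1] assms by (simp add: summable_sums)
qed

lemma alternating_zeta_sums:
  assumes "j > 1"
  shows "(\<lambda>n. (-1) ^ Suc n / of_nat (Suc n) ^ j) sums phi (of_nat j)"
proof -
  have "phi (of_nat j) = (\<Sum>n. (-1) ^ Suc n / of_nat (Suc n) powr of_nat j)"
    unfolding phi_def using assms
    by (subst alternating_zeta_series) (simp_all add: riemann_zeta_series del: of_nat_Suc)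
  hence "phi (of_nat j) = (\<Sum>n. (-1) ^ Suc n / of_nat (Suc n) ^ j)"
    by (simp only: of_nat_Suc_powr_of_nat)
  thus ?thesis using summable_Suc_power[of j "-1"] assms by (simp add: summable_sums del: power_Suc of_nat_Suc)
qed

text \<open>For odd \<open>j\<close> the terms at \<open>l\<close> and \<open>-l\<close> cancel. At
  \<open>j = 0\<close> the value \<open>2 * riemann_zeta 0 = -1\<close> is the one that
  \<open>root_lambda\<close> asks for.\<close>

lemma root_lambda_1: "root_lambda 1 (\<lambda>j. if even j then 2 * riemann_zeta (of_nat j) else 0)"
proof (rule root_lambdaI)
  fix j :: nat assume j: "j > 0"
  show "(\<lambda>n. (1 ^ Suc n + (-1) ^ j * inverse 1 ^ Suc n) / of_nat (Suc n) ^ j) sums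
      (if even j then 2 * riemann_zeta (of_nat j) else 0)"
  proof (cases "even j")
    case True
    with j have "j > 1" by (cases "j = 1") auto
    from sums_mult[OF riemann_zeta_sums[OF this], of 2] True show ?thesis by simp
  qed auto
qed (auto simp: riemann_zeta_0)

lemma root_lambda_minus_1: "root_lambda (-1) (\<lambda>j. if even j then 2 * phi (of_nat j) else 0)"
proof (rule root_lambdaI)
  fix j :: nat assume j: "j > 0"
  have inv: "inverse (-1) = (-1 :: complex)" by simp
  have eq: "(y + (-1) ^ j * y) / x = (if even j then 2 * (y / x) else 0)" for x y :: complex
    by (cases "even j") auto
  show "(\<lambda>n. ((-1) ^ Suc n + (-1) ^ j * inverse (-1) ^ Suc n) / of_nat (Suc n) ^ j) sums
      (if even j then 2 * phi (of_nat j) else 0)"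
  proof (cases "even j")
    case True
    with j have "j > 1" by (cases "j = 1") auto
    from sums_mult[OF alternating_zeta_sums[OF this], of 2] True show ?thesis
      unfolding inv eq by (simp only: if_True)
  next
    case False
    thus ?thesis unfolding inv eq by (simp only: if_False sums_zero)
  qed
qed (auto simp: riemann_zeta_0 phi_def)

text \<open>At \<open>j = 1\<close> the convergence is only conditional, hence Leibniz'
  criterion.\<close>

lemma L_chi4_sums:
  assumes "j > 0"
  shows "(\<lambda>k. (-1) ^ k / of_nat (2 * k + 1) ^ j) sums L_chi4 (of_nat j)"
proof -
  define a where "a = (\<lambda>k. 1 / real (2 * k + 1) ^ j)"
  have "a \<longlonglongrightarrow> 0"
  proof (rule tendsto_sandwich[of "\<lambda>_. 0" a sequentially "\<lambda>k. inverse (real k)"])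
    have "a k \<le> inverse (real k)" if "k \<ge> 1" for k
    proof -
      have "real k \<le> real (2 * k + 1) ^ 1" by simp
      also have "\<dots> \<le> real (2 * k + 1) ^ j" using assms by (intro power_increasing) auto
      finally show ?thesis using that by (simp add: a_def divide_simps del: of_nat_add of_nat_mult)
    qed
    thus "\<forall>\<^sub>F k in sequentially. a k \<le> inverse (real k)"
      by (rule eventually_sequentiallyI)
  qed (auto simp: a_def lim_inverse_n)
  moreover have "monoseq a"
    by (rule decseq_imp_monoseq) (auto simp: decseq_def a_def intro!: divide_left_mono power_mono)
  ultimately have "summable (\<lambda>k. (-1) ^ k * a k)" by (rule summable_Leibniz(1))
  hence "summable (\<lambda>k. complex_of_real ((-1) ^ k * a k))" by (rule summable_of_real)
  moreover have "complex_of_real ((-1) ^ k * a k) = (-1) ^ k / of_nat (2 * k + 1) ^ j" for k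
    unfolding a_def of_real_mult of_real_divide of_real_power of_real_of_nat_eq by simp
  ultimately have "summable (\<lambda>k. (-1) ^ k / of_nat (2 * k + 1) ^ j :: complex)" by simp
  moreover have "L_chi4 (of_nat j) = (\<Sum>k. (-1) ^ k / of_nat (2 * k + 1) ^ j)"
  proof -
    have "of_nat (2 * k + 1) powr of_nat j = (of_nat (2 * k + 1) :: complex) ^ j" for k
      using of_nat_Suc_powr_of_nat[of "2 * k" j] by simp
    thus ?thesis unfolding L_chi4_def by (simp only:)
  qed
  ultimately show ?thesis by (simp add: summable_sums)
qed

text \<open>Half of the terms vanish by the factor \<open>1 + (-1) ^ (j + Suc n)\<close>. For even
  \<open>j\<close> the even integers remain and give the alternating zeta series scaled by
  \<open>2 / 2 ^ j\<close>; for odd \<open>j\<close> the odd ones remain and give the character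
  series.\<close>

lemma Lambda_sums:
  assumes j: "j > 0"
  shows "(\<lambda>n. (\<i> ^ Suc n + (-1) ^ j * inverse \<i> ^ Suc n) / of_nat (Suc n) ^ j) sums Lambda j \<i>"
proof -
  define f where "f = (\<lambda>n. (\<i> ^ Suc n + (-1) ^ j * inverse \<i> ^ Suc n) / of_nat (Suc n) ^ j)"
  have inv: "inverse \<i> ^ m = (-1) ^ m * \<i> ^ m" for m
    using power_minus[of \<i> m] by simp
  have f: "f n = \<i> ^ Suc n * (1 + (-1) ^ (j + Suc n)) / of_nat (Suc n) ^ j" for n
    unfolding f_def inv power_add[of "-1" j "Suc n"] by (simp add: algebra_simps del: power_Suc)
  have i2: "\<i> ^ (2 * k) = (-1) ^ k" for k by (simp add: power_mult)
  show ?thesis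
  proof (cases "even j")
    case True
    with j have j1: "j > 1" by (cases "j = 1") auto
    have fk: "f (2 * k + 1) = 2 / 2 ^ j * ((-1) ^ Suc k / of_nat (Suc k) ^ j)" for k
    proof -
      have "f (2 * k + 1) = \<i> ^ (2 * Suc k) * 2 / of_nat (2 * Suc k) ^ j"
        unfolding f using True by simp
      also have "\<dots> = (-1) ^ Suc k * 2 / (2 ^ j * of_nat (Suc k) ^ j)"
        unfolding i2 of_nat_mult power_mult_distrib by simp
      finally show ?thesis by simp
    qed
    have "(\<lambda>k. f (2 * k + 1)) sums (2 / 2 ^ j * phi (of_nat j))"
      unfolding fk by (intro sums_mult alternating_zeta_sums j1)
    also have "?this \<longleftrightarrow> f sums (2 / 2 ^ j * phi (of_nat j))"
    proof (rule sums_mono_reindex)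
      fix n :: nat assume "n \<notin> range (\<lambda>k. 2 * k + 1)"
      hence "even n" by (metis oddE rangeI)
      thus "f n = 0" using True by (simp add: f)
    qed (simp add: strict_mono_def)
    also have "2 / 2 ^ j * phi (of_nat j) = Lambda j \<i>"
    proof -
      have "(2 powr (1 - of_nat j) :: complex) = 2 / 2 ^ j"
        by (simp add: powr_diff powr_nat')
      moreover have "(2 powi (1 - int j) :: complex) = 2 / 2 ^ j"
        by (simp add: power_int_diff)
      ultimately show ?thesis using True by (simp add: Lambda_def phi_def)
    qed
    finally show ?thesis unfolding f_def .
  next
    case False
    have fk: "f (2 * k) = 2 * \<i> * ((-1) ^ k / of_nat (2 * k + 1) ^ j)" for k
      unfolding f using False by (simp add: i2)
    have "(\<lambda>k. f (2 * k)) sums (2 * \<i> * L_chi4 (of_nat j))"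
      unfolding fk by (intro sums_mult L_chi4_sums j)
    also have "?this \<longleftrightarrow> f sums (2 * \<i> * L_chi4 (of_nat j))"
    proof (rule sums_mono_reindex)
      fix n :: nat assume "n \<notin> range (\<lambda>k. 2 * k)"
      hence "odd n" by (metis evenE rangeI)
      thus "f n = 0" using False by (simp add: f)
    qed (simp add: strict_mono_def)
    finally show ?thesis unfolding f_def using False by (simp add: Lambda_def)
  qed
qed

lemma Lambda_0: "Lambda 0 \<epsilon> = -1"
  by (simp add: Lambda_def riemann_zeta_0)

lemma root_lambda_i: "root_lambda \<i> (\<lambda>j. Lambda j \<i>)"
  by (rule root_lambdaI) (auto simp: Lambda_0 intro: Lambda_sums simp del: power_Suc of_nat_Suc inverse_i)

lemma root_lambda_minus_i: "root_lambda (-\<i>) (\<lambda>j. Lambda j (-\<i>))"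
proof (rule root_lambdaI)
  fix j :: nat assume j: "j > 0"
  have inv: "inverse (-\<i>) = \<i>" "inverse \<i> = - \<i>" by simp_all
  \<comment> \<open>Passing from \<open>\<i>\<close> to its inverse \<open>-\<i>\<close> exchanges
    \<open>l\<close> and \<open>-l\<close>, which multiplies the sum by
    \<open>(-1) ^ j\<close>.\<close>
  have L: "Lambda j (-\<i>) = (-1) ^ j * Lambda j \<i>" by (auto simp: Lambda_def complex_eq_iff)
  have eq: "((-\<i>) ^ Suc n + (-1) ^ j * \<i> ^ Suc n) / of_nat (Suc n) ^ j =
      (-1) ^ j * ((\<i> ^ Suc n + (-1) ^ j * (-\<i>) ^ Suc n) / of_nat (Suc n) ^ j)" for n
    by (cases "even j") (auto simp: diff_divide_distrib add_divide_distrib simp del: power_Suc of_nat_Suc)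
  show "(\<lambda>n. ((-\<i>) ^ Suc n + (-1) ^ j * inverse (-\<i>) ^ Suc n) / of_nat (Suc n) ^ j) sums Lambda j (-\<i>)"
    unfolding inv(1) L eq using sums_mult[OF Lambda_sums[OF j], of "(-1) ^ j"] unfolding inv(2) .
qed (auto simp: Lambda_0)

section \<open>Periodic zeta functions as unordered sums\<close>

lemma norm_summable_imp_has_sum_from_1:
  fixes f :: "nat \<Rightarrow> complex"
  assumes "summable (\<lambda>n. norm (f (Suc n)))"
  shows "(f has_sum (\<Sum>n. f (Suc n))) {1..}"
proof -
  have "((\<lambda>n. f (Suc n)) has_sum (\<Sum>n. f (Suc n))) UNIV"
    using assms summable_norm_cancel[OF assms] by (intro norm_summable_imp_has_sum) (auto simp: summable_sums)
  also have "?this \<longleftrightarrow> ?thesis"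
    by (rule has_sum_reindex_bij_witness[of _ "\<lambda>n. n - 1" Suc]) auto
  finally show ?thesis .
qed

lemma norm_of_nat_powr: "m > 0 \<Longrightarrow> norm (of_nat m powr s :: complex) = real m powr Re s"
  by (simp add: norm_powr_real_powr)

text \<open>The case \<open>\<eta> = 1\<close> is the Riemann zeta function, which is only
  meromorphic; every other \<open>\<eta>\<close> gives an entire function.\<close>

lemma periodic_zeta_meromorphic:
  assumes \<eta>: "norm \<eta> = 1"
  obtains F where "F meromorphic_on UNIV" "F analytic_on {s. Re s > 1}"
    "\<And>s. Re s > 1 \<Longrightarrow> ((\<lambda>m. \<eta> ^ m / of_nat m powr s) has_sum F s) {1..}"
proof -
  have hs: "((\<lambda>m. \<eta> ^ m / of_nat m powr s) has_sum (\<Sum>n. \<eta> ^ Suc n / of_nat (Suc n) powr s)) {1..}"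
    if s: "Re s > 1" for s
  proof (rule norm_summable_imp_has_sum_from_1)
    have "norm (\<eta> ^ Suc n / of_nat (Suc n) powr s) = real (Suc n) powr (- Re s)" for n
      using \<eta> by (simp add: norm_mult norm_inverse norm_power norm_of_nat_powr powr_minus divide_inverse del: of_nat_Suc power_Suc)
    thus "summable (\<lambda>n. norm (\<eta> ^ Suc n / of_nat (Suc n) powr s))"
      using summable_Suc_powr[OF s] by (simp only:)
  qed
  show ?thesis
  proof (cases "\<eta> = 1")
    case True
    have F: "riemann_zeta meromorphic_on UNIV"
      using nicely_meromorphic_riemann_zeta by (simp add: nicely_meromorphic_on_def)
    moreover note analytic_on_riemann_zeta
    ultimately show ?thesis
      using that[of riemann_zeta] hs True riemann_zeta_series by simp
  next
    case False
    then obtain F where F: "F holomorphic_on UNIV"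
        "\<And>s. Re s > 1 \<Longrightarrow> F s = (\<Sum>n. \<eta> ^ Suc n / of_nat (Suc n) powr s)"
      using periodic_zeta_entire[OF \<eta>] by metis
    hence "F analytic_on UNIV" by (simp add: analytic_on_open)
    hence "F meromorphic_on UNIV" "F analytic_on {s. Re s > 1}"
      by (auto intro: analytic_on_imp_meromorphic_on analytic_on_subset)
    thus ?thesis using that[of F] hs F(2) by simp
  qed
qed

section \<open>The double series\<close>

lemma has_sum_sum_finite:
  fixes f :: "'i \<Rightarrow> 'a \<Rightarrow> complex"
  assumes "finite I" "\<And>i. i \<in> I \<Longrightarrow> (f i has_sum s i) A"
  shows "((\<lambda>x. \<Sum>i\<in>I. f i x) has_sum (\<Sum>i\<in>I. s i)) A"
  using assms by (induction rule: finite_induct) (auto intro: has_sum_add)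

definition pair_index :: "(int \<times> nat) set" where
  "pair_index = {(l, m). l \<noteq> 0 \<and> 1 \<le> m \<and> l + int m \<noteq> 0}"

definition inv_squares :: real where
  "inv_squares = (\<Sum>\<^sub>\<infinity>l::int\<in>UNIV. 1 / (of_int l)\<^sup>2)"

lemma has_sum_inv_squares_shift:
  "((\<lambda>l. 1 / (of_int l)\<^sup>2 + 1 / (of_int (l + m))\<^sup>2) has_sum (2 * inv_squares)) (UNIV :: int set)"
proof -
  have 1: "((\<lambda>l::int. 1 / (of_int l)\<^sup>2) has_sum inv_squares) UNIV"
    unfolding inv_squares_def by (rule has_sum_infsum[OF summable_on_inverse_int_square])
  have 2: "((\<lambda>l::int. 1 / (of_int (l + m))\<^sup>2) has_sum inv_squares) UNIV"
    by (rule has_sum_reindex_bij_witness[of _ "\<lambda>l. l - m" "\<lambda>l. l + m", THEN iffD2, OF _ _ _ _ _ _ 1]) auto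
  from has_sum_add[OF 1 2] show ?thesis by simp
qed

lemma summable_on_powr_from_1:
  assumes "\<sigma> > 1"
  shows "(\<lambda>m::nat. real m powr (- \<sigma>)) summable_on A"
proof -
  have "summable (\<lambda>n. real n powr (- \<sigma>))" using assms by (simp add: summable_real_powr_iff)
  hence "(\<lambda>m::nat. real m powr (- \<sigma>)) summable_on UNIV"
    by (intro norm_summable_imp_summable_on) simp
  thus ?thesis by (rule summable_on_subset_banach) simp
qed

lemma summable_on_pair_bound:
  assumes "\<sigma> > 1"
  shows "(\<lambda>(l, m). (1 / (of_int l)\<^sup>2 + 1 / (of_int (l + int m))\<^sup>2) * real m powr (- \<sigma>)) summable_on pair_index"
proof -
  \<comment> \<open>The variables are exchanged so that the sum over \<open>l\<close> is the inner
    one; it contributes the constant \<open>2 * inv_squares\<close> for every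
    \<open>m\<close>.\<close>
  define f where "f = (\<lambda>(m, l). (1 / (of_int l)\<^sup>2 + 1 / (of_int (l + int m))\<^sup>2) * real m powr (- \<sigma>))"
  have "f summable_on (UNIV \<times> UNIV)"
  proof (rule summable_on_SigmaI)
    show "((\<lambda>l. f (m, l)) has_sum (2 * inv_squares * real m powr (- \<sigma>))) UNIV" for m
      unfolding f_def using has_sum_cmult_left[OF has_sum_inv_squares_shift[of "int m"]] by simp
    show "(\<lambda>m. 2 * inv_squares * real m powr (- \<sigma>)) summable_on UNIV"
      by (intro summable_on_cmult_right summable_on_powr_from_1 assms)
  qed (auto simp: f_def)
  hence "f summable_on (prod.swap ` pair_index)" by (rule summable_on_subset_banach) auto
  hence "(f \<circ> prod.swap) summable_on pair_index"
    by (subst summable_on_reindex[symmetric]) auto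
  thus ?thesis by (simp add: f_def o_def case_prod_unfold)
qed

lemma summable_on_frakT_term:
  assumes "norm x = 1" "norm y = 1" "Re s > 1" "p > 0" "q > 0"
  shows "(\<lambda>(l, m). x powi l * y ^ m / (of_int l ^ p * of_nat m powr s * of_int (l + int m) ^ q))
    summable_on pair_index"
proof (rule abs_summable_summable, rule Infinite_Sum.abs_summable_on_comparison_test')
  show "(\<lambda>(l, m). (1 / (of_int l)\<^sup>2 + 1 / (of_int (l + int m))\<^sup>2) * real m powr (- Re s)) summable_on pair_index"
    by (rule summable_on_pair_bound) fact
  fix z assume "z \<in> pair_index"
  then obtain l m where z: "z = (l, m)" "l \<noteq> 0" "m \<ge> 1" "l + int m \<noteq> 0" by (auto simp: pair_index_def)
  have "norm (x powi l * y ^ m / (of_int l ^ p * of_nat m powr s * of_int (l + int m) ^ q)) =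
      1 / (\<bar>of_int l\<bar> ^ p * \<bar>of_int (l + int m)\<bar> ^ q) * real m powr (- Re s)"
    using z(3) assms by (simp add: norm_mult norm_divide norm_inverse norm_power norm_powi_1 norm_of_nat_powr
      powr_minus divide_inverse del: of_int_add)
  also have "\<dots> \<le> (1 / (of_int l)\<^sup>2 + 1 / (of_int (l + int m))\<^sup>2) * real m powr (- Re s)"
    using inverse_power_mult_le[OF z(2,4) assms(4,5)] by (intro mult_right_mono) auto
  finally show "norm (case z of (l, m) \<Rightarrow> x powi l * y ^ m / (of_int l ^ p * of_nat m powr s * of_int (l + int m) ^ q))
      \<le> (case z of (l, m) \<Rightarrow> (1 / (of_int l)\<^sup>2 + 1 / (of_int (l + int m))\<^sup>2) * real m powr (- Re s))"
    by (simp add: z)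
qed

lemma analytic_on_shift:
  assumes "F analytic_on {s. Re s > 1}"
  shows "(\<lambda>s. F (s + of_nat k)) analytic_on {s. Re s > 1}"
proof -
  have "(\<lambda>s. s + of_nat k) analytic_on {s. Re s > 1}" by (intro analytic_intros)
  from analytic_on_compose_gen[OF this assms] show ?thesis by (simp add: o_def)
qed

lemma meromorphic_on_shift:
  assumes "F meromorphic_on UNIV"
  shows "(\<lambda>s. F (s + of_nat k)) meromorphic_on UNIV"
  by (rule meromorphic_on_compose[OF assms]) (auto intro!: analytic_intros)

lemma of_nat_powr_add:
  "m > 0 \<Longrightarrow> (of_nat m :: complex) powr (s + of_nat k) = of_nat m powr s * of_nat m ^ k"
  by (simp add: powr_add powr_nat')

text \<open>Summing over \<open>l\<close> for fixed \<open>m\<close> leaves finitely many terms.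
  Those from the pole \<open>l = 0\<close> carry \<open>y ^ m\<close>; those from the pole
  \<open>l = -m\<close> carry \<open>(y / x) ^ m\<close>, because the shift brings in
  \<open>x powi (-m)\<close>.\<close>

lemma frakT_props:
  assumes x: "root_lambda x \<Lambda>" and y: "norm y = 1" and pq: "p > 0" "q > 0"
  shows "(\<lambda>s. frakT p s q (x, y)) meromorphic_on UNIV"
    and "\<And>s. Re s > 1 \<Longrightarrow>
      ((\<lambda>(l, m). x powi l * y ^ m / (of_int l ^ p * of_nat m powr s * of_int (l + int m) ^ q))
         has_sum frakT p s q (x, y)) pair_index"
proof -
  have x1: "norm x = 1" and x0: "x \<noteq> 0" using x by (auto simp: root_lambda_def)
  obtain F where F: "F meromorphic_on UNIV" "F analytic_on {s. Re s > 1}"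
    "\<And>s. Re s > 1 \<Longrightarrow> ((\<lambda>m. y ^ m / of_nat m powr s) has_sum F s) {1..}"
    using periodic_zeta_meromorphic[OF y] by blast
  have "norm (y / x) = 1" using x1 y by (simp add: norm_divide)
  then obtain G where G: "G meromorphic_on UNIV" "G analytic_on {s. Re s > 1}"
    "\<And>s. Re s > 1 \<Longrightarrow> ((\<lambda>m. (y / x) ^ m / of_nat m powr s) has_sum G s) {1..}"
    using periodic_zeta_meromorphic by blast
  define cF where "cF = (\<lambda>\<omega>. (-1) ^ \<omega> * of_nat ((\<omega> + q - 1) choose \<omega>) * \<Lambda> (p - \<omega>))"
  \<comment> \<open>The sign \<open>(-1) ^ (p + \<omega>)\<close> stems from the powers of
    \<open>-m\<close> in the denominators of the second \<open>pf_full\<close>.\<close>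
  define cG where "cG = (\<lambda>\<omega>. (-1) ^ \<omega> * of_nat ((\<omega> + p - 1) choose \<omega>) * (-1) ^ (p + \<omega>) * \<Lambda> (q - \<omega>))"
  define M where "M = (\<lambda>s. (\<Sum>\<omega>\<le>p. cF \<omega> * F (s + of_nat (q + \<omega>))) + (\<Sum>\<omega>\<le>q. cG \<omega> * G (s + of_nat (p + \<omega>))))"
  have M_mero: "M meromorphic_on UNIV"
    unfolding M_def by (intro meromorphic_intros meromorphic_on_shift F G)
  have M_an: "M analytic_on {s. Re s > 1}"
    unfolding M_def by (intro analytic_intros analytic_on_shift F G)
  define f where "f = (\<lambda>s (l, m). x powi l * y ^ m / (of_int l ^ p * of_nat m powr s * of_int (l + int m) ^ q))"
  have hs: "(f s has_sum M s) pair_index" if s: "Re s > 1" for s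
  proof -
    define I where "I = Sigma {1::nat..} (\<lambda>m. - {0, - int m})"
    define g where "g = (\<lambda>m. y ^ m / of_nat m powr s *
      (pf_full (of_int (int m)) p q \<Lambda> + x powi (- int m) * pf_full (- of_int (int m)) q p \<Lambda>))"
    have I: "prod.swap ` pair_index = I" unfolding I_def pair_index_def
      by (force simp: image_iff add_eq_0_iff2)
    have sm: "(f s \<circ> prod.swap) summable_on I"
    proof -
      have "(f s \<circ> prod.swap) \<circ> prod.swap = f s" by (simp add: fun_eq_iff)
      hence "((f s \<circ> prod.swap) \<circ> prod.swap) summable_on pair_index"
        using summable_on_frakT_term[OF x1 y s pq] by (simp add: f_def)
      thus ?thesis unfolding I[symmetric] by (subst summable_on_reindex) auto
    qed
    have inner: "((\<lambda>l. (f s \<circ> prod.swap) (m, l)) has_sum g m) (- {0, - int m})" if "m \<in> {1..}" for m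
    proof -
      have "int m \<noteq> 0" using that by simp
      from has_sum_cmult_right[OF has_sum_root_pf[OF x this pq], of "y ^ m / of_nat m powr s"]
      show ?thesis unfolding g_def by (simp add: f_def mult_ac)
    qed
    have g_eq: "g m = (\<Sum>\<omega>\<le>p. cF \<omega> * (y ^ m / of_nat m powr (s + of_nat (q + \<omega>)))) +
        (\<Sum>\<omega>\<le>q. cG \<omega> * ((y / x) ^ m / of_nat m powr (s + of_nat (p + \<omega>))))" if "m \<in> {1..}" for m
    proof -
      have m: "m > 0" using that by simp
      have sgn: "u / (-v) ^ k = (-1) ^ k * u / v ^ k" for u v :: complex and k
        by (cases "even k") auto
      have "y ^ m / of_nat m powr s * pf_full (of_int (int m)) p q \<Lambda> =
          (\<Sum>\<omega>\<le>p. cF \<omega> * (y ^ m / of_nat m powr (s + of_nat (q + \<omega>))))"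
        unfolding pf_full_def sum_distrib_left of_nat_powr_add[OF m] cF_def by (simp add: mult_ac)
      moreover have "y ^ m / of_nat m powr s * (x powi (- int m) * pf_full (- of_int (int m)) q p \<Lambda>) =
          (\<Sum>\<omega>\<le>q. cG \<omega> * ((y / x) ^ m / of_nat m powr (s + of_nat (p + \<omega>))))"
        unfolding pf_full_def sum_distrib_left of_nat_powr_add[OF m] cG_def sgn
        using x0 by (simp add: mult_ac power_int_minus power_divide field_simps)
      ultimately show ?thesis unfolding g_def by (simp add: distrib_left)
    qed
    have "((\<lambda>m. (\<Sum>\<omega>\<le>p. cF \<omega> * (y ^ m / of_nat m powr (s + of_nat (q + \<omega>)))) +
        (\<Sum>\<omega>\<le>q. cG \<omega> * ((y / x) ^ m / of_nat m powr (s + of_nat (p + \<omega>))))) has_sum M s) {1..}"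
      unfolding M_def using s
      by (intro has_sum_add has_sum_sum_finite has_sum_cmult_right F(3) G(3)) auto
    hence outer: "(g has_sum M s) {1..}" by (subst has_sum_cong[OF g_eq])
    have "((f s \<circ> prod.swap) has_sum M s) I"
      unfolding I_def by (rule has_sum_SigmaI[OF inner outer sm[unfolded I_def]])
    hence "(((f s \<circ> prod.swap) \<circ> prod.swap) has_sum M s) pair_index"
      unfolding I[symmetric] by (subst (asm) has_sum_reindex) auto
    moreover have "(f s \<circ> prod.swap) \<circ> prod.swap = f s" by (simp add: fun_eq_iff)
    ultimately show ?thesis by simp
  qed
  have fr: "(\<lambda>s. frakT p s q (x, y)) = merom_ext (\<lambda>s. infsum (f s) pair_index)"
    unfolding frakT_def f_def pair_index_def by simp
  have M_eq: "M s = infsum (f s) pair_index" if "Re s > 1" for s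
    using hs[OF that] by (simp add: infsumI)
  note props = merom_ext_props[OF M_mero _ M_an, of "\<lambda>s. infsum (f s) pair_index", folded fr]
  show "(\<lambda>s. frakT p s q (x, y)) meromorphic_on UNIV"
    using props(1)[OF M_eq] by (simp add: nicely_meromorphic_on_def)
  fix s :: complex assume s: "Re s > 1"
  have "frakT p s q (x, y) = M s" using props(2)[OF M_eq s] M_eq[OF s] by simp
  thus "((\<lambda>(l, m). x powi l * y ^ m / (of_int l ^ p * of_nat m powr s * of_int (l + int m) ^ q))
         has_sum frakT p s q (x, y)) pair_index"
    using hs[OF s] by (simp add: f_def)
qed

text \<open>
  The common shape of the sums \<open>R\<close> and \<open>K\<close>: in \<open>T P k Q\<close> the argument \<open>k\<close> is the shift of
  the complex variable.
\<close>

definition K_form :: "(nat \<Rightarrow> complex) \<Rightarrow> nat \<Rightarrow> nat \<Rightarrow> nat \<Rightarrow> nat \<Rightarrow> nat \<Rightarrow>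
    (nat \<Rightarrow> nat \<Rightarrow> nat \<Rightarrow> complex) \<Rightarrow> (nat \<Rightarrow> nat \<Rightarrow> nat \<Rightarrow> complex) \<Rightarrow>
    (nat \<Rightarrow> nat \<Rightarrow> nat \<Rightarrow> complex) \<Rightarrow> (nat \<Rightarrow> nat \<Rightarrow> nat \<Rightarrow> complex) \<Rightarrow> complex" where
  "K_form \<Lambda> p q a b c T1 T2 T3 T4 =
     (-1) ^ p * (\<Sum>j\<le>p. \<Lambda> j * (-1) ^ j *
       (\<Sum>\<omega>\<le>p - j. of_nat ((\<omega> + a - 1) choose \<omega>) *
          of_nat ((p + c - j - \<omega> - 1) choose (c - 1)) * T1 (q + a + \<omega>) 0 (p + b + c - j - \<omega>)))
   + (-1) ^ (p + a) * (\<Sum>j\<le>c. \<Lambda> j *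
       (\<Sum>\<omega>\<le>c - j. of_nat ((\<omega> + a - 1) choose \<omega>) *
          of_nat ((p + c - j - \<omega> - 1) choose (p - 1)) * T2 q (a + \<omega>) (p + b + c - j - \<omega>)))
   + (-1) ^ p * (\<Sum>j\<le>a. \<Lambda> j *
       (\<Sum>\<omega>\<le>p - 1. of_nat ((\<omega> + a - j) choose \<omega>) *
          of_nat ((p + c - 2 - \<omega>) choose (c - 1)) * T3 (q + a - j + \<omega> + 1) 0 (p + b + c - 1 - \<omega>)))
   + (-1) ^ (p + a) * (\<Sum>j\<le>a. \<Lambda> j * (-1) ^ j *
       (\<Sum>\<omega>\<le>c - 1. of_nat ((\<omega> + a - j) choose \<omega>) *
          of_nat ((p + c - 2 - \<omega>) choose (p - 1)) * T4 q (a - j + \<omega> + 1) (p + b + c - 1 - \<omega>)))"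

lemma K_form_has_sum:
  assumes "\<And>P k Q. P > 0 \<Longrightarrow> Q > 0 \<Longrightarrow> ((\<lambda>z. T1 z P k Q) has_sum S1 P k Q) A"
    "\<And>P k Q. P > 0 \<Longrightarrow> Q > 0 \<Longrightarrow> ((\<lambda>z. T2 z P k Q) has_sum S2 P k Q) A"
    "\<And>P k Q. P > 0 \<Longrightarrow> Q > 0 \<Longrightarrow> ((\<lambda>z. T3 z P k Q) has_sum S3 P k Q) A"
    "\<And>P k Q. P > 0 \<Longrightarrow> Q > 0 \<Longrightarrow> ((\<lambda>z. T4 z P k Q) has_sum S4 P k Q) A"
    and pos: "p > 0" "q > 0" "a > 0" "b > 0" "c > 0"
  shows "((\<lambda>z. K_form \<Lambda> p q a b c (T1 z) (T2 z) (T3 z) (T4 z)) has_sum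
    K_form \<Lambda> p q a b c S1 S2 S3 S4) A"
  unfolding K_form_def
  by (intro has_sum_add has_sum_cmult_right has_sum_sum_finite assms(1-4)) (use pos in auto)

lemma K_form_meromorphic:
  assumes "\<And>P k Q. P > 0 \<Longrightarrow> Q > 0 \<Longrightarrow> (\<lambda>z. T1 z P k Q) meromorphic_on A"
    "\<And>P k Q. P > 0 \<Longrightarrow> Q > 0 \<Longrightarrow> (\<lambda>z. T2 z P k Q) meromorphic_on A"
    "\<And>P k Q. P > 0 \<Longrightarrow> Q > 0 \<Longrightarrow> (\<lambda>z. T3 z P k Q) meromorphic_on A"
    "\<And>P k Q. P > 0 \<Longrightarrow> Q > 0 \<Longrightarrow> (\<lambda>z. T4 z P k Q) meromorphic_on A"
    and pos: "p > 0" "q > 0" "a > 0" "b > 0" "c > 0"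
  shows "(\<lambda>z. K_form \<Lambda> p q a b c (T1 z) (T2 z) (T3 z) (T4 z)) meromorphic_on A"
  unfolding K_form_def
  by (intro meromorphic_on_add meromorphic_on_mult meromorphic_on_const meromorphic_on_sum assms(1-4))
    (use pos in auto)

text \<open>The substitution \<open>j = p - u - \<omega>\<close> for the outer index
  \<open>u\<close> collects the terms belonging to one \<open>\<Lambda> j\<close>.\<close>

lemma pf_full_pf_full:
  "pf_full N p c (\<lambda>i. pf_full m i a \<Lambda>) = (\<Sum>j\<le>p. \<Sum>\<omega>\<le>p - j. \<Lambda> j * (-1) ^ (p - j) *
     of_nat ((\<omega> + a - 1) choose \<omega>) * of_nat ((p - j - \<omega> + c - 1) choose (p - j - \<omega>)) /
     (m ^ (a + \<omega>) * N ^ (c + (p - j - \<omega>))))" (is "?L = ?R")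
proof -
  have "?L = (\<Sum>(u, w)\<in>Sigma {..p} (\<lambda>u. {..p - u}). \<Lambda> (p - u - w) * (-1) ^ (u + w) *
     of_nat ((w + a - 1) choose w) * of_nat ((u + c - 1) choose u) / (m ^ (a + w) * N ^ (c + u)))"
    unfolding pf_full_def sum_distrib_left
    by (subst sum.Sigma) (auto intro!: sum.cong simp: power_add mult_ac)
  also have "\<dots> = (\<Sum>(j, w)\<in>Sigma {..p} (\<lambda>j. {..p - j}). \<Lambda> j * (-1) ^ (p - j) *
     of_nat ((w + a - 1) choose w) * of_nat ((p - j - w + c - 1) choose (p - j - w)) /
     (m ^ (a + w) * N ^ (c + (p - j - w))))"
    by (rule sum.reindex_bij_witness[of _ "\<lambda>(j, w). (p - j - w, w)" "\<lambda>(u, w). (p - u - w, w)"]) auto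
  also have "\<dots> = ?R" by (subst sum.Sigma) auto
  finally show ?thesis .
qed

text \<open>Here the outer order enters the inner partial fractions as the multiplicity of the other
  pole, so the substitution is \<open>j = a - w\<close> and
  \<open>\<omega> = p - 1 - u\<close>.\<close>

lemma pf_part_pf_full:
  "pf_part N p c (\<lambda>i. pf_full m a i \<Lambda>) = (\<Sum>j\<le>a. \<Sum>\<omega><p. \<Lambda> j * (-1) ^ (p - 1 - \<omega> + (a - j)) *
     of_nat ((a - j + \<omega>) choose (a - j)) * of_nat ((p - 1 - \<omega> + c - 1) choose (p - 1 - \<omega>)) /
     (m ^ (\<omega> + 1 + (a - j)) * N ^ (c + (p - 1 - \<omega>))))" (is "?L = ?R")
proof -
  have "?L = (\<Sum>(u, w)\<in>{..<p} \<times> {..a}. \<Lambda> (a - w) * (-1) ^ (u + w) *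
     of_nat ((w + (p - u) - 1) choose w) * of_nat ((u + c - 1) choose u) / (m ^ (p - u + w) * N ^ (c + u)))"
    unfolding pf_part_def pf_full_def sum_distrib_left
    by (subst sum.Sigma) (auto intro!: sum.cong simp: power_add mult_ac)
  also have "\<dots> = (\<Sum>(j, \<omega>)\<in>{..a} \<times> {..<p}. \<Lambda> j * (-1) ^ (p - 1 - \<omega> + (a - j)) *
     of_nat ((a - j + \<omega>) choose (a - j)) * of_nat ((p - 1 - \<omega> + c - 1) choose (p - 1 - \<omega>)) /
     (m ^ (\<omega> + 1 + (a - j)) * N ^ (c + (p - 1 - \<omega>))))"
  proof (rule sum.reindex_bij_witness[of _ "\<lambda>(j, w). (p - 1 - w, a - j)" "\<lambda>(u, w). (a - w, p - 1 - u)"], goal_cases)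
    case (5 z)
    then obtain u w where z: "z = (u, w)" "u < p" "w \<le> a" by auto
    define k where "k = p - 1 - u"
    have k: "p - u = Suc k" "p - Suc u = k" "p - Suc k = u" "a - (a - w) = w"
      using z by (auto simp: k_def)
    show ?case
      by (simp add: z k)
  qed auto
  also have "\<dots> = ?R" by (subst sum.cartesian_product) auto
  finally show ?thesis .
qed

section \<open>The triple series\<close>

lemma divide_minus_one_power: "x / ((-1) ^ k * y) = (-1) ^ k * x / (y :: 'a::field)"
  by (cases "even k") auto

text \<open>The four double sums of \<open>K_form\<close> are nested partial fractions. In the
  application, with \<open>N = m + n\<close>, the first belongs to the pole \<open>l = 0\<close>,
  the second to \<open>l = - (m + n)\<close>, and the last two to \<open>l = -m\<close>, which
  occurs on both sides of the outer decomposition.\<close>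

lemma K_form_monomials:
  fixes m n N w X Y :: complex
  assumes "m \<noteq> 0" "n \<noteq> 0" "N \<noteq> 0" and pos: "p > 0" "a > 0" "c > 0"
  shows "K_form \<Lambda> p q a b c (\<lambda>P k Q. w / (m ^ P * n ^ k * N ^ Q)) (\<lambda>P k Q. w * Y / (m ^ P * n ^ k * N ^ Q))
      (\<lambda>P k Q. w * X / (m ^ P * n ^ k * N ^ Q)) (\<lambda>P k Q. w * X / (m ^ P * n ^ k * N ^ Q)) =
    w / (m ^ q * N ^ b) * (pf_full N p c (\<lambda>i. pf_full m i a \<Lambda>) +
      Y * pf_full (-N) c p (\<lambda>i. pf_full (-n) i a \<Lambda>) +
      X * (pf_part N p c (\<lambda>i. pf_full (-m) a i \<Lambda>) + pf_part (-N) c p (\<lambda>i. pf_full n a i \<Lambda>)))"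
proof -
  \<comment> \<open>\<open>K_form\<close> writes outer binomial coefficients with lower index
    \<open>c - 1\<close> or \<open>p - 1\<close>, partial fractions produce the complementary
    index.\<close>
  have sym: "(k + d - 1) choose (d - 1) = (k + d - 1) choose k" if "d > 0" for k d :: nat
    using binomial_symmetric[of k "k + d - 1"] that by simp
  have 1: "(-1) ^ p * (\<Sum>j\<le>p. \<Lambda> j * (-1) ^ j *
       (\<Sum>\<omega>\<le>p - j. of_nat ((\<omega> + a - 1) choose \<omega>) * of_nat ((p + c - j - \<omega> - 1) choose (c - 1)) *
         (w / (m ^ (q + a + \<omega>) * n ^ 0 * N ^ (p + b + c - j - \<omega>))))) =
      w / (m ^ q * N ^ b) * pf_full N p c (\<lambda>i. pf_full m i a \<Lambda>)"
    unfolding pf_full_pf_full sum_distrib_left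
  proof (intro sum.cong refl, goal_cases)
    case (1 j \<omega>)
    then obtain k where k: "p = j + \<omega> + k" by (metis atMost_iff le_Suc_ex le_diff_conv2 add.commute add.assoc)
    have e: "p + c - j - \<omega> - 1 = k + c - 1" "p + b + c - j - \<omega> = k + b + c" "p - j - \<omega> = k" "p - j = \<omega> + k"
      by (auto simp: k)
    show ?case
      unfolding e sym[OF pos(3)] unfolding k
      by (simp add: power_add mult_ac minus_one_power_iff)
  qed
  have 2: "(-1) ^ (p + a) * (\<Sum>j\<le>c. \<Lambda> j *
       (\<Sum>\<omega>\<le>c - j. of_nat ((\<omega> + a - 1) choose \<omega>) * of_nat ((p + c - j - \<omega> - 1) choose (p - 1)) *
         (w * Y / (m ^ q * n ^ (a + \<omega>) * N ^ (p + b + c - j - \<omega>))))) =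
      w / (m ^ q * N ^ b) * (Y * pf_full (-N) c p (\<lambda>i. pf_full (-n) i a \<Lambda>))"
    unfolding pf_full_pf_full sum_distrib_left
  proof (intro sum.cong refl, goal_cases)
    case (1 j \<omega>)
    then obtain k where k: "c = j + \<omega> + k" by (metis atMost_iff le_Suc_ex le_diff_conv2 add.commute add.assoc)
    have e: "p + c - j - \<omega> - 1 = k + p - 1" "p + b + c - j - \<omega> = k + b + p" "c - j - \<omega> = k" "c - j = \<omega> + k"
      by (auto simp: k)
    show ?case
      unfolding e sym[OF pos(1)] power_minus[of n] power_minus[of N]
      by (simp add: power_add mult_ac minus_one_power_iff)
  qed
  have 3: "(-1) ^ p * (\<Sum>j\<le>a. \<Lambda> j *
       (\<Sum>\<omega>\<le>p - 1. of_nat ((\<omega> + a - j) choose \<omega>) * of_nat ((p + c - 2 - \<omega>) choose (c - 1)) *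
         (w * X / (m ^ (q + a - j + \<omega> + 1) * n ^ 0 * N ^ (p + b + c - 1 - \<omega>))))) =
      w / (m ^ q * N ^ b) * (X * pf_part N p c (\<lambda>i. pf_full (-m) a i \<Lambda>))"
  proof -
    have idx: "{..p - 1} = {..<p}" using pos by auto
    show ?thesis unfolding idx pf_part_pf_full sum_distrib_left
    proof (intro sum.cong refl, goal_cases)
      case (1 j \<omega>)
      then obtain r k where k: "a = j + r" "p = Suc (\<omega> + k)"
        by (metis atMost_iff le_Suc_ex lessThan_iff less_imp_Suc_add)
      have e: "p + c - 2 - \<omega> = k + c - 1" "p + b + c - 1 - \<omega> = k + b + c" "p - 1 - \<omega> = k" "a - j = r"
          "\<omega> + a - j = r + \<omega>" "q + a - j + \<omega> + 1 = q + r + \<omega> + 1"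
        by (auto simp: k)
      have sym2: "(r + \<omega>) choose \<omega> = (r + \<omega>) choose r" using binomial_symmetric[of r "r + \<omega>"] by simp
      show ?case
        unfolding e sym[OF pos(3)] sym2 power_minus[of m] unfolding k
        by (simp add: power_add mult_ac minus_one_power_iff)
    qed
  qed
  have 4: "(-1) ^ (p + a) * (\<Sum>j\<le>a. \<Lambda> j * (-1) ^ j *
       (\<Sum>\<omega>\<le>c - 1. of_nat ((\<omega> + a - j) choose \<omega>) * of_nat ((p + c - 2 - \<omega>) choose (p - 1)) *
         (w * X / (m ^ q * n ^ (a - j + \<omega> + 1) * N ^ (p + b + c - 1 - \<omega>))))) =
      w / (m ^ q * N ^ b) * (X * pf_part (-N) c p (\<lambda>i. pf_full n a i \<Lambda>))"
  proof -
    have idx: "{..c - 1} = {..<c}" using pos by auto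
    show ?thesis unfolding idx pf_part_pf_full sum_distrib_left
    proof (intro sum.cong refl, goal_cases)
      case (1 j \<omega>)
      then obtain r k where k: "a = j + r" "c = Suc (\<omega> + k)"
        by (metis atMost_iff le_Suc_ex lessThan_iff less_imp_Suc_add)
      have e: "p + c - 2 - \<omega> = k + p - 1" "p + b + c - 1 - \<omega> = k + b + p" "c - 1 - \<omega> = k" "a - j = r"
          "\<omega> + a - j = r + \<omega>"
        by (auto simp: k)
      have sym2: "(r + \<omega>) choose \<omega> = (r + \<omega>) choose r" using binomial_symmetric[of r "r + \<omega>"] by simp
      show ?case
        unfolding e sym[OF pos(1)] sym2 power_minus[of N] unfolding k
        by (simp add: power_add mult_ac minus_one_power_iff)
    qed
  qed
  show ?thesis unfolding K_form_def 1 2 3 4 by (simp add: distrib_left)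
qed

lemma has_sum_pf_part:
  fixes M :: complex
  assumes "\<And>j. j > 0 \<Longrightarrow> ((\<lambda>l. g l j) has_sum S j) A"
  shows "((\<lambda>l. pf_part M i a (g l)) has_sum pf_part M i a S) A"
  unfolding pf_part_def by (intro has_sum_sum_finite has_sum_cmult_right assms) auto

lemma has_sum_remove:
  fixes f :: "'a \<Rightarrow> complex"
  assumes "(f has_sum s) (insert x A)" "x \<notin> A"
  shows "(f has_sum (s - f x)) A"
proof -
  have "f summable_on A"
    using assms(1) summable_on_subset_banach[of f "insert x A" A] by (auto simp: summable_on_def)
  then obtain t where t: "(f has_sum t) A" by (auto simp: summable_on_def)
  hence "(f has_sum (f x + t)) (insert x A)" using assms(2) by (intro has_sum_insert) auto
  hence "s = f x + t" using assms(1) has_sum_unique by blast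
  hence "s - f x = t" by simp
  thus ?thesis using t by simp
qed

text \<open>The poles \<open>l = 0\<close> and \<open>l = - (m + n)\<close> are separated first,
  while the factor \<open>(l + m) ^ a\<close> is kept. Each resulting term has two poles and is
  summed by \<open>has_sum_root_pf\<close>, from which one further integer has to be
  removed.\<close>

lemma has_sum_triple_inner:
  fixes m :: int and n :: nat
  assumes \<Lambda>: "root_lambda \<epsilon> \<Lambda>" and mn: "(m, n) \<in> pair_index" and pos: "p > 0" "a > 0" "c > 0"
  defines "\<mu> \<equiv> complex_of_int m" and "\<nu> \<equiv> complex_of_nat n" and "N \<equiv> complex_of_int (m + int n)"
  shows "((\<lambda>l. \<epsilon> powi l / (of_int l ^ p * of_int (l + m) ^ a * of_int (l + m + int n) ^ c)) has_sum
    (pf_full N p c (\<lambda>i. pf_full \<mu> i a \<Lambda>) +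
      \<epsilon> powi (- (m + int n)) * pf_full (-N) c p (\<lambda>i. pf_full (-\<nu>) i a \<Lambda>) +
      \<epsilon> powi (-m) * (pf_part N p c (\<lambda>i. pf_full (-\<mu>) a i \<Lambda>) + pf_part (-N) c p (\<lambda>i. pf_full \<nu> a i \<Lambda>))))
    (- {0, - m, - (m + int n)})"
proof -
  define L where "L = - {0, - m, - (m + int n)}"
  have m0: "m \<noteq> 0" and n0: "n > 0" and N0: "m + int n \<noteq> 0" using mn by (auto simp: pair_index_def)
  have nz: "\<mu> \<noteq> 0" "\<nu> \<noteq> 0" "N \<noteq> 0" using m0 n0 N0 unfolding N_def of_int_eq_0_iff by (auto simp: \<mu>_def \<nu>_def)
  have \<mu>N: "\<mu> - N = - \<nu>" by (simp add: \<mu>_def N_def \<nu>_def)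
  have e0: "\<epsilon> \<noteq> 0" and L0: "\<Lambda> 0 = -1" using \<Lambda> by (auto simp: root_lambda_def)
  define EN EM where "EN = \<epsilon> powi (- (m + int n))" and "EM = \<epsilon> powi (-m)"
  \<comment> \<open>\<open>V\<close> belongs to the poles \<open>0\<close> and \<open>-m\<close>,
    \<open>W\<close> to the poles \<open>-m\<close> and \<open>- (m + n)\<close>. The subtracted
    term of each is the summand at the third integer.\<close>
  define V where "V = (\<lambda>i. pf_full \<mu> i a \<Lambda> + EM * pf_full (-\<mu>) a i \<Lambda> - EN * (1 / (-\<nu>) ^ a) * (1 / (-N) ^ i))"
  define W where "W = (\<lambda>i. EM * pf_full \<nu> a i \<Lambda> + EN * pf_full (-\<nu>) i a \<Lambda> - 1 / \<mu> ^ a * (1 / N ^ i))"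
  have V: "((\<lambda>l. \<epsilon> powi l / (of_int l ^ i * of_int (l + m) ^ a)) has_sum V i) L" if i: "i > 0" for i
  proof -
    have "insert (- (m + int n)) L = - {0, -m}" using m0 n0 N0 by (auto simp: L_def)
    with has_sum_root_pf[OF \<Lambda> m0 i pos(2)]
    have "((\<lambda>l. \<epsilon> powi l / (of_int l ^ i * of_int (l + m) ^ a)) has_sum
        (pf_full \<mu> i a \<Lambda> + EM * pf_full (-\<mu>) a i \<Lambda>)) (insert (- (m + int n)) L)"
      by (simp add: \<mu>_def EM_def)
    from has_sum_remove[OF this]
    show ?thesis by (simp add: L_def V_def EN_def N_def \<nu>_def mult.commute)
  qed
  have W: "((\<lambda>l. \<epsilon> powi l / (of_int (l + m) ^ a * of_int (l + m + int n) ^ i)) has_sum W i) L" if i: "i > 0" for i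
  proof -
    \<comment> \<open>The variable is translated by \<open>m\<close>, which puts the poles at
      \<open>0\<close> and \<open>- n\<close> and produces the factor
      \<open>\<epsilon> powi (-m)\<close>.\<close>
    have "((\<lambda>l. \<epsilon> powi (- m) * (\<epsilon> powi l / (of_int l ^ a * of_int (l + int n) ^ i))) has_sum
        (\<epsilon> powi (-m) * (pf_full (of_int (int n)) a i \<Lambda> + \<epsilon> powi (- int n) * pf_full (- of_int (int n)) i a \<Lambda>)))
        (- {0, - int n})"
      using n0 by (intro has_sum_cmult_right has_sum_root_pf \<Lambda> i pos) auto
    also have "?this \<longleftrightarrow> ((\<lambda>l. \<epsilon> powi l / (of_int (l + m) ^ a * of_int (l + m + int n) ^ i)) has_sum
        (EM * pf_full \<nu> a i \<Lambda> + EN * pf_full (-\<nu>) i a \<Lambda>)) (- {- m, - (m + int n)})"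
    proof (rule has_sum_reindex_bij_witness[of _ "\<lambda>l. l + m" "\<lambda>l. l - m"])
      fix l
      show "\<epsilon> powi (l - m) / (of_int (l - m + m) ^ a * of_int (l - m + m + int n) ^ i) =
          \<epsilon> powi (- m) * (\<epsilon> powi l / (of_int l ^ a * of_int (l + int n) ^ i))"
        using e0 by (simp add: power_int_diff power_int_minus field_simps)
      have "EN = \<epsilon> powi (-m) * \<epsilon> powi (- int n)"
        unfolding EN_def using e0 by (simp flip: power_int_add)
      thus "\<epsilon> powi (-m) * (pf_full (of_int (int n)) a i \<Lambda> + \<epsilon> powi (- int n) * pf_full (- of_int (int n)) i a \<Lambda>) =
          EM * pf_full \<nu> a i \<Lambda> + EN * pf_full (-\<nu>) i a \<Lambda>"
        by (simp add: \<nu>_def EM_def distrib_left mult.assoc)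
    qed auto
    also have "- {- m, - (m + int n)} = insert 0 L" using m0 n0 N0 by (auto simp: L_def)
    finally have "((\<lambda>l. \<epsilon> powi l / (of_int (l + m) ^ a * of_int (l + m + int n) ^ i)) has_sum
        (EM * pf_full \<nu> a i \<Lambda> + EN * pf_full (-\<nu>) i a \<Lambda>)) (insert 0 L)" .
    from has_sum_remove[OF this] show ?thesis by (simp add: L_def W_def N_def \<mu>_def)
  qed
  have split: "\<epsilon> powi l / (of_int l ^ p * of_int (l + m) ^ a * of_int (l + m + int n) ^ c) =
      pf_part N p c (\<lambda>i. \<epsilon> powi l / (of_int l ^ i * of_int (l + m) ^ a)) +
      pf_part (-N) c p (\<lambda>i. \<epsilon> powi l / (of_int (l + m) ^ a * of_int (l + m + int n) ^ i))" if "l \<in> L" for l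
  proof -
    have "l \<noteq> 0" "l + m + int n \<noteq> 0" using that by (auto simp: L_def)
    hence "1 / (of_int l ^ p * of_int (l + m + int n) ^ c) =
      pf_part N p c (\<lambda>i. 1 / of_int l ^ i) + pf_part (-N) c p (\<lambda>i. 1 / of_int (l + m + int n) ^ i)"
      using nz(3) pos by (intro partial_fraction_decomp) (simp_all only: of_int_eq_0_iff, simp_all add: N_def)
    hence "\<epsilon> powi l / of_int (l + m) ^ a * (1 / (of_int l ^ p * of_int (l + m + int n) ^ c)) =
      pf_part N p c (\<lambda>i. \<epsilon> powi l / of_int (l + m) ^ a * (1 / of_int l ^ i)) +
      pf_part (-N) c p (\<lambda>i. \<epsilon> powi l / of_int (l + m) ^ a * (1 / of_int (l + m + int n) ^ i))"
      unfolding pf_part_cmult by (simp only: distrib_left)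
    thus ?thesis by (simp add: mult_ac)
  qed
  have "((\<lambda>l. pf_part N p c (\<lambda>i. \<epsilon> powi l / (of_int l ^ i * of_int (l + m) ^ a)) +
      pf_part (-N) c p (\<lambda>i. \<epsilon> powi l / (of_int (l + m) ^ a * of_int (l + m + int n) ^ i))) has_sum
      (pf_part N p c V + pf_part (-N) c p W)) L"
    by (intro has_sum_add has_sum_pf_part V W)
  hence hs: "((\<lambda>l. \<epsilon> powi l / (of_int l ^ p * of_int (l + m) ^ a * of_int (l + m + int n) ^ c)) has_sum
      (pf_part N p c V + pf_part (-N) c p W)) L"
    by (subst has_sum_cong[OF split])
  have o1: "pf_part N p c (\<lambda>i. 1 / (-N) ^ i) = (-1) ^ p * of_nat ((p + c - 1) choose c) / N ^ (c + p)"
    by (rule pf_part_opposite) (use nz pos in auto)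
  have o2: "pf_part (-N) c p (\<lambda>i. 1 / N ^ i) = (-1) ^ c * of_nat ((c + p - 1) choose p) / (-N) ^ (p + c)"
    using pf_part_opposite[of "-N" c p] nz pos by simp
  have z: "pf_full M 0 a \<Lambda> = - 1 / M ^ a" for M by (simp add: pf_full_def L0)
  have sgn: "(-1) ^ c * x / (-N) ^ (p + c) = (-1) ^ p * x / N ^ (c + p)" for x
    unfolding power_minus[of N] divide_minus_one_power by (simp add: power_add mult_ac minus_one_power_iff)
  \<comment> \<open>Since \<open>pf_full M 0 a \<Lambda> = - 1 / M ^ a\<close>, the summands at the
    additionally removed integers complete \<open>pf_part\<close> to \<open>pf_full\<close>, again
    crosswise: that of \<open>W\<close> in \<open>f1\<close>, that of \<open>V\<close> in
    \<open>f2\<close>.\<close>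
  have f1: "pf_full N p c (\<lambda>i. pf_full \<mu> i a \<Lambda>) =
      pf_part N p c (\<lambda>i. pf_full \<mu> i a \<Lambda>) - (1 / \<mu> ^ a) * pf_part (-N) c p (\<lambda>i. 1 / N ^ i)"
    unfolding pf_full_eq[of N] z o2 sgn by (simp add: add.commute)
  have f2: "pf_full (-N) c p (\<lambda>i. pf_full (-\<nu>) i a \<Lambda>) =
      pf_part (-N) c p (\<lambda>i. pf_full (-\<nu>) i a \<Lambda>) - (1 / (-\<nu>) ^ a) * pf_part N p c (\<lambda>i. 1 / (-N) ^ i)"
    unfolding pf_full_eq[of "-N"] z o1 sgn by (simp add: add.commute)
  have "pf_part N p c V + pf_part (-N) c p W = pf_full N p c (\<lambda>i. pf_full \<mu> i a \<Lambda>) +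
      EN * pf_full (-N) c p (\<lambda>i. pf_full (-\<nu>) i a \<Lambda>) +
      EM * (pf_part N p c (\<lambda>i. pf_full (-\<mu>) a i \<Lambda>) + pf_part (-N) c p (\<lambda>i. pf_full \<nu> a i \<Lambda>))"
    unfolding V_def W_def pf_part_diff pf_part_add pf_part_cmult f1 f2
    by (simp add: algebra_simps)
  with hs show ?thesis unfolding L_def EN_def EM_def by simp
qed

definition triple_index :: "((int \<times> nat) \<times> int) set" where
  "triple_index = Sigma pair_index (\<lambda>(m, n). - {0, - m, - (m + int n)})"

definition root_term :: "nat \<Rightarrow> nat \<Rightarrow> nat \<Rightarrow> nat \<Rightarrow> nat \<Rightarrow> complex \<Rightarrow> (int \<times> nat) \<times> int \<Rightarrow> complex" where
  "root_term p q a b c s = (\<lambda>((m, n), l). 1 / (of_int l ^ p * of_int m ^ q * of_nat n powr s *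
     of_int (l + m) ^ a * of_int (m + int n) ^ b * of_int (l + m + int n) ^ c))"

text \<open>The factors are grouped as \<open>l\<close>, \<open>l + m\<close> and \<open>m\<close>,
  \<open>m + n\<close>, each pair bounded by inverse squares with a sum independent of the shift.
  The variable \<open>n\<close> has its own convergent power, and \<open>l + m + n\<close> is at
  least \<open>1\<close> in modulus.\<close>

lemma summable_on_root_term:
  assumes s: "Re s > 1" and pos: "p > 0" "q > 0" "a > 0" "b > 0" "c > 0"
    and \<eta>: "\<And>z. norm (\<eta> z) \<le> 1"
  shows "(\<lambda>z. \<eta> z * root_term p q a b c s z) summable_on triple_index"
proof (rule abs_summable_summable, rule Infinite_Sum.abs_summable_on_comparison_test')
  define B where "B = (\<lambda>(m, n). (1 / (of_int m)\<^sup>2 + 1 / (of_int (m + int n))\<^sup>2) * real n powr (- Re s))"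
  define f where "f = (\<lambda>((m, n), l). (1 / (of_int l)\<^sup>2 + 1 / (of_int (l + m))\<^sup>2) * B (m, n))"
  have "f summable_on (Sigma pair_index (\<lambda>_. UNIV))"
  proof (rule summable_on_SigmaI)
    show "((\<lambda>l. f (z, l)) has_sum (2 * inv_squares * B z)) UNIV" for z
      unfolding f_def using has_sum_cmult_left[OF has_sum_inv_squares_shift[of "fst z"]]
      by (simp add: case_prod_unfold)
    have "B summable_on pair_index" unfolding B_def by (rule summable_on_pair_bound[OF s])
    thus "(\<lambda>z. 2 * inv_squares * B z) summable_on pair_index" by (rule summable_on_cmult_right)
  qed (auto simp: f_def B_def)
  thus "f summable_on triple_index"
    by (rule summable_on_subset_banach) (auto simp: triple_index_def)
  fix z assume "z \<in> triple_index"
  then obtain m n l where z: "z = ((m, n), l)" and nz: "m \<noteq> 0" "n \<ge> 1" "m + int n \<noteq> 0" "l \<noteq> 0"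
      "l \<noteq> - m" "l \<noteq> - (m + int n)" by (auto simp: triple_index_def pair_index_def)
  have nz': "l + m \<noteq> 0" "l + m + int n \<noteq> 0" using nz by auto
  have "norm (\<eta> z * root_term p q a b c s z) \<le> 1 * norm (root_term p q a b c s z)"
    unfolding norm_mult using \<eta>[of z] by (intro mult_right_mono) auto
  also have "\<dots> = 1 / (\<bar>of_int l\<bar> ^ p * \<bar>of_int (l + m)\<bar> ^ a) *
      (1 / (\<bar>of_int m\<bar> ^ q * \<bar>of_int (m + int n)\<bar> ^ b)) * real n powr (- Re s) * (1 / \<bar>of_int (l + m + int n)\<bar> ^ c)"
    using nz(2) by (simp add: z root_term_def norm_mult norm_divide norm_inverse norm_power norm_of_nat_powr
      powr_minus divide_inverse mult_ac del: of_int_add)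
  also have "\<dots> \<le> (1 / (of_int l)\<^sup>2 + 1 / (of_int (l + m))\<^sup>2) *
      (1 / (of_int m)\<^sup>2 + 1 / (of_int (m + int n))\<^sup>2) * real n powr (- Re s) * 1"
  proof (intro mult_mono inverse_power_mult_le nz nz' pos)
    have "(1::real) \<le> \<bar>of_int (l + m + int n)\<bar>" using nz'(2) by linarith
    hence "(1::real) \<le> \<bar>of_int (l + m + int n)\<bar> ^ c" by (rule one_le_power)
    thus "1 / \<bar>of_int (l + m + int n)\<bar> ^ c \<le> (1::real)" using pos by (simp add: divide_le_eq_1)
  qed (auto intro!: mult_nonneg_nonneg)
  finally show "norm (\<eta> z * root_term p q a b c s z) \<le> f z" by (simp add: z f_def B_def mult_ac)
qed

text \<open>The pairs of roots are what remains of \<open>\<epsilon> powi (2 * m + 3 * n)\<close>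
  after multiplication by \<open>1\<close>, \<open>\<epsilon> powi (- (m + n))\<close> and
  \<open>\<epsilon> powi (-m)\<close>, the factors of the three poles in \<open>l\<close>.\<close>

definition J_form :: "complex \<Rightarrow> (nat \<Rightarrow> complex) \<Rightarrow> nat \<Rightarrow> nat \<Rightarrow> nat \<Rightarrow> nat \<Rightarrow> nat \<Rightarrow> complex \<Rightarrow> complex" where
  "J_form \<epsilon> \<Lambda> p q a b c s = K_form \<Lambda> p q a b c
     (\<lambda>P k Q. frakT P (s + of_nat k) Q (\<epsilon>\<^sup>2, \<epsilon> ^ 3)) (\<lambda>P k Q. frakT P (s + of_nat k) Q (\<epsilon>, \<epsilon>\<^sup>2))
     (\<lambda>P k Q. frakT P (s + of_nat k) Q (\<epsilon>, \<epsilon> ^ 3)) (\<lambda>P k Q. frakT P (s + of_nat k) Q (\<epsilon>, \<epsilon> ^ 3))"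

text \<open>Two roots occur as first argument of the double series, \<open>\<epsilon>\<close> and
  its square, hence the two hypotheses of type \<open>root_lambda\<close>.\<close>

lemma J_form_meromorphic:
  assumes "root_lambda \<epsilon> \<Lambda>" "root_lambda (\<epsilon>\<^sup>2) \<Lambda>'"
    and pos: "p > 0" "q > 0" "a > 0" "b > 0" "c > 0"
  shows "J_form \<epsilon> \<Lambda> p q a b c meromorphic_on UNIV"
proof -
  have n: "norm (\<epsilon> ^ k) = 1" for k using assms(1) by (simp add: root_lambda_def norm_power)
  show ?thesis unfolding J_form_def
    by (intro K_form_meromorphic pos meromorphic_on_shift[of "\<lambda>s. frakT _ s _ _"] frakT_props(1)[OF assms(1) n]
      frakT_props(1)[OF assms(2) n])
qed

lemma has_sum_J_form:
  assumes \<epsilon>: "root_lambda \<epsilon> \<Lambda>" "root_lambda (\<epsilon>\<^sup>2) \<Lambda>'" and s: "Re s > 1"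
    and pos: "p > 0" "q > 0" "a > 0" "b > 0" "c > 0"
  shows "((\<lambda>((m, n), l). \<epsilon> powi (l + 2 * m + 3 * int n) * root_term p q a b c s ((m, n), l))
    has_sum J_form \<epsilon> \<Lambda> p q a b c s) triple_index"
proof -
  have e1: "norm \<epsilon> = 1" and e0: "\<epsilon> \<noteq> 0" using \<epsilon>(1) by (auto simp: root_lambda_def)
  have n: "norm (\<epsilon> ^ k) = 1" for k using e1 by (simp add: norm_power)
  define F where "F = (\<lambda>((m, n), l). \<epsilon> powi (l + 2 * m + 3 * int n) * root_term p q a b c s ((m, n), l))"
  define t where "t = (\<lambda>x y (m, n) P k Q. x powi m * y ^ n /
     (of_int m ^ P * of_nat n powr (s + of_nat k) * of_int (m + int n) ^ Q :: complex))"
  define g where "g = (\<lambda>z. K_form \<Lambda> p q a b c (t (\<epsilon>\<^sup>2) (\<epsilon> ^ 3) z) (t \<epsilon> (\<epsilon>\<^sup>2) z) (t \<epsilon> (\<epsilon> ^ 3) z) (t \<epsilon> (\<epsilon> ^ 3) z))"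
  have t_sum: "((\<lambda>z. t x y z P k Q) has_sum frakT P (s + of_nat k) Q (x, y)) pair_index"
    if "root_lambda x L" "norm y = 1" "P > 0" "Q > 0" for x y L P k Q
    using frakT_props(2)[OF that, of "s + of_nat k"] s by (simp add: t_def case_prod_unfold)
  have outer: "(g has_sum J_form \<epsilon> \<Lambda> p q a b c s) pair_index"
    unfolding g_def J_form_def
    by (intro K_form_has_sum pos t_sum[OF \<epsilon>(1) n] t_sum[OF \<epsilon>(2) n])
  have inner: "((\<lambda>l. F (z, l)) has_sum g z) (case z of (m, n) \<Rightarrow> - {0, - m, - (m + int n)})"
    if z: "z \<in> pair_index" for z
  proof -
    obtain m n where mn: "z = (m, n)" by fastforce
    have m0: "m \<noteq> 0" and n0: "n > 0" and N0: "m + int n \<noteq> 0" using z mn by (auto simp: pair_index_def)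
    define \<mu> \<nu> N where "\<mu> = complex_of_int m" and "\<nu> = complex_of_nat n" and "N = complex_of_int (m + int n)"
    have nz: "\<mu> \<noteq> 0" "\<nu> \<noteq> 0" "N \<noteq> 0" using m0 n0 N0 unfolding N_def of_int_eq_0_iff by (auto simp: \<mu>_def \<nu>_def)
    define w where "w = \<epsilon> powi (2 * m + 3 * int n) / of_nat n powr s"
    have pw: "(\<epsilon> ^ i) powi m * (\<epsilon> ^ j) ^ n = \<epsilon> powi (int i * m + int j * int n)" for i j
      using e0 by (simp add: power_int_add power_int_mult)
    have pw': "(\<epsilon> ^ i) powi m * (\<epsilon> ^ j) ^ n / of_nat n powr s = w * \<epsilon> powi ((int i - 2) * m + (int j - 3) * int n)" for i j
      unfolding pw w_def times_divide_eq_left power_int_add[OF disjI1[OF e0], symmetric]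
      by (simp add: algebra_simps)
    have t_eq: "t (\<epsilon> ^ i) (\<epsilon> ^ j) z = (\<lambda>P k Q. w * \<epsilon> powi ((int i - 2) * m + (int j - 3) * int n) / (\<mu> ^ P * \<nu> ^ k * N ^ Q))" for i j
      unfolding pw'[symmetric] fun_eq_iff t_def mn
      by (simp add: of_nat_powr_add[OF n0] \<mu>_def \<nu>_def N_def mult_ac)
    have t1: "t (\<epsilon>\<^sup>2) (\<epsilon> ^ 3) z = (\<lambda>P k Q. w / (\<mu> ^ P * \<nu> ^ k * N ^ Q))"
      using t_eq[of 2 3] by simp
    have t2: "t \<epsilon> (\<epsilon>\<^sup>2) z = (\<lambda>P k Q. w * \<epsilon> powi (- (m + int n)) / (\<mu> ^ P * \<nu> ^ k * N ^ Q))"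
      using t_eq[of 1 2] by (simp add: algebra_simps)
    have t3: "t \<epsilon> (\<epsilon> ^ 3) z = (\<lambda>P k Q. w * \<epsilon> powi (- m) / (\<mu> ^ P * \<nu> ^ k * N ^ Q))"
      using t_eq[of 1 3] by simp
    have "((\<lambda>l. w / (\<mu> ^ q * N ^ b) * (\<epsilon> powi l / (of_int l ^ p * of_int (l + m) ^ a * of_int (l + m + int n) ^ c)))
        has_sum g z) (- {0, - m, - (m + int n)})"
      unfolding g_def t1 t2 t3 K_form_monomials[OF nz pos(1,3,5)] unfolding \<mu>_def \<nu>_def N_def
      by (intro has_sum_cmult_right has_sum_triple_inner \<epsilon>(1) pos) (use z mn in simp)
    moreover have "w / (\<mu> ^ q * N ^ b) * (\<epsilon> powi l / (of_int l ^ p * of_int (l + m) ^ a * of_int (l + m + int n) ^ c)) = F (z, l)" for l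
    proof -
      have "\<epsilon> powi (l + 2 * m + 3 * int n) = \<epsilon> powi (2 * m + 3 * int n) * \<epsilon> powi l"
        using e0 by (simp flip: power_int_add add: algebra_simps)
      thus ?thesis by (simp add: F_def mn root_term_def w_def \<mu>_def N_def mult_ac)
    qed
    ultimately show ?thesis by (simp add: mn)
  qed
  have "F summable_on triple_index"
    using summable_on_root_term[OF s pos, of "\<lambda>((m, n), l). \<epsilon> powi (l + 2 * m + 3 * int n)"] e1
    by (auto simp: F_def case_prod_unfold norm_powi_1)
  hence "(F has_sum J_form \<epsilon> \<Lambda> p q a b c s) triple_index"
    unfolding triple_index_def by (intro has_sum_SigmaI[OF inner outer])
  thus ?thesis by (simp add: F_def)
qed

section \<open>Identification of the sums \<open>R\<close> and \<open>K\<close> with the common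
  shape\<close>

lemma K_sum_eq_K_form: "K_sum \<epsilon> p q a b c s u1 u2 u3 u4 = K_form (\<lambda>j. Lambda j \<epsilon>) p q a b c
    (\<lambda>P k Q. frakT P (s + of_nat k) Q u1) (\<lambda>P k Q. frakT P (s + of_nat k) Q u2)
    (\<lambda>P k Q. frakT P (s + of_nat k) Q u3) (\<lambda>P k Q. frakT P (s + of_nat k) Q u4)"
  by (simp add: K_sum_def K_form_def)

lemma sum_even_indices:
  fixes g :: "nat \<Rightarrow> 'a::comm_ring_1"
  shows "(\<Sum>j\<le>n. (if even j then 2 * f j else 0) * g j) = 2 * (\<Sum>j\<le>n div 2. f (2 * j) * g (2 * j))"
proof -
  have "(\<Sum>j\<le>n. (if even j then 2 * f j else 0) * g j) = (\<Sum>j\<in>{j. j \<le> n \<and> even j}. 2 * f j * g j)"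
    by (rule sum.mono_neutral_cong_right) auto
  also have "\<dots> = (\<Sum>j\<le>n div 2. 2 * f (2 * j) * g (2 * j))"
    by (rule sum.reindex_bij_witness[of _ "\<lambda>j. 2 * j" "\<lambda>j. j div 2"]) auto
  finally show ?thesis by (simp add: sum_distrib_left mult.assoc)
qed

text \<open>Only even indices survive, and on them the sign \<open>(-1) ^ j\<close> of the common
  shape is \<open>1\<close>; the factor \<open>2\<close> is absorbed by the coefficients.\<close>

lemma R_sum_eq_K_form: "R_sum \<psi> p q a b c s u1 u2 u3 u4 =
    K_form (\<lambda>j. if even j then 2 * \<psi> (of_nat j) else 0) p q a b c
    (\<lambda>P k Q. frakT P (s + of_nat k) Q u1) (\<lambda>P k Q. frakT P (s + of_nat k) Q u2)
    (\<lambda>P k Q. frakT P (s + of_nat k) Q u3) (\<lambda>P k Q. frakT P (s + of_nat k) Q u4)"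
  unfolding K_form_def mult.assoc[of _ "(-1) ^ j" for j] sum_even_indices R_sum_def
  by (simp add: mult_ac)

lemma J_eqs:
  "J0 p q a b c s = J_form 1 (\<lambda>j. if even j then 2 * riemann_zeta (of_nat j) else 0) p q a b c s"
  "J1 p q a b c s = J_form (-\<i>) (\<lambda>j. Lambda j (-\<i>)) p q a b c s"
  "J2 p q a b c s = J_form (-1) (\<lambda>j. if even j then 2 * phi (of_nat j) else 0) p q a b c s"
  "J3 p q a b c s = J_form \<i> (\<lambda>j. Lambda j \<i>) p q a b c s"
  by (simp_all add: J0_def J1_def J2_def J3_def J_form_def R_sum_eq_K_form K_sum_eq_K_form power3_eq_cube power2_eq_square)

section \<open>The twelve chambers\<close>

lemma forall_6: "(\<forall>i::6. P i) \<longleftrightarrow> P 1 \<and> P 2 \<and> P 3 \<and> P 4 \<and> P 5 \<and> P 6"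
proof -
  have "i = 1 \<or> i = 2 \<or> i = 3 \<or> i = 4 \<or> i = 5 \<or> i = 6" for i :: 6
  proof (induct i)
    case (of_int z)
    then have "0 \<le> z" "z < 6" by simp_all
    then have "z = 0 \<or> z = 1 \<or> z = 2 \<or> z = 3 \<or> z = 4 \<or> z = 5" by arith
    then show ?case by auto
  qed
  thus ?thesis by metis
qed

definition root_coset :: "((int \<times> nat) \<times> int) set" where
  "root_coset = {((m, n), l). ((m, n), l) \<in> triple_index \<and> (l + 2 * m + 3 * int n) mod 4 = 2}"

text \<open>
  The position of \<open>((m, n), l)\<close> among the twelve orderings of \<open>0, l, l + m, l + m + n\<close>
  with \<open>l + m < l + m + n\<close>, numbered as the summands of \<open>S_terms\<close>.
\<close>

definition chamber_of :: "(int \<times> nat) \<times> int \<Rightarrow> nat" where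
  "chamber_of = (\<lambda>((m, n), l).
     if l > 0 then
       if m > 0 then 0
       else if l + m > 0 then (if m + int n > 0 then 4 else 5)
       else if l + m + int n < 0 then 8
       else if m + int n > 0 then 6 else 7
     else
       if m > 0 then (if l + m > 0 then 1 else if l + m + int n > 0 then 2 else 3)
       else if l + m + int n > 0 then 9
       else if m + int n > 0 then 10 else 11)"

text \<open>\<open>L\<close>, \<open>M\<close>, \<open>N\<close> are the gaps between neighbours
  when \<open>0\<close>, \<open>l\<close>, \<open>l + m\<close>, \<open>l + m + n\<close> are sorted
  by size; \<open>chamber_inv\<close> reads them off again.\<close>

definition chamber_map :: "nat \<Rightarrow> nat \<times> nat \<times> nat \<Rightarrow> (int \<times> nat) \<times> int" where
  "chamber_map i = (\<lambda>(L, M, N).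
     [((int M, N), int L),
      ((int (L + M), N), - int L),
      ((int L, M + N), - int (L + M)),
      ((int L, M), - int (L + M + N)),
      ((- int M, M + N), int (L + M)),
      ((- int (M + N), M), int (L + M + N)),
      ((- int (L + M), L + M + N), int M),
      ((- int (L + M + N), L + M), int (M + N)),
      ((- int (L + M + N), L), int N),
      ((- int L, L + M + N), - int M),
      ((- int L, L + M), - int (M + N)),
      ((- int (L + M), L), - int N)] ! i)"

definition chamber_inv :: "nat \<Rightarrow> (int \<times> nat) \<times> int \<Rightarrow> nat \<times> nat \<times> nat" where
  "chamber_inv i = (\<lambda>((m, n), l).
     [(nat l, nat m, nat (int n)),
      (nat (- l), nat (l + m), nat (int n)),
      (nat m, nat (- (l + m)), nat (l + m + int n)),
      (nat m, nat (int n), nat (- (l + m + int n))),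
      (nat (l + m), nat (- m), nat (m + int n)),
      (nat (l + m), nat (int n), nat (- (m + int n))),
      (nat (- (l + m)), nat l, nat (m + int n)),
      (nat (- (l + m)), nat (l + m + int n), nat (- (m + int n))),
      (nat (int n), nat (- (l + m + int n)), nat l),
      (nat (- m), nat (- l), nat (l + m + int n)),
      (nat (- m), nat (m + int n), nat (- (l + m + int n))),
      (nat (int n), nat (- (m + int n)), nat (- l))] ! i)"

lemma less_12_cases:
  assumes "i < (12 :: nat)"
  obtains "i = 0" | "i = 1" | "i = 2" | "i = 3" | "i = 4" | "i = 5" | "i = 6" | "i = 7" | "i = 8"
    | "i = 9" | "i = 10" | "i = 11"
  using assms by (elim less_SucE[where m = i] | simp only: numeral_eq_Suc pred_numeral_simps BitM.simps)+

lemma chamber_map_in: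
  assumes "i < 12" "x \<in> PU4_index"
  shows "chamber_map i x \<in> root_coset \<and> chamber_of (chamber_map i x) = i \<and> chamber_inv i (chamber_map i x) = x"
proof -
  obtain L M N where x: "x = (L, M, N)" by (cases x)
  have pos: "1 \<le> L" "1 \<le> M" "1 \<le> N" and "(L + 2 * M + 3 * N) mod 4 = 2"
    using assms(2) by (auto simp: x PU4_index_def)
  hence "int (L + 2 * M + 3 * N) mod 4 = 2" by presburger
  hence cong: "(int L + 2 * int M + 3 * int N) mod 4 = 2" by simp
  \<comment> \<open>With \<open>x0 = 0\<close>, \<open>x1 = l\<close>, \<open>x2 = l + m\<close>,
    \<open>x3 = l + m + n\<close> one has \<open>l + 2 * m + 3 * n = 3 * x3 - x2 - x1 - x0\<close>,
    which is \<open>- (x0 + x1 + x2 + x3)\<close> modulo 4. This is invariant under permutations and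
    common translations, so \<open>l, m, n\<close> and the gaps satisfy the same congruence;
    \<open>4 * k\<close> is the explicit difference.\<close>
  have *: ?thesis
    if "chamber_map i (L, M, N) = ((m, n), l)" "((m, n), l) \<in> triple_index"
      "l + 2 * m + 3 * int n = int L + 2 * int M + 3 * int N + 4 * k"
      "chamber_of ((m, n), l) = i" "chamber_inv i ((m, n), l) = (L, M, N)" for l m n k
  proof -
    have "(l + 2 * m + 3 * int n) mod 4 = 2" unfolding that(3) by (simp only: mod_mult_self2 cong)
    thus ?thesis using that by (simp add: x root_coset_def)
  qed
  note defs = chamber_map_def chamber_inv_def chamber_of_def triple_index_def pair_index_def
  show ?thesis
    using assms(1)
  proof (cases rule: less_12_cases)
    case 1
    show ?thesis by (rule *[of "int M" "N" "int L" "0"]) (use pos 1 in \<open>simp_all add: defs\<close>)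
  next
    case 2
    show ?thesis by (rule *[of "int (L + M)" "N" "- int L" "0"]) (use pos 2 in \<open>simp_all add: defs\<close>)
  next
    case 3
    show ?thesis by (rule *[of "int L" "M + N" "- int (L + M)" "0"]) (use pos 3 in \<open>simp_all add: defs\<close>)
  next
    case 4
    show ?thesis by (rule *[of "int L" "M" "- int (L + M + N)" "- int N"]) (use pos 4 in \<open>simp_all add: defs\<close>)
  next
    case 5
    show ?thesis by (rule *[of "- int M" "M + N" "int (L + M)" "0"]) (use pos 5 in \<open>simp_all add: defs\<close>)
  next
    case 6
    show ?thesis by (rule *[of "- int (M + N)" "M" "int (L + M + N)" "- int N"]) (use pos 6 in \<open>simp_all add: defs\<close>)
  next
    case 7
    show ?thesis by (rule *[of "- int (L + M)" "L + M + N" "int M" "0"]) (use pos 7 in \<open>simp_all add: defs\<close>)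
  next
    case 8
    show ?thesis by (rule *[of "- int (L + M + N)" "L + M" "int (M + N)" "- int N"]) (use pos 8 in \<open>simp_all add: defs\<close>)
  next
    case 9
    show ?thesis by (rule *[of "- int (L + M + N)" "L" "int N" "- int M - int N"]) (use pos 9 in \<open>simp_all add: defs\<close>)
  next
    case 10
    show ?thesis by (rule *[of "- int L" "L + M + N" "- int M" "0"]) (use pos 10 in \<open>simp_all add: defs\<close>)
  next
    case 11
    show ?thesis by (rule *[of "- int L" "L + M" "- int (M + N)" "- int N"]) (use pos 11 in \<open>simp_all add: defs\<close>)
  next
    case 12
    show ?thesis by (rule *[of "- int (L + M)" "L" "- int N" "- int M - int N"]) (use pos 12 in \<open>simp_all add: defs\<close>)
  qed
qed

lemma nat_triple_in_PU4_index:
  assumes "x > 0" "y > 0" "w > 0" "(x + 2 * y + 3 * w) mod 4 = 2"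
  shows "(nat x, nat y, nat w) \<in> PU4_index"
proof -
  have "int ((nat x + 2 * nat y + 3 * nat w) mod 4) = 2" using assms by (simp add: zmod_int)
  hence "(nat x + 2 * nat y + 3 * nat w) mod 4 = 2" by linarith
  thus ?thesis using assms by (simp add: PU4_index_def Suc_le_eq)
qed

lemma chamber_inv_in:
  assumes "z \<in> root_coset" "chamber_of z = i"
  shows "chamber_inv i z \<in> PU4_index \<and> chamber_map i (chamber_inv i z) = z"
proof -
  obtain m n l where z: "z = ((m, n), l)" by (metis prod.exhaust)
  have nz: "m \<noteq> 0" "n \<ge> 1" "m + int n \<noteq> 0" "l \<noteq> 0" "l + m \<noteq> 0" "l + m + int n \<noteq> 0"
    and cong: "(l + 2 * m + 3 * int n) mod 4 = 2"
    using assms(1) by (auto simp: z root_coset_def triple_index_def pair_index_def)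
  have *: ?thesis
    if "chamber_inv i z = (nat x, nat y, nat w)" "x > 0 \<and> y > 0 \<and> w > 0"
      "x + 2 * y + 3 * w = l + 2 * m + 3 * int n + 4 * k"
      "chamber_map i (nat x, nat y, nat w) = z" for x y w k
  proof -
    have "(x + 2 * y + 3 * w) mod 4 = 2" unfolding that(3) by (simp only: mod_mult_self2 cong)
    thus ?thesis using that by (simp add: nat_triple_in_PU4_index)
  qed
  note defs = z chamber_map_def chamber_inv_def
  have "i < 12" using assms(2) by (auto simp: z chamber_of_def split: if_splits)
  thus ?thesis
  proof (cases rule: less_12_cases)
    case 1
    have "l > 0 \<and> m > 0" using assms(2) by (simp add: z 1 chamber_of_def split: if_splits)
    hence "l > 0 \<and> m > 0 \<and> int n > 0" using nz by linarith
    thus ?thesis by (intro *[of "l" "m" "int n" "0"]) (simp_all add: 1 defs, arith?)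
  next
    case 2
    have "\<not> l > 0 \<and> m > 0 \<and> l + m > 0" using assms(2) by (simp add: z 2 chamber_of_def split: if_splits)
    \<comment> \<open>The negated inequalities of \<open>chamber_of\<close> become strict ones
      because none of the six linear forms vanishes on \<open>triple_index\<close>; so all gaps are
      positive.\<close>
    hence "(- l) > 0 \<and> (l + m) > 0 \<and> int n > 0" using nz by linarith
    thus ?thesis by (intro *[of "- l" "l + m" "int n" "0"]) (simp_all add: 2 defs, arith?)
  next
    case 3
    have "\<not> l > 0 \<and> m > 0 \<and> \<not> l + m > 0 \<and> l + m + int n > 0" using assms(2) by (simp add: z 3 chamber_of_def split: if_splits)
    hence "m > 0 \<and> (- (l + m)) > 0 \<and> (l + m + int n) > 0" using nz by linarith
    thus ?thesis by (intro *[of "m" "- (l + m)" "l + m + int n" "0"]) (simp_all add: 3 defs, arith?)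
  next
    case 4
    have "\<not> l > 0 \<and> m > 0 \<and> \<not> l + m > 0 \<and> \<not> l + m + int n > 0" using assms(2) by (simp add: z 4 chamber_of_def split: if_splits)
    hence "m > 0 \<and> int n > 0 \<and> (- (l + m + int n)) > 0" using nz by linarith
    thus ?thesis by (intro *[of "m" "int n" "- (l + m + int n)" "- l - m - int n"]) (simp_all add: 4 defs, arith?)
  next
    case 5
    have "l > 0 \<and> \<not> m > 0 \<and> l + m > 0 \<and> m + int n > 0" using assms(2) by (simp add: z 5 chamber_of_def split: if_splits)
    hence "(l + m) > 0 \<and> (- m) > 0 \<and> (m + int n) > 0" using nz by linarith
    thus ?thesis by (intro *[of "l + m" "- m" "m + int n" "0"]) (simp_all add: 5 defs, arith?)
  next
    case 6
    have "l > 0 \<and> \<not> m > 0 \<and> l + m > 0 \<and> \<not> m + int n > 0" using assms(2) by (simp add: z 6 chamber_of_def split: if_splits)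
    hence "(l + m) > 0 \<and> int n > 0 \<and> (- (m + int n)) > 0" using nz by linarith
    thus ?thesis by (intro *[of "l + m" "int n" "- (m + int n)" "- m - int n"]) (simp_all add: 6 defs, arith?)
  next
    case 7
    have "l > 0 \<and> \<not> m > 0 \<and> \<not> l + m > 0 \<and> \<not> l + m + int n < 0 \<and> m + int n > 0" using assms(2) by (simp add: z 7 chamber_of_def split: if_splits)
    hence "(- (l + m)) > 0 \<and> l > 0 \<and> (m + int n) > 0" using nz by linarith
    thus ?thesis by (intro *[of "- (l + m)" "l" "m + int n" "0"]) (simp_all add: 7 defs, arith?)
  next
    case 8
    have "l > 0 \<and> \<not> m > 0 \<and> \<not> l + m > 0 \<and> \<not> l + m + int n < 0 \<and> \<not> m + int n > 0" using assms(2) by (simp add: z 8 chamber_of_def split: if_splits)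
    hence "(- (l + m)) > 0 \<and> (l + m + int n) > 0 \<and> (- (m + int n)) > 0" using nz by linarith
    thus ?thesis by (intro *[of "- (l + m)" "l + m + int n" "- (m + int n)" "- m - int n"]) (simp_all add: 8 defs, arith?)
  next
    case 9
    have "l > 0 \<and> \<not> m > 0 \<and> \<not> l + m > 0 \<and> l + m + int n < 0" using assms(2) by (simp add: z 9 chamber_of_def split: if_splits)
    hence "int n > 0 \<and> (- (l + m + int n)) > 0 \<and> l > 0" using nz by linarith
    thus ?thesis by (intro *[of "int n" "- (l + m + int n)" "l" "- m - int n"]) (simp_all add: 9 defs, arith?)
  next
    case 10
    have "\<not> l > 0 \<and> \<not> m > 0 \<and> l + m + int n > 0" using assms(2) by (simp add: z 10 chamber_of_def split: if_splits)
    hence "(- m) > 0 \<and> (- l) > 0 \<and> (l + m + int n) > 0" using nz by linarith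
    thus ?thesis by (intro *[of "- m" "- l" "l + m + int n" "0"]) (simp_all add: 10 defs, arith?)
  next
    case 11
    have "\<not> l > 0 \<and> \<not> m > 0 \<and> \<not> l + m + int n > 0 \<and> m + int n > 0" using assms(2) by (simp add: z 11 chamber_of_def split: if_splits)
    hence "(- m) > 0 \<and> (m + int n) > 0 \<and> (- (l + m + int n)) > 0" using nz by linarith
    thus ?thesis by (intro *[of "- m" "m + int n" "- (l + m + int n)" "- l - m - int n"]) (simp_all add: 11 defs, arith?)
  next
    case 12
    have "\<not> l > 0 \<and> \<not> m > 0 \<and> \<not> l + m + int n > 0 \<and> \<not> m + int n > 0" using assms(2) by (simp add: z 12 chamber_of_def split: if_splits)
    hence "int n > 0 \<and> (- (m + int n)) > 0 \<and> (- l) > 0" using nz by linarith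
    thus ?thesis by (intro *[of "int n" "- (m + int n)" "- l" "- l - m - int n"]) (simp_all add: 12 defs, arith?)
  qed
qed

section \<open>The sum over a coset of the root lattice\<close>

text \<open>Each form with an integer exponent is a sign times a natural number, and the signs
  collect into one exponent. The variable \<open>n\<close> is positive in every chamber, so the
  complex exponent meets no sign.\<close>

lemma root_term_signed:
  assumes "l = (-1) ^ d1 * int x1" "m = (-1) ^ d2 * int x2" "l + m = (-1) ^ d3 * int x3"
    "m + int n = (-1) ^ d4 * int x4" "l + m + int n = (-1) ^ d5 * int x5"
  shows "root_term p q a b c s ((m, n), l) = (-1) ^ (d1 * p + d2 * q + d3 * a + d4 * b + d5 * c) *
    (1 / (of_nat x1 ^ p * of_nat x2 ^ q * of_nat n powr s * of_nat x3 ^ a * of_nat x4 ^ b * of_nat x5 ^ c))"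
proof -
  have sgn: "of_int ((-1) ^ d * int x) ^ k = (-1) ^ (d * k) * (of_nat x ^ k :: complex)" for d x k
    by (simp add: power_mult_distrib power_mult)
  have "root_term p q a b c s ((m, n), l) = 1 / (of_int l ^ p * of_int m ^ q * of_nat n powr s *
     of_int (l + m) ^ a * of_int (m + int n) ^ b * of_int (l + m + int n) ^ c)"
    by (simp add: root_term_def)
  also have "\<dots> = 1 / ((-1) ^ (d1 * p + d2 * q + d3 * a + d4 * b + d5 * c) *
      (of_nat x1 ^ p * of_nat x2 ^ q * of_nat n powr s * of_nat x3 ^ a * of_nat x4 ^ b * of_nat x5 ^ c))"
    unfolding assms(5) unfolding assms(3,4) unfolding assms(1,2) sgn by (simp add: power_add mult_ac)
  finally show ?thesis by (simp only: divide_minus_one_power) simp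
qed

lemma zeta3_term_vector:
  "zeta3_term (vector [z1, z2, z3, z4, z5, z6]) (L, M, N) =
    1 / (of_nat L powr z1 * of_nat M powr z2 * of_nat N powr z3 *
      of_nat (L + M) powr z4 * of_nat (M + N) powr z5 * of_nat (L + M + N) powr z6)"
  unfolding zeta3_term_def case_prod_conv vector_6 ..

lemma length_S_terms: "length (S_terms p q a b c s) = 12"
  by (simp add: S_terms_def Let_def)

lemma root_term_chamber_map:
  assumes "i < 12" "x \<in> PU4_index"
  shows "root_term p q a b c s (chamber_map i x) =
    (-1) ^ fst (S_terms p q a b c s ! i) * zeta3_term (snd (S_terms p q a b c s ! i)) x"
proof -
  obtain L M N where x: "x = (L, M, N)" by (cases x)
  have pos: "L > 0" "M > 0" "N > 0"
    using assms(2) by (auto simp: x PU4_index_def)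
  have pw: "of_nat k powr of_nat j = (of_nat k ^ j :: complex)" if "k > 0" for k j
    using that by (simp add: powr_nat')
  have pws: "(of_nat L + of_nat M) powr of_nat j = ((of_nat L + of_nat M) ^ j :: complex)"
    "(of_nat M + of_nat N) powr of_nat j = ((of_nat M + of_nat N) ^ j :: complex)"
    "(of_nat L + of_nat M + of_nat N) powr of_nat j = ((of_nat L + of_nat M + of_nat N) ^ j :: complex)" for j
    using pw[of "L + M" j] pw[of "M + N" j] pw[of "L + M + N" j] pos by simp_all
  have *: ?thesis
    if "chamber_map i (L, M, N) = ((m, n), l)" "l = (-1) ^ d1 * int x1" "m = (-1) ^ d2 * int x2"
      "l + m = (-1) ^ d3 * int x3" "m + int n = (-1) ^ d4 * int x4" "l + m + int n = (-1) ^ d5 * int x5"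
      "fst (S_terms p q a b c s ! i) = d1 * p + d2 * q + d3 * a + d4 * b + d5 * c"
      "zeta3_term (snd (S_terms p q a b c s ! i)) (L, M, N) = 1 / (of_nat x1 ^ p * of_nat x2 ^ q * of_nat n powr s *
        of_nat x3 ^ a * of_nat x4 ^ b * of_nat x5 ^ c)" for l m n d1 d2 d3 d4 d5 x1 x2 x3 x4 x5
    unfolding x that(1,7,8) by (rule root_term_signed) fact+
  note defs = chamber_map_def S_terms_def Let_def zeta3_term_vector pw[OF pos(1)] pw[OF pos(2)] pw[OF pos(3)] pws
  show ?thesis
    using assms(1)
  proof (cases rule: less_12_cases)
    case 1
    show ?thesis by (rule *[of "int M" N "int L" 0 L 0 M 0 "L + M" 0 "M + N" 0 "L + M + N"]) (simp_all add: 1 defs mult_ac)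
  next
    case 2
    show ?thesis by (rule *[of "int (L + M)" N "- int L" 1 L 0 "L + M" 0 M 0 "L + M + N" 0 "M + N"]) (simp_all add: 2 defs mult_ac)
  next
    case 3
    show ?thesis by (rule *[of "int L" "M + N" "- int (L + M)" 1 "L + M" 0 L 1 M 0 "L + M + N" 0 N]) (simp_all add: 3 defs mult_ac)
  next
    case 4
    show ?thesis by (rule *[of "int L" M "- int (L + M + N)" 1 "L + M + N" 0 L 1 "M + N" 0 "L + M" 1 N]) (simp_all add: 4 defs mult_ac)
  next
    case 5
    show ?thesis by (rule *[of "- int M" "M + N" "int (L + M)" 0 "L + M" 1 M 0 L 0 N 0 "L + M + N"]) (simp_all add: 5 defs mult_ac)
  next
    case 6
    show ?thesis by (rule *[of "- int (M + N)" M "int (L + M + N)" 0 "L + M + N" 1 "M + N" 0 L 1 N 0 "L + M"]) (simp_all add: 6 defs mult_ac)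
  next
    case 7
    show ?thesis by (rule *[of "- int (L + M)" "L + M + N" "int M" 0 M 1 "L + M" 1 L 0 N 0 "M + N"]) (simp_all add: 7 defs mult_ac)
  next
    case 8
    show ?thesis by (rule *[of "- int (L + M + N)" "L + M" "int (M + N)" 0 "M + N" 1 "L + M + N" 1 L 1 N 0 M]) (simp_all add: 8 defs mult_ac)
  next
    case 9
    show ?thesis by (rule *[of "- int (L + M + N)" L "int N" 0 N 1 "L + M + N" 1 "L + M" 1 "M + N" 1 M]) (simp_all add: 9 defs mult_ac)
  next
    case 10
    show ?thesis by (rule *[of "- int L" "L + M + N" "- int M" 1 M 1 L 1 "L + M" 0 "M + N" 0 N]) (simp_all add: 10 defs mult_ac)
  next
    case 11
    show ?thesis by (rule *[of "- int L" "L + M" "- int (M + N)" 1 "M + N" 1 L 1 "L + M + N" 0 M 1 N]) (simp_all add: 11 defs mult_ac)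
  next
    case 12
    show ?thesis by (rule *[of "- int (L + M)" L "- int N" 1 N 1 "L + M" 1 "L + M + N" 1 M 1 "M + N"]) (simp_all add: 12 defs mult_ac)
  qed
qed

lemma has_sum_chamber:
  assumes "i < 12" "zeta3_term (snd (S_terms p q a b c s ! i)) summable_on PU4_index"
  shows "(root_term p q a b c s has_sum (-1) ^ fst (S_terms p q a b c s ! i) *
    infsum (zeta3_term (snd (S_terms p q a b c s ! i))) PU4_index) {z \<in> root_coset. chamber_of z = i}"
proof -
  have "((\<lambda>x. (-1) ^ fst (S_terms p q a b c s ! i) * zeta3_term (snd (S_terms p q a b c s ! i)) x) has_sum
      (-1) ^ fst (S_terms p q a b c s ! i) * infsum (zeta3_term (snd (S_terms p q a b c s ! i))) PU4_index) PU4_index"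
    by (intro has_sum_cmult_right has_sum_infsum assms)
  also have "?this \<longleftrightarrow> ?thesis"
    by (rule has_sum_reindex_bij_witness[of _ "chamber_inv i" "chamber_map i"])
      (use chamber_map_in[OF assms(1)] chamber_inv_in root_term_chamber_map[OF assms(1)] in auto)
  finally show ?thesis .
qed

lemma has_sum_root_coset:
  assumes "\<And>i. i < 12 \<Longrightarrow> zeta3_term (snd (S_terms p q a b c s ! i)) summable_on PU4_index"
  shows "(root_term p q a b c s has_sum (\<Sum>i<12. (-1) ^ fst (S_terms p q a b c s ! i) *
    infsum (zeta3_term (snd (S_terms p q a b c s ! i))) PU4_index)) root_coset"
proof -
  have "(root_term p q a b c s has_sum (\<Sum>i<12. (-1) ^ fst (S_terms p q a b c s ! i) *
    infsum (zeta3_term (snd (S_terms p q a b c s ! i))) PU4_index)) (\<Union>i<12. {z \<in> root_coset. chamber_of z = i})"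
    by (rule sum_has_sum) (auto intro: has_sum_chamber assms)
  moreover have "chamber_of z < 12" for z
    by (auto simp: chamber_of_def split: prod.splits)
  hence "(\<Union>i<12. {z \<in> root_coset. chamber_of z = i}) = root_coset" by auto
  ultimately show ?thesis by simp
qed

text \<open>Orthogonality of the characters modulo 4. The weights are
  \<open>\<epsilon> powi (-2)\<close>, that is \<open>1\<close> for
  \<open>\<epsilon> = 1, -1\<close> and \<open>-1\<close> for
  \<open>\<epsilon> = \<i>, -\<i>\<close>, whence the signs of \<open>J1\<close> and
  \<open>J3\<close>.\<close>

lemma coset_character:
  fixes L :: int
  shows "1 powi L - (-\<i>) powi L + (-1) powi L - \<i> powi L = (if L mod 4 = 2 then 4 else 0 :: complex)"
proof -
  define r where "r = nat (L mod 4)"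
  have r4: "r < 4" and rL: "int r = L mod 4" by (auto simp: r_def)
  have red: "\<epsilon> powi L = \<epsilon> ^ r" if "\<epsilon> ^ 4 = 1" for \<epsilon> :: complex
  proof -
    have e0: "\<epsilon> \<noteq> 0" using that by auto
    have "\<epsilon> powi L = \<epsilon> powi (4 * (L div 4) + int r)" by (simp add: rL)
    also have "\<dots> = (\<epsilon> ^ 4) powi (L div 4) * \<epsilon> ^ r"
    proof -
      have "\<epsilon> powi (4 * (L div 4)) = (\<epsilon> ^ 4) powi (L div 4)" by (simp add: power_int_mult)
      thus ?thesis using e0 by (simp add: power_int_add)
    qed
    finally show ?thesis by (simp add: that)
  qed
  have four: "(1::complex) ^ 4 = 1" "(-\<i>) ^ 4 = 1" "(-1::complex) ^ 4 = 1" "\<i> ^ 4 = 1"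
    by (simp_all add: eval_nat_numeral)
  have iff: "L mod 4 = 2 \<longleftrightarrow> r = 2" using rL by linarith
  have "r = 0 \<or> r = 1 \<or> r = 2 \<or> r = 3" using r4 by arith
  thus ?thesis unfolding red[OF four(1)] red[OF four(2)] red[OF four(3)] red[OF four(4)] iff
    by (auto simp: eval_nat_numeral)
qed

definition J_comb :: "nat \<Rightarrow> nat \<Rightarrow> nat \<Rightarrow> nat \<Rightarrow> nat \<Rightarrow> complex \<Rightarrow> complex" where
  "J_comb p q a b c s = 1 / 4 * (J0 p q a b c s - J1 p q a b c s + J2 p q a b c s - J3 p q a b c s)"

lemma root_lambda_squares:
  "\<exists>\<Lambda>. root_lambda (1\<^sup>2) \<Lambda>" "\<exists>\<Lambda>. root_lambda ((-1)\<^sup>2) \<Lambda>"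
  "\<exists>\<Lambda>. root_lambda (\<i>\<^sup>2) \<Lambda>" "\<exists>\<Lambda>. root_lambda ((-\<i>)\<^sup>2) \<Lambda>"
  using root_lambda_1 root_lambda_minus_1 by auto

lemma has_sum_diff:
  fixes f g :: "'a \<Rightarrow> complex"
  assumes "(f has_sum x) A" "(g has_sum y) A"
  shows "((\<lambda>z. f z - g z) has_sum (x - y)) A"
  using has_sum_add[OF assms(1) has_sum_cmult_right[OF assms(2), of "-1"]] by simp

lemma has_sum_J_comb:
  assumes s: "Re s > 1" and pos: "p > 0" "q > 0" "a > 0" "b > 0" "c > 0"
  shows "(root_term p q a b c s has_sum J_comb p q a b c s) root_coset"
proof -
  obtain \<Lambda>1 \<Lambda>2 \<Lambda>3 \<Lambda>4 where sq: "root_lambda (1\<^sup>2) \<Lambda>1" "root_lambda ((-1)\<^sup>2) \<Lambda>2"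
    "root_lambda (\<i>\<^sup>2) \<Lambda>3" "root_lambda ((-\<i>)\<^sup>2) \<Lambda>4"
    using root_lambda_squares by blast
  define t where "t = (\<lambda>\<epsilon> ((m, n), l). \<epsilon> powi (l + 2 * m + 3 * int n) * root_term p q a b c s ((m, n), l))"
  have "((\<lambda>z. 1 / 4 * (t 1 z - t (-\<i>) z + t (-1) z - t \<i> z)) has_sum J_comb p q a b c s) triple_index"
    unfolding J_comb_def J_eqs t_def
    by (intro has_sum_cmult_right has_sum_add has_sum_diff
      has_sum_J_form[OF root_lambda_1 sq(1) s pos] has_sum_J_form[OF root_lambda_minus_1 sq(2) s pos]
      has_sum_J_form[OF root_lambda_i sq(3) s pos] has_sum_J_form[OF root_lambda_minus_i sq(4) s pos])
  also have "?this \<longleftrightarrow> ?thesis"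
  proof (rule has_sum_cong_neutral)
    have eq: "1 / 4 * (t 1 z - t (-\<i>) z + t (-1) z - t \<i> z) =
        (if (snd z + 2 * fst (fst z) + 3 * int (snd (fst z))) mod 4 = 2 then root_term p q a b c s z else 0)" for z
    proof -
      obtain m n l where z: "z = ((m, n), l)" by (metis prod.exhaust)
      define L where "L = l + 2 * m + 3 * int n"
      have "1 / 4 * (t 1 z - t (-\<i>) z + t (-1) z - t \<i> z) =
          1 / 4 * (1 powi L - (-\<i>) powi L + (-1) powi L - \<i> powi L) * root_term p q a b c s z"
        unfolding t_def z case_prod_conv L_def[symmetric] by (simp only: algebra_simps)
      also have "\<dots> = (if L mod 4 = 2 then root_term p q a b c s z else 0)"
        unfolding coset_character by simp
      finally show ?thesis by (simp add: z L_def)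
    qed
    show "root_term p q a b c s z = 0" if "z \<in> root_coset - triple_index" for z
      using that by (auto simp: root_coset_def)
    show "1 / 4 * (t 1 z - t (-\<i>) z + t (-1) z - t \<i> z) = 0" if "z \<in> triple_index - root_coset" for z
      unfolding eq using that by (auto simp: root_coset_def)
    show "1 / 4 * (t 1 z - t (-\<i>) z + t (-1) z - t \<i> z) = root_term p q a b c s z" if "z \<in> triple_index \<inter> root_coset" for z
      unfolding eq using that by (auto simp: root_coset_def)
  qed
  finally show ?thesis .
qed

section \<open>Absolute convergence of the triple zeta series\<close>

lemma summable_on_zeta3_bound:
  "(\<lambda>(l, m, n). 1 / (real l)\<^sup>2 * (1 / (real m)\<^sup>2 * (1 / (real n)\<^sup>2))) summable_on A"
proof -
  have n: "(\<lambda>n::nat. 1 / (real n)\<^sup>2) summable_on UNIV"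
    using inverse_power_summable[of 2, where 'a=real]
    by (intro norm_summable_imp_summable_on) (simp add: inverse_eq_divide)
  have prod: "(\<lambda>(x, y). f x * g y) summable_on (UNIV \<times> UNIV)"
    if "f summable_on UNIV" "g summable_on UNIV" "\<And>x. f x \<ge> 0" "\<And>y. g y \<ge> 0"
    for f :: "nat \<Rightarrow> real" and g :: "'b \<Rightarrow> real"
  proof (rule summable_on_SigmaI)
    show "((\<lambda>y. (\<lambda>(x, y). f x * g y) (x, y)) has_sum (f x * infsum g UNIV)) UNIV" for x
      unfolding case_prod_conv by (intro has_sum_cmult_right has_sum_infsum that)
    show "(\<lambda>x. f x * infsum g UNIV) summable_on UNIV"
      by (intro summable_on_cmult_left that)
  qed (use that in auto)
  have 2: "(\<lambda>(m, n). 1 / (real m)\<^sup>2 * (1 / (real n)\<^sup>2)) summable_on UNIV"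
    using prod[OF n n] by simp
  have "(\<lambda>(l, mn). 1 / (real l)\<^sup>2 * (case mn of (m, n) \<Rightarrow> 1 / (real m)\<^sup>2 * (1 / (real n)\<^sup>2))) summable_on UNIV"
    using prod[OF n 2] by (simp add: case_prod_unfold)
  hence "(\<lambda>(l, m, n). 1 / (real l)\<^sup>2 * (1 / (real m)\<^sup>2 * (1 / (real n)\<^sup>2))) summable_on UNIV"
    by (simp add: case_prod_unfold)
  thus ?thesis by (rule summable_on_subset_banach) simp
qed

text \<open>The bases of the six powers are bounded below by \<open>L\<close>, \<open>M\<close>,
  \<open>N\<close>, \<open>L\<close>, \<open>M\<close>, \<open>N\<close> in turn, using
  \<open>L + M \<ge> L\<close>, \<open>M + N \<ge> M\<close> and
  \<open>L + M + N \<ge> N\<close>.\<close>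

lemma norm_zeta3_term_le:
  fixes v :: "complex^6"
  assumes v: "\<And>k. Re (v $ k) \<ge> 1" and x: "(L, M, N) \<in> PU4_index"
  shows "norm (zeta3_term v (L, M, N)) \<le> 1 / (real L)\<^sup>2 * (1 / (real M)\<^sup>2 * (1 / (real N)\<^sup>2))"
proof -
  have pos: "L \<ge> 1" "M \<ge> 1" "N \<ge> 1" using x by (auto simp: PU4_index_def)
  have pw: "real y \<le> norm (of_nat x powr (v $ k))" if "y \<le> x" "y \<ge> 1" for x y :: nat and k
  proof -
    have "real y \<le> real x powr 1" using that by simp
    also have "\<dots> \<le> real x powr Re (v $ k)" using that v by (intro powr_mono) auto
    also have "\<dots> = norm (of_nat x powr (v $ k))" using that by (simp add: norm_of_nat_powr)
    finally show ?thesis .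
  qed
  have "real L * real M * real N * real L * real M * real N \<le>
      norm (of_nat L powr (v $ 1)) * norm (of_nat M powr (v $ 2)) * norm (of_nat N powr (v $ 3)) *
      norm (of_nat (L + M) powr (v $ 4)) * norm (of_nat (M + N) powr (v $ 5)) * norm (of_nat (L + M + N) powr (v $ 6))"
    by (intro mult_mono pw mult_nonneg_nonneg) (use pos in auto)
  hence "norm (zeta3_term v (L, M, N)) \<le> 1 / (real L * real M * real N * real L * real M * real N)"
    unfolding zeta3_term_def case_prod_conv norm_divide norm_mult norm_one
    by (intro divide_left_mono mult_pos_pos) (use pos in \<open>auto simp del: of_nat_add\<close>)
  thus ?thesis by (simp add: power2_eq_square mult_ac)
qed

lemma summable_on_zeta3_term:
  fixes v :: "complex^6"
  assumes "\<And>k. Re (v $ k) \<ge> 1"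
  shows "zeta3_term v summable_on PU4_index"
proof (rule abs_summable_summable, rule Infinite_Sum.abs_summable_on_comparison_test'[OF summable_on_zeta3_bound])
  fix x assume "x \<in> PU4_index"
  thus "norm (zeta3_term v x) \<le> (case x of (l, m, n) \<Rightarrow> 1 / (real l)\<^sup>2 * (1 / (real m)\<^sup>2 * (1 / (real n)\<^sup>2)))"
    using norm_zeta3_term_le[OF assms] by (cases x) auto
qed

text \<open>A direction with nonnegative real parts keeps all shifted arguments under one majorant.
  So the series converges uniformly for \<open>t\<close> in \<open>[0, 1]\<close>, and its sum is
  continuous at \<open>0\<close>.\<close>

lemma infsum_zeta3_tendsto:
  fixes u v :: "complex^6"
  assumes v: "\<And>k. Re (v $ k) \<ge> 1" and u: "\<And>k. Re (u $ k) \<ge> 0"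
  shows "((\<lambda>t. infsum (zeta3_term (v + complex_of_real t *s u)) PU4_index) \<longlongrightarrow> infsum (zeta3_term v) PU4_index) (at_right 0)"
proof -
  define f where "f = (\<lambda>x t. zeta3_term (v + complex_of_real t *s u) x)"
  have "uniform_limit {0..1} (\<lambda>X t. \<Sum>x\<in>X. f x t) (\<lambda>t. \<Sum>\<^sub>\<infinity>x\<in>PU4_index. f x t) (finite_subsets_at_top PU4_index)"
  proof (rule Weierstrass_m_test_general[OF _ summable_on_zeta3_bound])
    fix x t assume "x \<in> PU4_index" "t \<in> {0..1::real}"
    moreover have "Re ((v + complex_of_real t *s u) $ k) \<ge> 1" if "t \<ge> 0" for k
      using v[of k] mult_nonneg_nonneg[OF that u[of k]] by simp
    ultimately show "norm (f x t) \<le> (case x of (l, m, n) \<Rightarrow> 1 / (real l)\<^sup>2 * (1 / (real m)\<^sup>2 * (1 / (real n)\<^sup>2)))"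
      unfolding f_def using norm_zeta3_term_le[of "v + complex_of_real t *s u"] by (cases x) auto
  qed
  moreover have "\<forall>\<^sub>F X in finite_subsets_at_top PU4_index. continuous_on {0..1} (\<lambda>t. \<Sum>x\<in>X. f x t)"
  proof (rule eventually_finite_subsets_at_top_weakI, rule continuous_on_sum)
    fix X x assume "finite X" "X \<subseteq> PU4_index" "x \<in> X"
    then obtain L M N where "x = (L, M, N)" "L \<ge> 1" "M \<ge> 1" "N \<ge> 1" by (auto simp: PU4_index_def)
    thus "continuous_on {0..1} (f x)"
      unfolding f_def zeta3_term_def
      by (auto intro!: continuous_intros simp del: of_nat_add)
  qed
  ultimately have "continuous_on {0..1} (\<lambda>t. \<Sum>\<^sub>\<infinity>x\<in>PU4_index. f x t)"
    by (intro uniform_limit_theorem[OF _ _ finite_subsets_at_top_neq_bot])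
  hence "((\<lambda>t. \<Sum>\<^sub>\<infinity>x\<in>PU4_index. f x t) \<longlongrightarrow> (\<Sum>\<^sub>\<infinity>x\<in>PU4_index. f x 0)) (at 0 within {0..1})"
    by (simp add: continuous_on_def)
  hence "((\<lambda>t. \<Sum>\<^sub>\<infinity>x\<in>PU4_index. f x t) \<longlongrightarrow> (\<Sum>\<^sub>\<infinity>x\<in>PU4_index. f x 0)) (at_right 0)"
    by (simp add: at_within_Icc_at_right)
  thus ?thesis by (simp add: f_def)
qed

section \<open>Analytic continuation\<close>

lemma J_comb_meromorphic:
  assumes pos: "p > 0" "q > 0" "a > 0" "b > 0" "c > 0"
  shows "J_comb p q a b c meromorphic_on UNIV"
proof -
  obtain \<Lambda>1 \<Lambda>2 \<Lambda>3 \<Lambda>4 where sq: "root_lambda (1\<^sup>2) \<Lambda>1" "root_lambda ((-1)\<^sup>2) \<Lambda>2"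
    "root_lambda (\<i>\<^sup>2) \<Lambda>3" "root_lambda ((-\<i>)\<^sup>2) \<Lambda>4"
    using root_lambda_squares by blast
  show ?thesis
    unfolding J_comb_def J_eqs
    by (intro meromorphic_on_mult meromorphic_on_const meromorphic_on_add meromorphic_on_diff
      J_form_meromorphic[OF root_lambda_1 sq(1) pos] J_form_meromorphic[OF root_lambda_minus_1 sq(2) pos]
      J_form_meromorphic[OF root_lambda_i sq(3) pos] J_form_meromorphic[OF root_lambda_minus_i sq(4) pos])
qed

lemma S_sum_nth:
  "S_sum F p q a b c s = (\<Sum>i<12. (-1) ^ fst (S_terms p q a b c s ! i) * F (snd (S_terms p q a b c s ! i)))"
  unfolding S_sum_def
  by (simp add: sum_list_sum_nth length_S_terms case_prod_unfold atLeast0LessThan)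

lemma fst_S_terms_nth:
  "i < 12 \<Longrightarrow> fst (S_terms p q a b c s ! i) = fst (S_terms p q a b c s' ! i)"
  by (erule less_12_cases) (simp_all add: S_terms_def Let_def)

lemma snd_S_terms_nth:
  fixes p q a b c :: nat and s :: complex
  defines "v \<equiv> \<lambda>s i. snd (S_terms p q a b c s ! i)"
  assumes "i < 12"
  shows "v s i = v 0 i + s *s (v 1 i - v 0 i)"
  using assms(2) unfolding v_def
  by (rule less_12_cases) (simp_all add: S_terms_def Let_def vec_eq_iff forall_6 vector_6)

lemma Re_S_terms_nth:
  assumes "1 \<le> p" "1 \<le> q" "1 \<le> a" "1 \<le> b" "1 \<le> c" "Re s \<ge> 1" "i < 12"
  shows "Re (snd (S_terms p q a b c s ! i) $ k) \<ge> 1"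
proof -
  have "\<forall>k. Re (snd (S_terms p q a b c s ! i) $ k) \<ge> 1"
    using assms(7) by (rule less_12_cases) (use assms(1-6) in \<open>simp_all add: S_terms_def Let_def forall_6 vector_6\<close>)
  thus ?thesis ..
qed

text \<open>Both sides are the sum of \<open>root_term\<close> over \<open>root_coset\<close>,
  evaluated by chambers on the left and by characters on the right.\<close>

lemma S_sum_eq_J_comb:
  assumes H: "is_zeta3_PU4 H" and pos: "1 \<le> p" "1 \<le> q" "1 \<le> a" "1 \<le> b" "1 \<le> c" and s: "Re s > 1"
  shows "S_sum H p q a b c s = J_comb p q a b c s"
proof -
  have sm: "zeta3_term (snd (S_terms p q a b c s ! i)) summable_on PU4_index" if "i < 12" for i
    by (rule summable_on_zeta3_term, rule Re_S_terms_nth) (use pos s that in auto)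
  have "S_sum H p q a b c s = (\<Sum>i<12. (-1) ^ fst (S_terms p q a b c s ! i) *
      infsum (zeta3_term (snd (S_terms p q a b c s ! i))) PU4_index)"
    unfolding S_sum_nth using H sm by (intro sum.cong) (auto simp: is_zeta3_PU4_def)
  moreover have "(root_term p q a b c s has_sum J_comb p q a b c s) root_coset"
    by (rule has_sum_J_comb) (use s pos in auto)
  ultimately show ?thesis
    using has_sum_root_coset[OF sm] has_sum_unique by metis
qed

lemma limit_unique_if_eventually_eq:
  fixes f g :: "complex \<Rightarrow> complex"
  assumes "\<forall>\<^sub>F z in at s. f z = g z" "f \<midarrow>s\<rightarrow> a" "g \<midarrow>s\<rightarrow> b"
  shows "a = b"
  using Lim_transform_eventually[OF assms(2,1)] assms(3) LIM_unique by blast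

lemma open_positive_orthant: "open {u :: complex^6. \<forall>k. Re (u $ k) > 0}"
proof -
  have "open {u :: complex^6. Re (u $ k) > 0}" for k
    by (intro open_Collect_less continuous_intros)
  hence "open (\<Inter>k. {u :: complex^6. Re (u $ k) > 0})" by (intro open_INT) auto
  moreover have "(\<Inter>k. {u :: complex^6. Re (u $ k) > 0}) = {u. \<forall>k. Re (u $ k) > 0}" by auto
  ultimately show ?thesis by simp
qed

theorem theorem7p4:
  fixes H :: "complex^6 \<Rightarrow> complex" and p q a b c :: nat and s :: complex
  assumes "is_zeta3_PU4 H"
    and "1 \<le> p" and "1 \<le> q" and "1 \<le> a" and "1 \<le> b" and "1 \<le> c"
    and "\<forall>(e, v) \<in> set (S_terms p q a b c s). mv_holomorphic_at H v"
    and "(\<lambda>z. 1 / 4 * (J0 p q a b c z - J1 p q a b c z + J2 p q a b c z - J3 p q a b c z))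
           analytic_on {s}"
  shows "S_sum H p q a b c s =
           1 / 4 * (J0 p q a b c s - J1 p q a b c s + J2 p q a b c s - J3 p q a b c s)"
proof -
  define E where "E = J_comb p q a b c"
  define v where "v = (\<lambda>z i. snd (S_terms p q a b c z ! i))"
  define \<sigma> where "\<sigma> = (\<lambda>i. (-1 :: complex) ^ fst (S_terms p q a b c 0 ! i))"
  define d where "d = (\<lambda>i. v 1 i - v 0 i)"
  have v_eq: "v z i = v 0 i + z *s d i" if "i < 12" for z i
    unfolding v_def d_def using snd_S_terms_nth[OF that, of p q a b c z] by simp
  have S_eq: "S_sum H p q a b c z = (\<Sum>i<12. \<sigma> i * H (v z i))" for z
    unfolding S_sum_nth \<sigma>_def v_def
    by (rule sum.cong) (use fst_S_terms_nth[of _ p q a b c z 0] in auto)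
  have mero: "mv_meromorphic H" using assms(1) by (simp add: is_zeta3_PU4_def)
  \<comment> \<open>For \<open>Re z > 1\<close> these directions do not lead out of the region of
    absolute convergence as long as \<open>t > 0\<close>.\<close>
  define W where "W = {u :: complex^6. \<forall>k. Re (u $ k) > 0}"
  have W: "open W" "W \<noteq> {}"
  proof -
    show "open W" unfolding W_def by (rule open_positive_orthant)
    have "(\<chi> k. 1) \<in> W" by (simp add: W_def)
    thus "W \<noteq> {}" by blast
  qed
  \<comment> \<open>Genericity depends on the line, so every summand receives its own direction; the
    summands are coupled only through the common parameter \<open>t\<close>.\<close>
  have "\<forall>i. \<exists>u. u \<in> W \<and> (\<forall>z\<in>closed_segment 2 s.
      mv_quotient_at (\<lambda>x::complex^2. H (v 0 i + x $ 2 *s d i + x $ 1 *s u)) (vector [0, z]))"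
  proof
    fix i
    obtain u where "u \<in> W" "\<And>z. z \<in> closed_segment 2 s \<Longrightarrow>
        mv_quotient_at (\<lambda>x::complex^2. H (v 0 i + x $ 2 *s d i + x $ 1 *s u)) (vector [0, z])"
      by (rule generic_direction[OF mero compact_segment[of 2 s] W, of "v 0 i" "d i"]) (rule that)
    thus "\<exists>u. u \<in> W \<and> (\<forall>z\<in>closed_segment 2 s.
      mv_quotient_at (\<lambda>x::complex^2. H (v 0 i + x $ 2 *s d i + x $ 1 *s u)) (vector [0, z]))" by blast
  qed
  from choice[OF this] obtain u where "\<forall>i. u i \<in> W \<and> (\<forall>z\<in>closed_segment 2 s.
      mv_quotient_at (\<lambda>x::complex^2. H (v 0 i + x $ 2 *s d i + x $ 1 *s u i)) (vector [0, z]))"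
    by (elim exE) (rule that)
  hence u: "u i \<in> W" "z \<in> closed_segment 2 s \<Longrightarrow>
      mv_quotient_at (\<lambda>x::complex^2. H (v 0 i + x $ 2 *s d i + x $ 1 *s u i)) (vector [0, z])" for i z
    by simp_all
  \<comment> \<open>The coordinates are \<open>(t, z)\<close>. The right-hand side \<open>E\<close>
    is not shifted, since it is already meromorphic in \<open>z\<close> alone.\<close>
  define \<Phi> where "\<Phi> = (\<lambda>x::complex^2.
      (\<Sum>i\<leftarrow>[0..<12]. \<sigma> i * H (v 0 i + x $ 2 *s d i + x $ 1 *s u i)) + (-1) * E (x $ 2))"
  have \<Phi>_eq: "\<Phi> (vector [complex_of_real t, z]) = (\<Sum>i<12. \<sigma> i * H (v z i + complex_of_real t *s u i)) - E z" for t z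
    unfolding \<Phi>_def interv_sum_list_conv_sum_set_nat by (simp add: v_eq[symmetric] atLeast0LessThan)
  have quot: "mv_quotient_at \<Phi> (vector [0, z])" if "z \<in> closed_segment 2 s" for z
  proof -
    have "E meromorphic_on {(vector [0, z] :: complex^2) $ 2}"
      unfolding E_def by (rule meromorphic_on_subset[OF J_comb_meromorphic]) (use assms in auto)
    thus ?thesis unfolding \<Phi>_def
      by (intro mv_quotient_at_add mv_quotient_at_sum_list mv_quotient_at_cmult u(2)[OF that]
        mv_quotient_at_meromorphic_nth)
  qed
  define good where "good = (\<lambda>z. ((\<lambda>t. \<Phi> (vector [complex_of_real t, z])) \<longlongrightarrow> 0) (at_right 0))"
  \<comment> \<open>Here \<open>H\<close> equals its series for all \<open>t \<ge> 0\<close>,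
    including \<open>t = 0\<close>, so the limit is found without any local quotient.\<close>
  have good_right: "good z" if z: "Re z > 1" for z
  proof -
    have "((\<lambda>t. H (v z i + complex_of_real t *s u i)) \<longlongrightarrow> H (v z i)) (at_right 0)" if i: "i < 12" for i
    proof -
      have Re_v: "Re (v z i $ k) \<ge> 1" for k
        unfolding v_def by (rule Re_S_terms_nth) (use assms z i in auto)
      have Re_u: "Re (u i $ k) \<ge> 0" for k using u(1)[of i] by (auto simp: W_def less_imp_le)
      have H_eq: "H (v z i + complex_of_real t *s u i) = infsum (zeta3_term (v z i + complex_of_real t *s u i)) PU4_index"
        if "t \<ge> 0" for t
      proof -
        have "Re ((v z i + complex_of_real t *s u i) $ k) \<ge> 1" for k
          using Re_v[of k] mult_nonneg_nonneg[OF that Re_u[of k]] by simp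
        thus ?thesis using assms(1) summable_on_zeta3_term by (auto simp: is_zeta3_PU4_def)
      qed
      have "H (v z i) = infsum (zeta3_term (v z i)) PU4_index" using H_eq[of 0] by simp
      moreover have "\<forall>\<^sub>F t in at_right 0. infsum (zeta3_term (v z i + complex_of_real t *s u i)) PU4_index =
          H (v z i + complex_of_real t *s u i)"
        using eventually_at_right_less[of "0::real"] by eventually_elim (simp add: H_eq)
      ultimately show ?thesis
        using Lim_transform_eventually[OF infsum_zeta3_tendsto[OF Re_v Re_u]] by simp
    qed
    hence "((\<lambda>t. \<Phi> (vector [complex_of_real t, z])) \<longlongrightarrow> (\<Sum>i<12. \<sigma> i * H (v z i)) - E z) (at_right 0)"
      unfolding \<Phi>_eq by (intro tendsto_intros) auto
    moreover have "(\<Sum>i<12. \<sigma> i * H (v z i)) - E z = 0"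
      using S_sum_eq_J_comb[OF assms(1-6) z] by (simp add: S_eq E_def)
    ultimately show ?thesis by (simp add: good_def)
  qed
  have "\<forall>\<^sub>F z in at 2. z \<in> {z. Re z > 1}"
    by (rule eventually_at_in_open') (auto simp: open_halfspace_Re_gt)
  hence "\<forall>\<^sub>F z in at 2. good z" by eventually_elim (simp add: good_right)
  hence good_s: "\<forall>\<^sub>F z in at s. good z"
    unfolding good_def by (rule quotient_limit_propagates[where a = 2 and b = s and \<Phi> = \<Phi>, rotated]) (rule quot)
  have isCont_v: "isCont (\<lambda>z. v z i) z" if "i < 12" for i z
  proof -
    have "continuous_on UNIV (\<lambda>z. v 0 i + z *s d i)" by (intro continuous_intros)
    hence "isCont (\<lambda>z. v 0 i + z *s d i) z" by (simp add: continuous_on_eq_continuous_at)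
    moreover have "(\<lambda>z. v z i) = (\<lambda>z. v 0 i + z *s d i)" by (rule ext, rule v_eq[OF that])
    ultimately show ?thesis by (simp only:)
  qed
  \<comment> \<open>Holomorphy at \<open>v s i\<close> extends to a neighbourhood, so
    \<open>H\<close> is also continuous at \<open>v z i\<close> for \<open>z\<close> near
    \<open>s\<close>. There the limit in \<open>good\<close> can be evaluated and becomes the
    identity itself.\<close>
  have isCont_H: "isCont H (v s i)" "\<forall>\<^sub>F z in at s. isCont H (v z i)" if i: "i < 12" for i
  proof -
    have "S_terms p q a b c s ! i \<in> set (S_terms p q a b c s)" using i by (simp add: length_S_terms)
    hence "mv_holomorphic_at H (v s i)"
      using assms(7) unfolding v_def by (auto simp: case_prod_unfold)
    then obtain U where U: "open U" "v s i \<in> U" "mv_holomorphic_on H U"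
      unfolding mv_holomorphic_at_def by blast
    have cont: "isCont H y" if "y \<in> U" for y
      using mv_holomorphic_on_imp_continuous_on[OF U(3)] U(1) that continuous_on_eq_continuous_at by blast
    show "isCont H (v s i)" by (rule cont[OF U(2)])
    have "\<forall>\<^sub>F z in at s. v z i \<in> U"
      by (rule topological_tendstoD[OF isCont_v[OF i, unfolded isCont_def] U(1,2)])
    thus "\<forall>\<^sub>F z in at s. isCont H (v z i)" by eventually_elim (rule cont)
  qed
  have near: "\<forall>\<^sub>F z in at s. \<forall>i\<in>{..<12}. isCont H (v z i)"
    by (intro eventually_ball_finite ballI isCont_H) auto
  have "\<forall>\<^sub>F z in at s. S_sum H p q a b c z = E z"
    using good_s near
  proof eventually_elim
    case (elim z)
    have "((\<lambda>t. H (v z i + complex_of_real t *s u i)) \<longlongrightarrow> H (v z i)) (at_right 0)" if "i < 12" for i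
    proof (rule isCont_tendsto_compose[where g = H])
      show "isCont H (v z i)" using elim that by simp
      have "continuous_on UNIV (\<lambda>t::real. v z i + complex_of_real t *s u i)" by (intro continuous_intros)
      hence "isCont (\<lambda>t::real. v z i + complex_of_real t *s u i) 0" by (simp add: continuous_on_eq_continuous_at)
      hence "((\<lambda>t. v z i + complex_of_real t *s u i) \<longlongrightarrow> v z i) (at 0)" by (simp add: isCont_def)
      thus "((\<lambda>t. v z i + complex_of_real t *s u i) \<longlongrightarrow> v z i) (at_right 0)"
        by (rule filterlim_mono) (auto simp: at_le)
    qed
    hence "((\<lambda>t. \<Phi> (vector [complex_of_real t, z])) \<longlongrightarrow> (\<Sum>i<12. \<sigma> i * H (v z i)) - E z) (at_right 0)"
      unfolding \<Phi>_eq by (intro tendsto_intros) auto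
    with elim(1) have "(\<Sum>i<12. \<sigma> i * H (v z i)) - E z = 0"
      unfolding good_def using tendsto_unique trivial_limit_at_right_real by blast
    thus ?case by (simp add: S_eq)
  qed
  \<comment> \<open>The identity is so far known for \<open>z\<close> near \<open>s\<close> but not
    at \<open>s\<close>; continuity of both sides carries it over.\<close>
  moreover have "S_sum H p q a b c \<midarrow>s\<rightarrow> S_sum H p q a b c s"
    unfolding S_eq
    by (intro tendsto_intros isCont_tendsto_compose[where g = H, OF isCont_H(1)] isCont_v[unfolded isCont_def]) auto
  moreover have "E \<midarrow>s\<rightarrow> E s"
    using analytic_at_imp_isCont[OF assms(8)] by (simp add: isCont_def E_def J_comb_def[abs_def])
  ultimately have "S_sum H p q a b c s = E s"
    by (rule limit_unique_if_eventually_eq)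
  thus ?thesis by (simp add: E_def J_comb_def)
qed

end
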